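(* For every real $\theta$ with $0\le\theta<3$, $$\#\{D\in\mathbb N:\ 1<D\le X,\ D\text{ is not a square},\ \epsilon_D\le D^{\theta}\}=o_\theta(X)\qquad (X\to\infty),$$ where $\epsilon_D$ denotes the fundamental solution of the Pell equation $T^2-DU^2=1$.
   Context: For a positive integer $D$ which is not a square, a solution $(T,U)\in\mathbb Z^2$ of the Pell equation $T^2-DU^2=1$ is identified with the real number $\eta_D=T+U\sqrt D$. The fundamental solution $\epsilon_D$ is the unique solution with $\epsilon_D>1$ such that the set of all solutions $\eta_D$ equals $\{\pm\epsilon_D^n:n\in\mathbb Z\}$. *)

theory Defs
  imports
    "HOL-Analysis.Analysis"
    "HOL-Library.Landau_Symbols"
    "HOL-Computational_Algebra.Nth_Powers"
begin

definition pell_solutions :: "nat \<Rightarrow> (int \<times> int) set" where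
  "pell_solutions D = {(T, U). T ^ 2 - int D * U ^ 2 = 1}"

text \<open>The identification of a solution with a real number is injective when \<open>D\<close> is not a square.\<close>

definition pell_real :: "nat \<Rightarrow> int \<times> int \<Rightarrow> real" where
  "pell_real D = (\<lambda>(T, U). of_int T + of_int U * sqrt (real D))"

definition is_pell_fundamental :: "nat \<Rightarrow> real \<Rightarrow> bool" where
  "is_pell_fundamental D e \<longleftrightarrow>
     e > 1 \<and>
     pell_real D ` pell_solutions D = {s * e powi n | s n. s \<in> {1, -1}}"

text \<open>Uniqueness of the fundamental solution holds for every \<open>D\<close> and is shown below; existence
  holds for positive non-square \<open>D\<close>, and only such \<open>D\<close> are of interest here.\<close>

definition pell_fundamental :: "nat \<Rightarrow> real" where
  "pell_fundamental D = (THE e. is_pell_fundamental D e)"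

lemma is_pell_fundamental_le:
  assumes "is_pell_fundamental D e" and "is_pell_fundamental D f"
  shows "f \<le> e"
proof -
  have e: "e > 1" and f: "f > 1"
    using assms by (auto simp: is_pell_fundamental_def)
  have "e = 1 * e powi 1" by simp
  then have "e \<in> {s * e powi n | s n. s \<in> {1, -1}}" by blast
  also have "\<dots> = {s * f powi n | s n. s \<in> {1, -1}}"
    using assms by (simp add: is_pell_fundamental_def)
  finally obtain s n where sn: "e = s * f powi n" and s: "s = 1 \<or> s = -1" by auto
  have pos: "f powi n > 0" using f by simp
  with sn s e have en: "e = f powi n" by auto
  have "n > 0"
  proof (rule ccontr)
    assume "\<not> n > 0"
    then have "f powi n \<le> f powi 0" using f by (intro power_int_increasing) auto
    with en e show False by simp
  qed
  then have "f powi 1 \<le> f powi n" using f by (intro power_int_increasing) auto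
  with en show ?thesis by simp
qed

lemma is_pell_fundamental_unique:
  "is_pell_fundamental D e \<Longrightarrow> is_pell_fundamental D f \<Longrightarrow> e = f"
  by (intro antisym is_pell_fundamental_le)

lemma pell_fundamental_eqI: "is_pell_fundamental D e \<Longrightarrow> pell_fundamental D = e"
  unfolding pell_fundamental_def
  by (rule the_equality) (auto intro: is_pell_fundamental_unique)

end

theory Submission
  imports Defs "HOL-Computational_Algebra.Polynomial_Factorial" "HOL-Real_Asymp.Real_Asymp"
begin

text \<open>
  Splitting \<open>(T - 1) (T + 1) = D U\<^sup>2\<close> into coprime factors turns a solution of the Pell equation with
  \<open>1 < T \<le> D\<^sup>\<theta>\<close> into a solution of \<open>b v\<^sup>2 - a u\<^sup>2 = c\<close> with \<open>c \<in> {-2, -1, 1, 2}\<close>, where \<open>a b\<close> is \<open>D\<close> or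
  \<open>D / 4\<close>. So it suffices to count the pairs \<open>(a, b)\<close> in dyadic boxes \<open>a ~ A\<close>, \<open>b ~ B\<close>, \<open>u ~ U\<close>; write
  \<open>Y = A B\<close>, and let \<open>K\<close> be a small power of \<open>Y\<close>.

  The point \<open>(v / u, a / b)\<close> lies very close to the curve \<open>t = s\<^sup>2\<close>. Cut the range of \<open>a / b\<close> into about
  \<open>Y / K\<close> cells. The pigeonhole principle yields in every cell integral binary cubic forms \<open>E\<close> and \<open>F\<close>, of
  size polynomial in \<open>Y\<close>, such that \<open>u E(a, b) + v F(a, b)\<close> is smaller than \<open>1\<close> at all points of the cell,
  hence vanishes there; this is where \<open>T < Y\<^sup>3\<close> enters. Cancelling common factors, \<open>E(a, b) = g v\<close> and
  \<open>F(a, b) = - g u\<close>, where \<open>g\<close> divides a fixed nonzero integer and therefore takes few values, and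
  \<open>b E\<^sup>2 - a F\<^sup>2 = c g\<^sup>2\<close> is the value of a form \<open>G\<close> of odd degree at \<open>(a, b)\<close>. Dirichlet's theorem covers
  the pairs in a cell by \<open>O(\<surd>K)\<close> parallel lines; each line contains few solutions for a given \<open>g\<close>, unless
  \<open>G\<close> is constant on the lines, and then \<open>g\<close> determines the line. A line with too many points has a
  direction of small height, and the pairs near such directions are few in total.
\<close>

subsection \<open>Siegel's lemma and the divisor bound\<close>

text \<open>A cell contains on average \<open>O(K)\<close> pairs, so few points on each of
  \<open>O(\<surd>K)\<close> lines is a genuine saving; the divisors of a fixed integer and the
  lines with many points must cost less than the remaining factor \<open>\<surd>K\<close>.

  The exponent \<open>3\<close> comes from comparing eight unknown coefficients with nine linear
  conditions. Put \<open>X0 = Y / K\<close> and let \<open>T = A U^2\<close> stand for the size of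
  the Pell solution. Up to constants and powers of \<open>K\<close>, the admissible coefficients
  fill a box of volume \<open>X0^30 / T^4\<close>, while the conditions cut the space of values into
  \<open>X0^27 (X0^2 + T) / T^4\<close> parts. The pigeonhole principle applies as soon as
  \<open>T\<close> is smaller than \<open>X0^3\<close> by a power of \<open>K\<close>.

  The values of \<open>g\<close> are limited by divisibility and not by size: \<open>g\<close>
  divides an integer that is polynomial in \<open>Y\<close>, and such an integer has few divisors.
  For this reason all constructions are made quantitative, with heights polynomial in
  \<open>Y\<close>, but no exponent has to be sharp.\<close>

lemma siegel_pigeonhole:
  fixes c :: "nat \<Rightarrow> nat \<Rightarrow> real" and M \<delta> \<Lambda> :: "nat \<Rightarrow> real"
  assumes M: "\<And>i. i < n \<Longrightarrow> 0 \<le> M i"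
    and \<delta>: "\<And>k. k < m \<Longrightarrow> 0 < \<delta> k"
    and \<Lambda>: "\<And>k. k < m \<Longrightarrow> (\<Sum>i<n. \<bar>c k i\<bar> * M i) \<le> \<Lambda> k"
    and less: "(\<Prod>k<m. 2 * \<Lambda> k / \<delta> k + 1) < (\<Prod>i<n. M i)"
  obtains x :: "nat \<Rightarrow> int"
  where "\<exists>i<n. x i \<noteq> 0" "\<And>i. i < n \<Longrightarrow> \<bar>real_of_int (x i)\<bar> \<le> M i"
    "\<And>k. k < m \<Longrightarrow> \<bar>\<Sum>i<n. c k i * real_of_int (x i)\<bar> < \<delta> k"
proof -
  define S where "S = (\<Pi>\<^sub>E i\<in>{..<n}. {0..\<lfloor>M i\<rfloor>})"
  define L where "L = (\<lambda>k (x::nat \<Rightarrow> int). \<Sum>i<n. c k i * real_of_int (x i))"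
  \<comment> \<open>On the box the \<open>k\<close>-th form takes values in
    \<open>[-\<Lambda> k, \<Lambda> k]\<close>; pieces of length \<open>\<delta> k\<close> turn the
    hypothesis \<open>less\<close> into more points than bins. Separate weights \<open>M i\<close>
    and tolerances \<open>\<delta> k\<close> are kept because the auxiliary cubic forms have
    coefficients of very different sizes.\<close>
  define bin where "bin = (\<lambda>x. \<lambda>k\<in>{..<m}. \<lfloor>(L k x + \<Lambda> k) / \<delta> k\<rfloor>)"
  define Bins where "Bins = (\<Pi>\<^sub>E k\<in>{..<m}. {0..\<lfloor>2 * \<Lambda> k / \<delta> k\<rfloor>})"
  have \<Lambda>0: "0 \<le> \<Lambda> k" if "k < m" for k
  proof -
    have "0 \<le> (\<Sum>i<n. \<bar>c k i\<bar> * M i)" using M by (intro sum_nonneg) auto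
    then show ?thesis using \<Lambda>[OF that] by linarith
  qed
  have finS: "finite S" unfolding S_def by (intro finite_PiE) auto
  have finB: "finite Bins" unfolding Bins_def by (intro finite_PiE) auto
  have Lb: "\<bar>L k x\<bar> \<le> \<Lambda> k" if "k < m" "x \<in> S" for k x
  proof -
    have "\<bar>L k x\<bar> \<le> (\<Sum>i<n. \<bar>c k i * real_of_int (x i)\<bar>)"
      unfolding L_def by (rule sum_abs)
    also have "\<dots> \<le> (\<Sum>i<n. \<bar>c k i\<bar> * M i)"
    proof (rule sum_mono)
      fix i assume "i \<in> {..<n}"
      then have "x i \<in> {0..\<lfloor>M i\<rfloor>}" using that(2) unfolding S_def by (rule PiE_mem[rotated])
      then have "0 \<le> x i" "x i \<le> \<lfloor>M i\<rfloor>" by auto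
      then have "0 \<le> real_of_int (x i)" "real_of_int (x i) \<le> M i" by linarith+
      then have "\<bar>real_of_int (x i)\<bar> \<le> M i" by linarith
      then show "\<bar>c k i * real_of_int (x i)\<bar> \<le> \<bar>c k i\<bar> * M i"
        by (simp add: abs_mult mult_left_mono)
    qed
    finally show ?thesis using \<Lambda>[OF that(1)] by linarith
  qed
  have binB: "bin x \<in> Bins" if "x \<in> S" for x
    unfolding Bins_def
  proof (rule PiE_I)
    fix k assume k: "k \<in> {..<m}"
    then have "\<bar>L k x\<bar> \<le> \<Lambda> k" "\<delta> k > 0" using Lb that \<delta> by auto
    then have "0 \<le> (L k x + \<Lambda> k) / \<delta> k" "(L k x + \<Lambda> k) / \<delta> k \<le> 2 * \<Lambda> k / \<delta> k"
      by (auto intro!: divide_right_mono divide_nonneg_pos)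
    then show "bin x k \<in> {0..\<lfloor>2 * \<Lambda> k / \<delta> k\<rfloor>}"
      using k by (auto simp: bin_def intro: floor_mono)
  qed (auto simp: bin_def)
  have "real (card Bins) = (\<Prod>k<m. real_of_int (\<lfloor>2 * \<Lambda> k / \<delta> k\<rfloor> + 1))"
  proof -
    have "real (card {0..\<lfloor>2 * \<Lambda> k / \<delta> k\<rfloor>}) = real_of_int (\<lfloor>2 * \<Lambda> k / \<delta> k\<rfloor> + 1)" if "k < m" for k
    proof -
      have "0 \<le> 2 * \<Lambda> k / \<delta> k" using \<Lambda>0[OF that] \<delta>[OF that] by simp
      then have "0 \<le> \<lfloor>2 * \<Lambda> k / \<delta> k\<rfloor>" by simp
      then show ?thesis by simp
    qed
    then show ?thesis unfolding Bins_def by (simp add: card_PiE)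
  qed
  also have "\<dots> \<le> (\<Prod>k<m. 2 * \<Lambda> k / \<delta> k + 1)"
  proof (rule prod_mono)
    fix k assume "k \<in> {..<m}"
    then have "0 \<le> 2 * \<Lambda> k / \<delta> k" using \<Lambda>0[of k] \<delta>[of k] by auto
    then have "0 \<le> \<lfloor>2 * \<Lambda> k / \<delta> k\<rfloor>" by simp
    then show "0 \<le> real_of_int (\<lfloor>2 * \<Lambda> k / \<delta> k\<rfloor> + 1) \<and>
      real_of_int (\<lfloor>2 * \<Lambda> k / \<delta> k\<rfloor> + 1) \<le> 2 * \<Lambda> k / \<delta> k + 1" by auto
  qed
  also have "\<dots> < (\<Prod>i<n. M i)" by (rule less)
  also have "\<dots> \<le> (\<Prod>i<n. real_of_int (\<lfloor>M i\<rfloor> + 1))"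
    using M by (intro prod_mono) auto
  also have "\<dots> = real (card S)"
  proof -
    have "real (card {0..\<lfloor>M i\<rfloor>}) = real_of_int (\<lfloor>M i\<rfloor> + 1)" if "i < n" for i
      using M[OF that] by simp
    then show ?thesis unfolding S_def by (simp add: card_PiE)
  qed
  finally have "card Bins < card S" by simp
  moreover have "card (bin ` S) \<le> card Bins"
    using binB finB by (intro card_mono) auto
  ultimately have "card (bin ` S) < card S" by simp
  then have "\<not> inj_on bin S" by (rule pigeonhole)
  then obtain x y where xy: "x \<in> S" "y \<in> S" "x \<noteq> y" "bin x = bin y"
    by (auto simp: inj_on_def)
  show ?thesis
  proof
    from xy(1-3) obtain i where "x i \<noteq> y i" by blast
    moreover from this have "i < n"
      using PiE_arb xy(1,2) unfolding S_def by (metis lessThan_iff)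
    ultimately show "\<exists>i<n. x i - y i \<noteq> 0" by auto
  next
    fix i assume "i < n"
    then have "x i \<in> {0..\<lfloor>M i\<rfloor>}" "y i \<in> {0..\<lfloor>M i\<rfloor>}"
      using PiE_mem xy(1,2) unfolding S_def by (metis lessThan_iff)+
    then have "\<bar>x i - y i\<bar> \<le> \<lfloor>M i\<rfloor>" by auto
    then show "\<bar>real_of_int (x i - y i)\<bar> \<le> M i" by linarith
  next
    fix k assume k: "k < m"
    have "bin x k = bin y k" using xy(4) by simp
    then have "\<lfloor>(L k x + \<Lambda> k) / \<delta> k\<rfloor> = \<lfloor>(L k y + \<Lambda> k) / \<delta> k\<rfloor>" using k by (simp add: bin_def)
    then have "\<bar>(L k x + \<Lambda> k) / \<delta> k - (L k y + \<Lambda> k) / \<delta> k\<bar> < 1" by linarith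
    moreover have "(L k x + \<Lambda> k) / \<delta> k - (L k y + \<Lambda> k) / \<delta> k = (L k x - L k y) / \<delta> k"
      by (simp add: diff_divide_distrib add_divide_distrib)
    ultimately have "\<bar>L k x - L k y\<bar> / \<delta> k < 1" using \<delta>[OF k] by (simp add: abs_divide)
    then have "\<bar>L k x - L k y\<bar> < \<delta> k" using \<delta>[OF k] by (simp add: divide_less_eq)
    moreover have "L k x - L k y = (\<Sum>i<n. c k i * real_of_int (x i - y i))"
      by (simp add: L_def sum_subtractf algebra_simps)
    ultimately show "\<bar>\<Sum>i<n. c k i * real_of_int (x i - y i)\<bar> < \<delta> k" by simp
  qed
qed

section \<open>The bound \<open>O(n powr \<epsilon>)\<close> for the number of divisors\<close>

lemma card_divisors_prime_power_mult:
  fixes p m :: nat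
  assumes "prime p" "m > 0"
  shows "card {d. d dvd p ^ k * m} \<le> (k + 1) * card {d. d dvd m}"
proof -
  have "{d. d dvd p ^ k * m} \<subseteq> (\<lambda>(i, d). p ^ i * d) ` ({..k} \<times> {d. d dvd m})"
  proof
    fix d assume "d \<in> {d. d dvd p ^ k * m}"
    then obtain b c where bc: "d = b * c" "b dvd p ^ k" "c dvd m"
      using division_decomp by blast
    then obtain i where "i \<le> k" "b = p ^ i"
      using divides_primepow_nat[OF assms(1)] by auto
    then show "d \<in> (\<lambda>(i, d). p ^ i * d) ` ({..k} \<times> {d. d dvd m})"
      using bc by (auto intro!: image_eqI[of _ _ "(i, c)"])
  qed
  then have "card {d. d dvd p ^ k * m} \<le> card ({..k} \<times> {d. d dvd m})"
    using assms by (intro surj_card_le) auto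
  then show ?thesis by (simp only: card_cartesian_product card_atMost Suc_eq_plus1)
qed

text \<open>For \<open>p \<ge> 2 powr (1 / \<epsilon>)\<close> the contribution \<open>k + 1\<close>
  of a prime power \<open>p^k\<close> is at most \<open>2^k \<le> (p^k) powr \<epsilon>\<close>.
  Only the boundedly many smaller primes cost a constant, each of them once.\<close>

lemma card_divisors_le_powr:
  fixes \<epsilon> :: real
  assumes "\<epsilon> > 0"
  obtains C where "C \<ge> 1" "\<And>n::nat. n > 0 \<Longrightarrow> real (card {d. d dvd n}) \<le> C * real n powr \<epsilon>"
proof -
  define N where "N = nat \<lceil>2 powr (1 / \<epsilon>)\<rceil>"
  have exp_growth: "real k + 1 \<le> 2 ^ k" for k :: nat
    by (induction k) auto
  \<comment> \<open>Since \<open>k \<epsilon> ln 2 + 1 \<le> 2 powr (k \<epsilon>)\<close>, it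
    suffices that \<open>C1\<close> bounds the ratio of \<open>k + 1\<close> to the left-hand side
    uniformly in \<open>k\<close>.\<close>
  define C1 where "C1 = max 1 (2 / (\<epsilon> * ln 2) + 1)"
  have C1: "C1 \<ge> 1" by (simp add: C1_def)
  have large: "real (k + 1) \<le> (real p ^ k) powr \<epsilon>" if "p \<ge> N" "p > 0" for p k :: nat
  proof -
    have "2 powr (1 / \<epsilon>) \<le> real p" using that unfolding N_def by linarith
    then have "(2 powr (1 / \<epsilon>)) powr \<epsilon> \<le> real p powr \<epsilon>"
      using assms by (intro powr_mono2) auto
    then have "2 \<le> real p powr \<epsilon>" using assms by (simp add: powr_powr)
    then have "2 ^ k \<le> (real p powr \<epsilon>) ^ k" by (intro power_mono) auto
    also have "\<dots> = (real p ^ k) powr \<epsilon>"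
      using that by (simp add: powr_power powr_realpow[symmetric] powr_powr mult.commute)
    finally show ?thesis using exp_growth[of k] by simp
  qed
  have small: "real (k + 1) \<le> C1 * (real p ^ k) powr \<epsilon>" if "p \<ge> 2" for p k :: nat
  proof -
    have "real k * (\<epsilon> * ln 2) + 1 \<le> exp (real k * (\<epsilon> * ln 2))"
      using exp_ge_add_one_self[of "real k * (\<epsilon> * ln 2)"] by linarith
    also have "\<dots> = 2 powr (real k * \<epsilon>)" by (simp add: powr_def mult.assoc)
    also have "\<dots> \<le> real p powr (real k * \<epsilon>)" using that assms by (intro powr_mono2) auto
    also have "\<dots> = (real p ^ k) powr \<epsilon>"
      using that by (simp add: powr_realpow[symmetric] powr_powr)
    finally have *: "real k * (\<epsilon> * ln 2) + 1 \<le> (real p ^ k) powr \<epsilon>" .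
    have "real (k + 1) \<le> (2 / (\<epsilon> * ln 2) + 1) * (real k * (\<epsilon> * ln 2) + 1)"
    proof -
      have "\<epsilon> * ln 2 > 0" using assms by simp
      then have "(2 / (\<epsilon> * ln 2) + 1) * (real k * (\<epsilon> * ln 2) + 1)
        = 2 * real k + 2 / (\<epsilon> * ln 2) + real k * (\<epsilon> * ln 2) + 1"
        using assms by (simp add: field_simps)
      moreover have "0 \<le> 2 / (\<epsilon> * ln 2)" "0 \<le> real k * (\<epsilon> * ln 2)" using assms by auto
      ultimately show ?thesis by simp
    qed
    also have "\<dots> \<le> C1 * (real p ^ k) powr \<epsilon>"
      using * assms by (intro mult_mono) (auto simp: C1_def)
    finally show ?thesis .
  qed
  \<comment> \<open>Records in the induction how often the constant \<open>C1\<close> has been paid;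
    it never exceeds \<open>N\<close>.\<close>
  define w where "w = (\<lambda>n::nat. card {p. prime p \<and> p dvd n \<and> p < N})"
  have main: "real (card {d. d dvd n}) \<le> C1 ^ w n * real n powr \<epsilon>" if "n > 0" for n
    using that
  proof (induction n rule: less_induct)
    case (less n)
    show ?case
    proof (cases "n = 1")
      case True
      then show ?thesis using C1 by simp
    next
      case False
      then obtain p where p: "prime p" "p dvd n" using prime_factor_nat by blast
      define k where "k = multiplicity p n"
      define m where "m = n div p ^ k"
      have nm: "n = p ^ k * m" unfolding m_def k_def by (simp add: multiplicity_dvd)
      have k0: "k > 0" unfolding k_def
        using p less.prems by (simp add: prime_multiplicity_gt_zero_iff)
      have pm: "\<not> p dvd m"
        unfolding m_def k_def using less.prems p
        by (metis gr_implies_not0 multiplicity_decompose not_prime_unit)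
      have m0: "m > 0" using nm less.prems by (metis gr0I mult_0_right)
      have p2: "p \<ge> 2" using p by (simp add: prime_ge_2_nat)
      have "m < n"
      proof -
        have "1 < p ^ k" using p2 k0 by (intro one_less_power) auto
        then show ?thesis using m0 nm by simp
      qed
      from less.IH[OF this m0] have IH: "real (card {d. d dvd m}) \<le> C1 ^ w m * real m powr \<epsilon>" .
      define j where "j = (if p < N then 1 else 0 :: nat)"
      have w: "w m + j \<le> w n"
      proof -
        have "{p. prime p \<and> p dvd m \<and> p < N} \<union> (if p < N then {p} else {})
          \<subseteq> {p. prime p \<and> p dvd n \<and> p < N}"
          using p nm by auto
        then have "card ({p. prime p \<and> p dvd m \<and> p < N} \<union> (if p < N then {p} else {})) \<le> w n"
          unfolding w_def by (intro card_mono) auto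
        moreover have "card ({p. prime p \<and> p dvd m \<and> p < N} \<union> (if p < N then {p} else {})) = w m + j"
          unfolding w_def j_def using pm by (subst card_Un_disjoint) auto
        ultimately show ?thesis by simp
      qed
      have kb: "real (k + 1) \<le> C1 ^ j * (real p ^ k) powr \<epsilon>"
        using small[OF p2, of k] large[of p k] p2 by (auto simp: j_def)
      have "real (card {d. d dvd n}) \<le> real (k + 1) * real (card {d. d dvd m})"
        using card_divisors_prime_power_mult[OF p(1) m0, of k] nm
        by (metis of_nat_le_iff of_nat_mult)
      also have "\<dots> \<le> (C1 ^ j * (real p ^ k) powr \<epsilon>) * (C1 ^ w m * real m powr \<epsilon>)"
        using kb IH C1 by (intro mult_mono) auto
      also have "\<dots> = C1 ^ (w m + j) * real n powr \<epsilon>"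
        unfolding nm by (simp add: powr_mult power_add mult_ac)
      also have "\<dots> \<le> C1 ^ w n * real n powr \<epsilon>"
        using w C1 by (intro mult_right_mono power_increasing) auto
      finally show ?thesis .
    qed
  qed
  show ?thesis
  proof
    show "C1 ^ N \<ge> 1" using C1 by simp
    fix n :: nat assume "n > 0"
    have "w n \<le> N"
      unfolding w_def using card_mono[of "{..<N}" "{p. prime p \<and> p dvd n \<and> p < N}"] by auto
    then have "C1 ^ w n * real n powr \<epsilon> \<le> C1 ^ N * real n powr \<epsilon>"
      using C1 by (intro mult_right_mono power_increasing) auto
    then show "real (card {d. d dvd n}) \<le> C1 ^ N * real n powr \<epsilon>"
      using main[OF \<open>n > 0\<close>] by linarith
  qed
qed

subsection \<open>Binary forms and bounded resultants\<close>

text \<open>For \<open>degree p \<le> d\<close> this is the homogenisation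
  \<open>b^d p(a / b)\<close>. The degree \<open>d\<close> is a separate argument because forms are
  compared in one fixed degree; a polynomial of smaller degree then yields a form divisible by a
  power of \<open>b\<close>.\<close>

definition homog :: "nat \<Rightarrow> int poly \<Rightarrow> int \<Rightarrow> int \<Rightarrow> int" where
  "homog d p a b = (\<Sum>i\<le>d. coeff p i * a ^ i * b ^ (d - i))"

lemma homog_0 [simp]: "homog d 0 a b = 0"
  by (simp add: homog_def)

lemma homog_add: "homog d (p + q) a b = homog d p a b + homog d q a b"
  by (simp add: homog_def sum.distrib algebra_simps)

lemma homog_diff: "homog d (p - q) a b = homog d p a b - homog d q a b"
  by (simp add: homog_def sum_subtractf algebra_simps)

lemma homog_smult: "homog d (smult c p) a b = c * homog d p a b"
  by (simp add: homog_def sum_distrib_left algebra_simps)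

lemma homog_pCons: "homog (Suc d) (pCons c p) a b = c * b ^ Suc d + a * homog d p a b"
  unfolding homog_def
  by (subst sum.atMost_Suc_shift) (simp add: sum_distrib_left algebra_simps)

lemma homog_const: "homog d [:c:] a b = c * b ^ d"
  by (cases d) (simp_all add: homog_pCons, simp add: homog_def)

lemma homog_add_degree: "degree p \<le> d \<Longrightarrow> homog (e + d) p a b = b ^ e * homog d p a b"
proof (induction p arbitrary: d)
  case (pCons c p)
  show ?case
  proof (cases d)
    case 0
    then have "p = 0" using pCons by (simp split: if_splits)
    then show ?thesis using 0 by (simp add: homog_const)
  next
    case (Suc d')
    then have "degree p \<le> d'" using pCons by (simp split: if_splits)
    then show ?thesis using Suc pCons.IH[of d'] by (simp add: homog_pCons power_add algebra_simps)
  qed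
qed simp

lemma homog_mult:
  "degree p \<le> d \<Longrightarrow> degree q \<le> e \<Longrightarrow> homog (d + e) (p * q) a b = homog d p a b * homog e q a b"
proof (induction p arbitrary: d)
  case (pCons c p)
  show ?case
  proof (cases d)
    case 0
    then have "p = 0" using pCons by (simp split: if_splits)
    then show ?thesis using 0 by (simp add: homog_const homog_smult)
  next
    case (Suc d')
    then have "degree p \<le> d'" using pCons by (simp split: if_splits)
    then have IH: "homog (d' + e) (p * q) a b = homog d' p a b * homog e q a b"
      using pCons by simp
    have "homog (d + e) (smult c q) a b = c * (b ^ d * homog e q a b)"
      using homog_add_degree[OF pCons.prems(2), of d] by (simp add: homog_smult)
    then show ?thesis
      using IH Suc by (simp add: homog_add homog_pCons algebra_simps)
  qed
qed simp

lemma homog_monom: "j \<le> d \<Longrightarrow> homog d (monom r j) a b = r * a ^ j * b ^ (d - j)"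
proof -
  assume "j \<le> d"
  then have "homog d (monom r j) a b = (\<Sum>i\<le>d. if i = j then r * a ^ j * b ^ (d - j) else 0)"
    unfolding homog_def by (intro sum.cong) auto
  then show ?thesis using \<open>j \<le> d\<close> by simp
qed

lemma homog_eq_poly:
  assumes "degree p \<le> d" "b \<noteq> 0"
  shows "real_of_int (homog d p a b)
    = real_of_int b ^ d * poly (map_poly real_of_int p) (real_of_int a / real_of_int b)"
  using assms(1)
proof (induction p arbitrary: d)
  case (pCons c p)
  show ?case
  proof (cases d)
    case 0
    then have "p = 0" using pCons by (simp split: if_splits)
    then show ?thesis using 0 by (simp add: homog_const map_poly_pCons)
  next
    case (Suc d')
    then have "degree p \<le> d'" using pCons by (simp split: if_splits)
    then show ?thesis using Suc pCons.IH[of d'] assms(2)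
      by (simp add: homog_pCons map_poly_pCons pCons.hyps field_simps)
  qed
qed simp

section \<open>Coefficient bounds by interpolation at integers\<close>

lemma real_coeff_le_of_values:
  "\<exists>C\<ge>1. \<forall>(p::real poly) A V. A \<subseteq> {..<m} \<longrightarrow> card A = Suc n \<longrightarrow> degree p \<le> n \<longrightarrow>
     (\<forall>i\<in>A. \<bar>poly p (real i)\<bar> \<le> V) \<longrightarrow> (\<forall>k. \<bar>coeff p k\<bar> \<le> C * V)"
proof (induction n)
  case 0
  have "\<bar>coeff p k\<bar> \<le> 1 * V"
    if A: "card A = Suc 0" "degree p \<le> 0" "\<forall>i\<in>A. \<bar>poly p (real i)\<bar> \<le> V"
    for p :: "real poly" and A V k
  proof -
    obtain i where i: "A = {i}" using A(1) by (auto simp: card_1_singleton_iff)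
    obtain c where c: "p = [:c:]" using A(2) degree0_coeffs by auto
    have "\<bar>c\<bar> \<le> V" using A(3) i c by auto
    then show ?thesis using c by (cases k) auto
  qed
  then show ?case by (intro exI[of _ 1]) (simp only: order_refl simp_thms, blast)
next
  case (Suc n)
  from Suc.IH obtain C where C: "C \<ge> 1" and IH': "\<forall>(p::real poly) A V. A \<subseteq> {..<m} \<longrightarrow>
     card A = Suc n \<longrightarrow> degree p \<le> n \<longrightarrow> (\<forall>i\<in>A. \<bar>poly p (real i)\<bar> \<le> V) \<longrightarrow>
     (\<forall>k. \<bar>coeff p k\<bar> \<le> C * V)"
    by (elim exE conjE)
  note IH = IH'[rule_format]
  \<comment> \<open>One step of Newton interpolation: subtract the value at a node \<open>i\<close>
    and divide by \<open>X - i\<close>. The nodes are distinct integers, so the quotient is at most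
    \<open>2 V\<close> at the others, and multiplying back by \<open>X - i\<close> with
    \<open>i < m\<close> costs a factor \<open>m + 1\<close>.\<close>
  define C' where "C' = 1 + 2 * (real m + 1) * C"
  have "\<bar>coeff p k\<bar> \<le> C' * V"
    if A: "A \<subseteq> {..<m}" "card A = Suc (Suc n)" "degree p \<le> Suc n"
      "\<forall>i\<in>A. \<bar>poly p (real i)\<bar> \<le> V"
    for p :: "real poly" and A V k
  proof -
    have "A \<noteq> {}" using A(2) by auto
    then obtain i where i: "i \<in> A" by auto
    have V0: "0 \<le> V" using A(4) i by (meson abs_ge_zero order_trans)
    have "poly (p - [:poly p (real i):]) (real i) = 0" by simp
    then obtain q where q: "p - [:poly p (real i):] = [:- real i, 1:] * q"
      using poly_eq_0_iff_dvd by (metis dvdE)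
    then have p: "p = [:poly p (real i):] + [:- real i, 1:] * q" by (simp add: algebra_simps)
    have dq: "degree q \<le> n"
    proof (cases "q = 0")
      case False
      then have "degree ([:- real i, 1:] * q) = Suc (degree q)"
        by (subst degree_mult_eq) auto
      moreover have "degree (p - [:poly p (real i):]) \<le> Suc n"
        using A(3) by (intro degree_diff_le) auto
      ultimately show ?thesis using q by simp
    qed simp
    have "\<bar>poly q (real l)\<bar> \<le> 2 * V" if l: "l \<in> A - {i}" for l
    proof -
      have "poly p (real l) = poly p (real i) + (real l - real i) * poly q (real l)"
        by (subst p) (simp add: algebra_simps)
      then have "\<bar>real l - real i\<bar> * \<bar>poly q (real l)\<bar> = \<bar>poly p (real l) - poly p (real i)\<bar>"
        by (simp add: abs_mult[symmetric])
      also have "\<dots> \<le> 2 * V"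
      proof -
        have "\<bar>poly p (real l)\<bar> \<le> V" "\<bar>poly p (real i)\<bar> \<le> V" using A(4) i l by auto
        then show ?thesis by linarith
      qed
      finally have 1: "\<bar>real l - real i\<bar> * \<bar>poly q (real l)\<bar> \<le> 2 * V" .
      have "1 \<le> \<bar>real l - real i\<bar>" using l by (cases "l < i") auto
      then have "1 * \<bar>poly q (real l)\<bar> \<le> \<bar>real l - real i\<bar> * \<bar>poly q (real l)\<bar>"
        by (intro mult_right_mono) auto
      then show ?thesis using 1 by linarith
    qed
    moreover have "card (A - {i}) = Suc n" using A(2) i by simp
    ultimately have cq: "\<bar>coeff q k\<bar> \<le> C * (2 * V)" for k
      using IH[of "A - {i}" q "2 * V" k] A(1) dq by (meson Diff_subset order_trans)
    have "\<bar>coeff [:poly p (real i):] k\<bar> \<le> V" using A(4) i V0 by (cases k) auto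
    moreover have "\<bar>coeff ([:- real i, 1:] * q) k\<bar> \<le> real m * (C * (2 * V)) + C * (2 * V)"
    proof -
      have "coeff ([:- real i, 1:] * q) k = - real i * coeff q k + coeff (pCons 0 q) k"
        by (simp)
      moreover have "\<bar>real i * coeff q k\<bar> \<le> real m * (C * (2 * V))"
        using cq[of k] A(1) i V0 C by (auto simp: abs_mult intro!: mult_mono)
      moreover have "\<bar>coeff (pCons 0 q) k\<bar> \<le> C * (2 * V)"
        using cq[of "k - 1"] V0 C by (cases k) auto
      ultimately show ?thesis by linarith
    qed
    moreover have "coeff p k = coeff [:poly p (real i):] k + coeff ([:- real i, 1:] * q) k"
      using arg_cong[OF p, of "\<lambda>r. coeff r k"] by (simp only: coeff_add)
    ultimately have "\<bar>coeff p k\<bar> \<le> V + (real m * (C * (2 * V)) + C * (2 * V))"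
      by linarith
    then show ?thesis by (simp add: C'_def algebra_simps)
  qed
  moreover have "C' \<ge> 1" using C by (simp add: C'_def)
  ultimately show ?case by (intro exI[of _ C'] conjI allI impI)
qed

text \<open>At an integer where \<open>f = g h\<close> does not vanish,
  \<open>\<bar>h\<bar> \<ge> 1\<close> and hence \<open>\<bar>g\<bar> \<le> \<bar>f\<bar>\<close>;
  interpolation at such integers bounds the coefficients of \<open>g\<close>. This keeps the
  cofactors of a gcd of two forms polynomially bounded.\<close>

lemma int_poly_factor_coeff_bound:
  "\<exists>C::real. C \<ge> 1 \<and> (\<forall>(f :: int poly) g M k. g dvd f \<longrightarrow> f \<noteq> 0 \<longrightarrow> degree f \<le> n \<longrightarrow>
     (\<forall>i. \<bar>real_of_int (coeff f i)\<bar> \<le> M) \<longrightarrow> \<bar>real_of_int (coeff g k)\<bar> \<le> C * M)"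
proof -
  \<comment> \<open>Among \<open>2 n + 1\<close> integers at most \<open>n\<close> are roots of
    \<open>f\<close>, so \<open>n + 1\<close> nodes remain.\<close>
  define m where "m = 2 * n + 1"
  from real_coeff_le_of_values[of m n] obtain C where C: "C \<ge> 1"
    and interp': "\<forall>(p::real poly) A V. A \<subseteq> {..<m} \<longrightarrow>
     card A = Suc n \<longrightarrow> degree p \<le> n \<longrightarrow> (\<forall>i\<in>A. \<bar>poly p (real i)\<bar> \<le> V) \<longrightarrow>
     (\<forall>k. \<bar>coeff p k\<bar> \<le> C * V)"
    by (elim exE conjE)
  note interp = interp'[rule_format]
  define C' where "C' = C * (real (n + 1) * real m ^ n)"
  have "1 \<le> real m ^ n" by (simp add: m_def)
  then have "1 * 1 \<le> real (n + 1) * real m ^ n" by (intro mult_mono) auto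
  then have "C' \<ge> 1" using C mult_mono[of 1 C 1 "real (n + 1) * real m ^ n"] by (simp add: C'_def)
  moreover have "\<bar>real_of_int (coeff g k)\<bar> \<le> C' * M"
    if fg: "g dvd f" "f \<noteq> 0" "degree f \<le> n" and M': "\<forall>i. \<bar>real_of_int (coeff f i)\<bar> \<le> M"
    for f g :: "int poly" and M k
  proof -
    note M = M'[rule_format]
    have M0: "0 \<le> M" using M[of 0] by linarith
    define Z where "Z = {i. i < m \<and> poly f (int i) = 0}"
    have "card Z \<le> card {x. poly f x = 0}"
      unfolding Z_def using fg(2) poly_roots_finite by (intro card_inj_on_le[of int]) auto
    also have "\<dots> \<le> n" by (rule order_trans[OF card_poly_roots_bound[OF fg(2)] fg(3)])
    finally have "card Z \<le> n" .
    moreover have "finite Z" "Z \<subseteq> {..<m}" by (auto simp: Z_def)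
    ultimately have "card ({..<m} - Z) \<ge> Suc n" by (simp add: card_Diff_subset m_def)
    then obtain A where A: "A \<subseteq> {..<m} - Z" "card A = Suc n"
      by (meson obtain_subset_with_card_n)
    obtain h where h: "f = g * h" using fg(1) by (elim dvdE)
    define p where "p = map_poly real_of_int g"
    have dp: "degree p \<le> n"
      unfolding p_def
      by (rule order_trans[OF map_poly_degree_leq order_trans[OF dvd_imp_degree_le[OF fg(1,2)] fg(3)]])
    have "\<bar>poly p (real i)\<bar> \<le> real (n + 1) * real m ^ n * M" if i: "i \<in> A" for i
    proof -
      have im: "i < m" and "poly f (int i) \<noteq> 0" using i A by (auto simp: Z_def)
      then have "poly h (int i) \<noteq> 0" using h by auto
      then have "1 \<le> \<bar>poly h (int i)\<bar>" by linarith
      then have "\<bar>poly g (int i)\<bar> * 1 \<le> \<bar>poly g (int i)\<bar> * \<bar>poly h (int i)\<bar>"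
        by (intro mult_left_mono) auto
      then have "\<bar>poly g (int i)\<bar> \<le> \<bar>poly f (int i)\<bar>" by (simp add: h abs_mult)
      moreover have "poly p (real i) = real_of_int (poly g (int i))"
        unfolding p_def by (induction g) (auto simp: map_poly_pCons)
      ultimately have "\<bar>poly p (real i)\<bar> \<le> \<bar>real_of_int (poly f (int i))\<bar>" by linarith
      also have "real_of_int (poly f (int i)) = (\<Sum>j\<le>degree f. real_of_int (coeff f j) * real i ^ j)"
        by (simp add: poly_altdef)
      also have "\<bar>\<dots>\<bar> \<le> (\<Sum>j\<le>degree f. M * real m ^ n)"
      proof (rule order_trans[OF sum_abs], rule sum_mono)
        fix j assume "j \<in> {..degree f}"
        then have "real i ^ j \<le> real m ^ j" "real m ^ j \<le> real m ^ n"
          using im fg(3) by (auto intro!: power_mono power_increasing simp: m_def)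
        then show "\<bar>real_of_int (coeff f j) * real i ^ j\<bar> \<le> M * real m ^ n"
          using M[of j] M0 by (auto simp: abs_mult intro!: mult_mono)
      qed
      also have "\<dots> = real (degree f + 1) * (M * real m ^ n)" by simp
      also have "\<dots> \<le> real (n + 1) * (M * real m ^ n)"
        using fg(3) M0 by (intro mult_right_mono) auto
      finally show ?thesis by (simp add: mult_ac)
    qed
    then have "\<bar>coeff p k\<bar> \<le> C * (real (n + 1) * real m ^ n * M)"
      using interp[of A p "real (n + 1) * real m ^ n * M" k] A dp by (meson Diff_subset order_trans)
    then show ?thesis by (simp add: p_def C'_def coeff_map_poly mult_ac)
  qed
  ultimately show ?thesis by (intro exI[of _ C'] conjI allI impI)
qed

text \<open>Siegel's lemma annihilates all coefficients of \<open>S P + S' Q\<close> except the \<open>j\<close>-th one, which cannot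
  vanish as well because \<open>S\<close> and \<open>S'\<close> have degree less than \<open>d\<close>. The bound has only to be polynomial in
  \<open>M\<close>.\<close>

lemma coprime_poly_bounded_bezout:
  fixes P Q :: "int poly" and M :: real
  defines "d \<equiv> max (degree P) (degree Q)"
  assumes cop: "coprime P Q" and d1: "d \<ge> 1" and M1: "M \<ge> 1"
    and PM: "\<And>i. \<bar>real_of_int (coeff P i)\<bar> \<le> M" and QM: "\<And>i. \<bar>real_of_int (coeff Q i)\<bar> \<le> M"
    and j: "j < 2 * d"
  obtains S S' r where "degree S < d" "degree S' < d" "S * P + S' * Q = monom r j" "r \<noteq> 0"
    "\<bar>real_of_int r\<bar> \<le> (5 * real d * M) ^ (2 * d + 1)"
proof -
  \<comment> \<open>The pigeonhole count demands \<open>(5 d M M')^(2 d - 1) < M'^(2 d)\<close>,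
    that is \<open>(5 d M)^(2 d - 1) < M'\<close>.\<close>
  define M' where "M' = (5 * real d * M) ^ (2 * d)"
  have b1: "1 < 5 * real d * M"
  proof -
    have "1 * 1 \<le> real d * M" using d1 M1 by (intro mult_mono) auto
    then show ?thesis by simp
  qed
  then have M'1: "M' \<ge> 1" unfolding M'_def by (intro one_le_power) auto
  \<comment> \<open>The Sylvester matrix of \<open>P\<close> and \<open>Q\<close>: the unknowns with
    \<open>i < d\<close> are the coefficients of \<open>S\<close>, the others those of
    \<open>S'\<close>.\<close>
  define c where "c = (\<lambda>k i. if i < d then (if i \<le> k then coeff P (k - i) else 0)
     else (if i - d \<le> k then coeff Q (k - (i - d)) else 0))"
  have cM: "\<bar>real_of_int (c k i)\<bar> \<le> M" for k i
    using PM QM M1 by (auto simp: c_def)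
  \<comment> \<open>Renumbers the rows so that the \<open>j\<close>-th is left out, which leaves
    \<open>2 d - 1\<close> conditions for \<open>2 d\<close> unknowns. The matrix is integral, so
    the tolerance \<open>1\<close> already forces zeros.\<close>
  define s where "s = (\<lambda>k. if k < j then k else Suc k)"
  have "\<exists>x :: nat \<Rightarrow> int. (\<exists>i<2*d. x i \<noteq> 0) \<and> (\<forall>i<2*d. \<bar>real_of_int (x i)\<bar> \<le> M') \<and>
    (\<forall>k<2*d-1. \<bar>\<Sum>i<2*d. real_of_int (c (s k) i) * real_of_int (x i)\<bar> < 1)"
  proof (rule siegel_pigeonhole[where n = "2*d" and m = "2*d-1" and c = "\<lambda>k i. real_of_int (c (s k) i)"
        and M = "\<lambda>_. M'" and \<delta> = "\<lambda>_. 1" and \<Lambda> = "\<lambda>_. 2 * real d * (M * M')"])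
    show "(\<Sum>i<2*d. \<bar>real_of_int (c (s k) i)\<bar> * M') \<le> 2 * real d * (M * M')" for k
    proof -
      have "(\<Sum>i<2*d. \<bar>real_of_int (c (s k) i)\<bar> * M') \<le> (\<Sum>i<2*d. M * M')"
        using cM M'1 by (intro sum_mono mult_right_mono) auto
      then show ?thesis by simp
    qed
    have "1 * 1 \<le> M * M'" using M1 M'1 by (intro mult_mono) auto
    then have "1 * 1 \<le> real d * (M * M')" using d1 by (intro mult_mono) auto
    moreover have "5 * real d * M * M' = 5 * (real d * (M * M'))" by (simp add: mult_ac)
    ultimately have "2 * (2 * real d * (M * M')) / 1 + 1 \<le> 5 * real d * M * M'" by linarith
    then have "(2 * (2 * real d * (M * M')) / 1 + 1) ^ (2*d-1) \<le> (5 * real d * M * M') ^ (2*d-1)"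
      using M1 M'1 by (intro power_mono) auto
    also have "\<dots> = (5 * real d * M) ^ (2*d-1) * M' ^ (2*d-1)" by (simp add: power_mult_distrib)
    also have "\<dots> < M' * M' ^ (2*d-1)"
    proof (rule mult_strict_right_mono)
      show "(5 * real d * M) ^ (2*d-1) < M'"
        unfolding M'_def using b1 d1 by (intro power_strict_increasing) auto
    qed (use M'1 in auto)
    also have "\<dots> = M' ^ (2*d)" using d1 by (simp flip: power_Suc)
    finally show "(\<Prod>k<2*d-1. 2 * (2 * real d * (M * M')) / 1 + 1) < (\<Prod>i<2*d. M')" by simp
  qed (use M'1 in auto)
  then obtain x :: "nat \<Rightarrow> int" where x: "(\<exists>i<2*d. x i \<noteq> 0) \<and>
    (\<forall>i<2*d. \<bar>real_of_int (x i)\<bar> \<le> M') \<and>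
    (\<forall>k<2*d-1. \<bar>\<Sum>i<2*d. real_of_int (c (s k) i) * real_of_int (x i)\<bar> < 1)"
    by (rule exE)
  note x0 = x[THEN conjunct1]
    and xM = x[THEN conjunct2, THEN conjunct1, rule_format]
    and xs = x[THEN conjunct2, THEN conjunct2, rule_format]
  define S where "S = (\<Sum>i<d. monom (x i) i)"
  define S' where "S' = (\<Sum>i<d. monom (x (d + i)) i)"
  have cS: "coeff S i = (if i < d then x i else 0)" for i
    by (simp add: S_def coeff_sum)
  have cS': "coeff S' i = (if i < d then x (d + i) else 0)" for i
    by (simp add: S'_def coeff_sum)
  have dS: "degree S < d" "degree S' < d"
    using d1 by (auto intro!: le_less_trans[OF degree_le[of "d - 1"]] simp: cS cS')
  have cmul: "coeff (S * P + S' * Q) k = (\<Sum>i<2*d. c k i * x i)" for k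
  proof -
    have conv: "coeff ((\<Sum>i<d. monom (y i) i) * R) k
      = (\<Sum>i<d. (if i \<le> k then coeff R (k - i) else 0) * y i)" for y and R :: "int poly"
      by (simp add: sum_distrib_right coeff_sum coeff_monom_mult) (intro sum.cong, auto)
    have "(\<Sum>i<2*d. c k i * x i) = (\<Sum>i<d. c k i * x i) + (\<Sum>i<d. c k (d + i) * x (d + i))"
      by (simp add: mult_2 lessThan_atLeast0 sum.atLeastLessThan_concat[symmetric, of 0 d "d + d"]
          sum.shift_bounds_nat_ivl[of _ 0 d d, simplified] add.commute)
    also have "\<dots> = coeff (S * P + S' * Q) k"
      by (simp add: S_def S'_def conv c_def cong: if_cong)
    finally show ?thesis by simp
  qed
  have deg: "degree (S * P + S' * Q) < 2 * d"
  proof -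
    have "degree (S * P) < 2 * d" "degree (S' * Q) < 2 * d"
      using degree_mult_le[of S P] degree_mult_le[of S' Q] dS by (auto simp: d_def)
    then show ?thesis by (intro degree_add_less)
  qed
  define r where "r = coeff (S * P + S' * Q) j"
  have eq: "S * P + S' * Q = monom r j"
  proof (rule poly_eqI)
    fix k
    show "coeff (S * P + S' * Q) k = coeff (monom r j) k"
    proof (cases "k = j \<or> k \<ge> 2 * d")
      case True
      then show ?thesis
      proof
        assume "k = j"
        then show ?thesis by (simp add: r_def)
      next
        assume k: "k \<ge> 2 * d"
        then have "coeff (S * P + S' * Q) k = 0" using deg by (intro coeff_eq_0) simp
        then show ?thesis using k j by simp
      qed
    next
      case False
      define k' where "k' = (if k < j then k else k - 1)"
      have k': "k' < 2*d-1" "s k' = k" using False j by (auto simp: k'_def s_def)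
      have "\<bar>real_of_int (\<Sum>i<2*d. c k i * x i)\<bar> < 1" using xs[OF k'(1)] k'(2) by simp
      then have "(\<Sum>i<2*d. c k i * x i) = 0" by linarith
      then show ?thesis using cmul[of k] False by simp
    qed
  qed
  have "r \<noteq> 0"
  proof
    assume "r = 0"
    then have SPQ: "S * P = - S' * Q" using eq by (simp add: eq_neg_iff_add_eq_0)
    have *: "R = 0" if "coprime R1 R2" "R1 dvd R * R2" "degree R < degree R1" for R R1 R2 :: "int poly"
    proof -
      have "R1 dvd R" using coprime_dvd_mult_left_iff[OF that(1)] that(2) by simp
      then show ?thesis using dvd_imp_degree_le[of R1 R] that(3) by (cases "R = 0") auto
    qed
    \<comment> \<open>Whichever of \<open>P\<close> and \<open>Q\<close> attains the degree
      \<open>d\<close> divides the factor that accompanies the other one, and that factor has degree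
      less than \<open>d\<close>.\<close>
    have "S = 0 \<and> S' = 0"
    proof (cases "degree P = d")
      case True
      have "P dvd S' * Q" using SPQ by (metis dvd_minus_iff dvd_triv_right mult_minus_left)
      then have "S' = 0" using *[OF cop] dS True by simp
      moreover have "P \<noteq> 0" using True d1 by auto
      ultimately show ?thesis using SPQ by simp
    next
      case False
      then have dQ: "degree Q = d" by (simp add: d_def max_def split: if_splits)
      have "Q dvd S * P" using SPQ by simp
      then have "S = 0" using *[of Q P S] cop dS dQ by (simp add: coprime_commute)
      moreover have "Q \<noteq> 0" using dQ d1 by auto
      ultimately show ?thesis using SPQ by simp
    qed
    then have "x i = 0" if "i < 2*d" for i
      using cS[of i] cS'[of "i - d"] that by (cases "i < d") (auto split: if_splits)
    then show False using x0 by auto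
  qed
  have "\<bar>real_of_int r\<bar> = \<bar>\<Sum>i<2*d. real_of_int (c j i) * real_of_int (x i)\<bar>"
    unfolding r_def cmul by simp
  also have "\<dots> \<le> (\<Sum>i<2*d. M * M')"
    using cM xM M1 by (intro order_trans[OF sum_abs] sum_mono) (auto simp: abs_mult intro!: mult_mono)
  also have "\<dots> \<le> (5 * real d * M) * M'" using M1 M'1 by simp
  also have "\<dots> = (5 * real d * M) ^ (2 * d + 1)" by (simp add: M'_def)
  finally show ?thesis by (rule that[OF dS eq \<open>r \<noteq> 0\<close>])
qed

text \<open>The two extreme values of \<open>j\<close> show that \<open>g\<close> divides multiples of powers of \<open>b\<close> and of \<open>a\<close>; one of
  them alone would not bound the part of \<open>g\<close> composed of primes dividing \<open>b\<close>.\<close>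

lemma coprime_poly_homog_common_divisor:
  fixes P Q :: "int poly" and M :: real
  defines "d \<equiv> max (degree P) (degree Q)"
  assumes cop: "coprime P Q" and d1: "d \<ge> 1" and M1: "M \<ge> 1"
    and PM: "\<And>i. \<bar>real_of_int (coeff P i)\<bar> \<le> M" and QM: "\<And>i. \<bar>real_of_int (coeff Q i)\<bar> \<le> M"
  obtains r where "r \<noteq> 0" "\<bar>real_of_int r\<bar> \<le> (5 * real d * M) ^ (4 * d + 2)"
    "\<And>a b g. \<lbrakk>coprime a b; g dvd homog d P a b; g dvd homog d Q a b\<rbrakk> \<Longrightarrow> g dvd r"
proof -
  note bez = coprime_poly_bounded_bezout[OF cop _ M1 PM QM, folded d_def, OF d1]
  obtain S0 S0' r0 where 0: "degree S0 < d" "degree S0' < d" "S0 * P + S0' * Q = monom r0 0"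
    "r0 \<noteq> 0" "\<bar>real_of_int r0\<bar> \<le> (5 * real d * M) ^ (2 * d + 1)"
    by (rule bez[of 0]) (use d1 in auto)
  obtain S1 S1' r1 where 1: "degree S1 < d" "degree S1' < d" "S1 * P + S1' * Q = monom r1 (2 * d - 1)"
    "r1 \<noteq> 0" "\<bar>real_of_int r1\<bar> \<le> (5 * real d * M) ^ (2 * d + 1)"
    by (rule bez[of "2 * d - 1"]) (use d1 in auto)
  have dd: "degree P \<le> d" "degree Q \<le> d" by (auto simp: d_def)
  have comb: "g dvd homog (2 * d - 1) (S * P + S' * Q) a b"
    if "degree S < d" "degree S' < d" "g dvd homog d P a b" "g dvd homog d Q a b" for S S' g a b
  proof -
    have "2 * d - 1 = (d - 1) + d" using d1 by simp
    moreover have "homog ((d - 1) + d) (S * P) a b = homog (d - 1) S a b * homog d P a b"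
      using that dd by (intro homog_mult) auto
    moreover have "homog ((d - 1) + d) (S' * Q) a b = homog (d - 1) S' a b * homog d Q a b"
      using that dd by (intro homog_mult) auto
    ultimately show ?thesis using that(3,4) by (simp add: homog_add)
  qed
  show ?thesis
  proof
    show "r0 * r1 \<noteq> 0" using 0 1 by simp
    have "\<bar>real_of_int (r0 * r1)\<bar> \<le> (5 * real d * M) ^ (2 * d + 1) * (5 * real d * M) ^ (2 * d + 1)"
      unfolding of_int_mult abs_mult using M1 by (intro mult_mono 0(5) 1(5)) auto
    also have "\<dots> = (5 * real d * M) ^ (4 * d + 2)" by (simp flip: power_add)
    finally show "\<bar>real_of_int (r0 * r1)\<bar> \<le> (5 * real d * M) ^ (4 * d + 2)" .
  next
    fix a b g :: int
    assume ab: "coprime a b" and g: "g dvd homog d P a b" "g dvd homog d Q a b"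
    have "g dvd r0 * b ^ (2 * d - 1)"
      using comb[OF 0(1,2) g] 0(3) by (simp add: homog_monom)
    moreover have "g dvd r1 * a ^ (2 * d - 1)"
      using comb[OF 1(1,2) g] 1(3) by (simp add: homog_monom)
    ultimately have "g dvd r0 * r1 * b ^ (2 * d - 1)" "g dvd r0 * r1 * a ^ (2 * d - 1)"
      by (metis dvd_mult mult.assoc mult.commute)+
    then have "g dvd gcd (r0 * r1 * b ^ (2 * d - 1)) (r0 * r1 * a ^ (2 * d - 1))" by simp
    also have "\<dots> = normalize (r0 * r1 * gcd (b ^ (2 * d - 1)) (a ^ (2 * d - 1)))"
      by (metis gcd_mult_left normalize_mult normalize_gcd)
    also have "gcd (b ^ (2 * d - 1)) (a ^ (2 * d - 1)) = 1"
      using ab by (simp add: coprime_iff_gcd_eq_1[symmetric] coprime_commute)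
    finally show "g dvd r0 * r1" by simp
  qed
qed

text \<open>This excludes that \<open>b P\<^sup>2 - a Q\<^sup>2\<close> is a multiple of a power of \<open>a\<close>. If it were, the lines
  \<open>a = const\<close> could carry too many pairs, and for small \<open>a\<close> these are not rare.\<close>

lemma square_minus_X_times_square_neq_monom:
  fixes P Q :: "int poly"
  assumes cop: "coprime P Q" and P0: "P \<noteq> 0"
  defines "d \<equiv> max (degree P) (degree Q)"
  shows "P ^ 2 - pCons 0 (Q ^ 2) \<noteq> monom \<gamma> (2 * d + 1)"
proof
  assume eq: "P ^ 2 - pCons 0 (Q ^ 2) = monom \<gamma> (2 * d + 1)"
  have "coeff (P ^ 2) 0 = 0"
    using arg_cong[OF eq, of "\<lambda>p. coeff p 0"] by simp
  then have P00: "poly P 0 = 0" by (simp add: poly_0_coeff_0[symmetric])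
  then obtain P' where P': "P = pCons 0 P'"
    by (cases P) (auto simp: poly_0_coeff_0)
  \<comment> \<open>For \<open>d = 0\<close> the monomial would be linear, and comparing the
    coefficients of \<open>X\<close> would not give \<open>Q(0) = 0\<close>. For
    \<open>d \<ge> 1\<close> both low coefficients vanish, so that \<open>X\<close> divides
    \<open>P\<close> and then \<open>Q\<close>.\<close>
  have d1: "d \<ge> 1"
  proof (rule ccontr)
    assume "\<not> d \<ge> 1"
    then have "degree P = 0" by (simp add: d_def)
    then show False using P' P0 by (auto split: if_splits)
  qed
  have "coeff (P ^ 2 - pCons 0 (Q ^ 2)) 1 = 0" using eq d1 by simp
  moreover have "P ^ 2 = pCons 0 (pCons 0 (P' ^ 2))"
    by (simp add: P' power2_eq_square)
  ultimately have "poly Q 0 = 0" by (simp add: poly_0_coeff_0[symmetric])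
  then have "[:0, 1:] dvd Q" "[:0, 1:] dvd P" using P00 by (simp_all add: poly_eq_0_iff_dvd)
  then have "is_unit ([:0, 1:] :: int poly)" using cop coprime_common_divisor by blast
  then show False by (auto simp: is_unit_poly_iff)
qed

text \<open>Everything is uniform in \<open>E\<close> and \<open>F\<close>, because each cell has
  its own forms whereas the divisor bound needs one exponent for all of them. The alternative
  \<open>homog 3 H a b = 0\<close> collects the pairs at which the common factor \<open>H\<close> of
  \<open>E\<close> and \<open>F\<close> vanishes; there the relation carries no information on
  \<open>u\<close> and \<open>v\<close>. If \<open>d\<close> is the larger degree of the two
  cofactors, then \<open>n = 2 d + 1\<close>, which explains both the parity and the bound
  \<open>7\<close>.\<close>

lemma auxiliary_form:
  "\<exists>(C::real) N::nat. C \<ge> 1 \<and> (\<forall>(E :: int poly) F (M :: real). E \<noteq> 0 \<or> F \<noteq> 0 \<longrightarrow>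
     degree E \<le> 3 \<longrightarrow> degree F \<le> 3 \<longrightarrow> M \<ge> 1 \<longrightarrow>
     (\<forall>i. \<bar>real_of_int (coeff E i)\<bar> \<le> M \<and> \<bar>real_of_int (coeff F i)\<bar> \<le> M) \<longrightarrow>
     (\<exists>n G r H. odd n \<and> n \<le> 7 \<and> degree G \<le> n \<and> (\<forall>\<gamma>. G \<noteq> monom \<gamma> n) \<and>
       r \<noteq> 0 \<and> \<bar>real_of_int r\<bar> \<le> C * M ^ N \<and> H \<noteq> 0 \<and> degree H \<le> 3 \<and>
       (\<forall>a b u v. b > 0 \<longrightarrow> u > 0 \<longrightarrow> v > 0 \<longrightarrow> coprime a b \<longrightarrow> coprime u v \<longrightarrow>
         u * homog 3 E a b + v * homog 3 F a b = 0 \<longrightarrow> homog 3 H a b = 0 \<or>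
         (\<exists>g. g \<noteq> 0 \<and> g dvd r \<and> homog n G a b = (b * v ^ 2 - a * u ^ 2) * g ^ 2))))"
proof -
  from int_poly_factor_coeff_bound[of 3] obtain C0 :: real where C0': "C0 \<ge> 1 \<and>
    (\<forall>(f :: int poly) g M k. g dvd f \<longrightarrow> f \<noteq> 0 \<longrightarrow> degree f \<le> 3 \<longrightarrow>
     (\<forall>i. \<bar>real_of_int (coeff f i)\<bar> \<le> M) \<longrightarrow> \<bar>real_of_int (coeff g k)\<bar> \<le> C0 * M)"
    by (rule exE)
  note C0 = C0'[THEN conjunct1] and fac = C0'[THEN conjunct2, rule_format]
  \<comment> \<open>For \<open>d \<le> 3\<close> the bound \<open>(5 d M)^(4 d + 2)\<close> on
    common divisors of the values becomes \<open>(15 M)^14\<close>, applied with \<open>C0 M\<close>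
    in place of \<open>M\<close>.\<close>
  define C where "C = (15 * C0) ^ 14"
  have C1: "C \<ge> 1" using C0 unfolding C_def by (intro one_le_power) auto
  show ?thesis
  proof (rule exI[of _ C], rule exI[of _ 14], intro conjI allI impI)
    show "C \<ge> 1" by (rule C1)
    fix E F :: "int poly" and M :: real
    assume nz: "E \<noteq> 0 \<or> F \<noteq> 0" and dE: "degree E \<le> 3" and dF: "degree F \<le> 3" and M1: "M \<ge> 1"
      and "\<forall>i. \<bar>real_of_int (coeff E i)\<bar> \<le> M \<and> \<bar>real_of_int (coeff F i)\<bar> \<le> M"
    then have EM: "\<And>i. \<bar>real_of_int (coeff E i)\<bar> \<le> M" and FM: "\<And>i. \<bar>real_of_int (coeff F i)\<bar> \<le> M"
      by auto
    define H where "H = gcd E F"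
    have H0: "H \<noteq> 0" using nz by (simp add: H_def)
    define P where "P = E div H"
    define Q where "Q = F div H"
    have P: "E = H * P" and Q: "F = H * Q" by (simp_all add: P_def Q_def H_def)
    have cop: "coprime P Q"
      unfolding P_def Q_def H_def using nz by (rule div_gcd_coprime)
    define d where "d = max (degree P) (degree Q)"
    have dH: "degree H + d \<le> 3"
    proof -
      have "P \<noteq> 0 \<Longrightarrow> degree H + degree P \<le> 3" using dE H0 by (simp add: P degree_mult_eq)
      moreover have "Q \<noteq> 0 \<Longrightarrow> degree H + degree Q \<le> 3" using dF H0 by (simp add: Q degree_mult_eq)
      moreover have "P \<noteq> 0 \<or> Q \<noteq> 0" using nz P Q by auto
      ultimately show ?thesis unfolding d_def by (cases "P = 0"; cases "Q = 0") (auto simp: max_def)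
    qed
    have dPQ: "degree P \<le> d" "degree Q \<le> d" by (auto simp: d_def)
    have PM: "\<bar>real_of_int (coeff P i)\<bar> \<le> C0 * M" for i
    proof (cases "P = 0")
      case True then show ?thesis using C0 M1 by simp
    next
      case False
      then show ?thesis using fac[of P E M i] P H0 dE EM by simp
    qed
    have QM: "\<bar>real_of_int (coeff Q i)\<bar> \<le> C0 * M" for i
    proof (cases "Q = 0")
      case True then show ?thesis using C0 M1 by simp
    next
      case False
      then show ?thesis using fac[of Q F M i] Q H0 dF FM by simp
    qed
    have CM: "1 \<le> C0 * M" using mult_mono[of 1 C0 1 M] C0 M1 by simp
    have bound: "(C0 * M) ^ 1 \<le> C * M ^ 14" "1 \<le> d \<Longrightarrow> (5 * real d * (C0 * M)) ^ (4 * d + 2) \<le> C * M ^ 14"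
    proof -
      have "(C0 * M) ^ 1 \<le> (15 * (C0 * M)) ^ 1" using CM by simp
      also have "\<dots> \<le> (15 * (C0 * M)) ^ 14" using CM by (intro power_increasing) auto
      also have eq: "\<dots> = C * M ^ 14" by (simp add: C_def power_mult_distrib mult.assoc[symmetric])
      finally show "(C0 * M) ^ 1 \<le> C * M ^ 14" .
      assume "1 \<le> d"
      have "(5 * real d * (C0 * M)) ^ (4 * d + 2) \<le> (15 * (C0 * M)) ^ (4 * d + 2)"
        using dH CM by (intro power_mono mult_right_mono) auto
      also have "\<dots> \<le> (15 * (C0 * M)) ^ 14" using CM dH by (intro power_increasing) auto
      finally have "(5 * real d * (C0 * M)) ^ (4 * d + 2) \<le> (15 * (C0 * M)) ^ 14" .
      then show "(5 * real d * (C0 * M)) ^ (4 * d + 2) \<le> C * M ^ 14" by (simp only: eq)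
    qed
    have split: "homog 3 H a b = 0 \<or> (\<exists>g. homog d P a b = g * v \<and> homog d Q a b = - (g * u))"
      if uv: "u > 0" "v > 0" "coprime u v" and eq: "u * homog 3 E a b + v * homog 3 F a b = 0" and b: "b > 0"
      for a b u v :: int
    proof (cases "homog (3 - d) H a b = 0")
      case True
      have "homog (d + (3 - d)) H a b = b ^ d * homog (3 - d) H a b"
        using dH by (intro homog_add_degree) simp
      then show ?thesis using True dH by simp
    next
      case False
      have 3: "3 = (3 - d) + d" using dH by simp
      have "homog 3 E a b = homog (3 - d) H a b * homog d P a b"
        unfolding P by (subst 3, rule homog_mult) (use dH dPQ in auto)
      moreover have "homog 3 F a b = homog (3 - d) H a b * homog d Q a b"
        unfolding Q by (subst 3, rule homog_mult) (use dH dPQ in auto)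
      ultimately have "homog (3 - d) H a b * (u * homog d P a b + v * homog d Q a b) = 0"
        using eq by (simp add: algebra_simps)
      then have *: "u * homog d P a b = - (v * homog d Q a b)" using False by simp
      then have "v dvd u * homog d P a b" by simp
      then have "v dvd homog d P a b" using uv(3) by (metis coprime_commute coprime_dvd_mult_right_iff)
      then obtain g where g: "homog d P a b = g * v" by (metis dvdE mult.commute)
      then have "v * (homog d Q a b + g * u) = 0" using * by (simp add: algebra_simps)
      then have "homog d Q a b = - (g * u)" using uv by simp
      then show ?thesis using g by blast
    qed
    show "\<exists>n G r H. odd n \<and> n \<le> 7 \<and> degree G \<le> n \<and> (\<forall>\<gamma>. G \<noteq> monom \<gamma> n) \<and>
         r \<noteq> 0 \<and> \<bar>real_of_int r\<bar> \<le> C * M ^ 14 \<and> H \<noteq> 0 \<and> degree H \<le> 3 \<and>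
         (\<forall>a b u v. b > 0 \<longrightarrow> u > 0 \<longrightarrow> v > 0 \<longrightarrow> coprime a b \<longrightarrow> coprime u v \<longrightarrow>
           u * homog 3 E a b + v * homog 3 F a b = 0 \<longrightarrow> homog 3 H a b = 0 \<or>
           (\<exists>g. g \<noteq> 0 \<and> g dvd r \<and> homog n G a b = (b * v ^ 2 - a * u ^ 2) * g ^ 2))"
    proof (cases "P = 0")
      \<comment> \<open>Here \<open>E = 0\<close> and \<open>F\<close> is \<open>H\<close> up to
        sign, so the relation reads \<open>v F = 0\<close> and always ends in the first alternative;
        any admissible \<open>n\<close>, \<open>G\<close> and \<open>r\<close> will do.\<close>
      case True
      then have "is_unit Q" using cop by simp
      then obtain e where e: "Q = [:e:]" "e \<noteq> 0" by (auto simp: is_unit_poly_iff)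
      have d0: "d = 0" using True e by (simp add: d_def)
      have "homog 3 H a b = 0"
        if "b > 0" "u > 0" "v > 0" "coprime u v" "u * homog 3 E a b + v * homog 3 F a b = 0" for a b u v
        using split[OF that(2-5) that(1)] e d0 True that(2,3) by (auto simp: homog_const)
      moreover have "1 \<le> C * M ^ 14"
        using mult_mono[of 1 C 1 "M ^ 14"] C1 one_le_power[OF M1, of 14] by simp
      ultimately show ?thesis
        using H0 dH
        by (intro exI[of _ 1] exI[of _ "1 :: int poly"] exI[of _ "1::int"] exI[of _ H])
          (auto simp: monom_Suc one_pCons)
    next
      case False
      obtain r where r: "r \<noteq> 0" "\<bar>real_of_int r\<bar> \<le> C * M ^ 14"
        and rd: "\<And>a b g. \<lbrakk>coprime a b; g dvd homog d P a b; g dvd homog d Q a b\<rbrakk> \<Longrightarrow> g dvd r"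
      proof (cases "d \<ge> 1")
        case True
        obtain r where r: "r \<noteq> 0" "\<bar>real_of_int r\<bar> \<le> (5 * real d * (C0 * M)) ^ (4 * d + 2)"
          "\<And>a b g. \<lbrakk>coprime a b; g dvd homog d P a b; g dvd homog d Q a b\<rbrakk> \<Longrightarrow> g dvd r"
          using coprime_poly_homog_common_divisor[OF cop _ CM PM QM, folded d_def, OF True] by blast
        show ?thesis by (rule that[of r]) (use r bound(2)[OF True] in \<open>auto intro: order_trans\<close>)
      next
        \<comment> \<open>For \<open>d = 0\<close> the nonzero constant \<open>P\<close> is itself a
          value, and so it can serve as \<open>r\<close>.\<close>
        case False
        then have "degree P = 0" by (simp add: d_def)
        then obtain e where e: "P = [:e:]" using degree0_coeffs by auto
        show ?thesis
        proof (rule that[of e])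
          show "e \<noteq> 0" using e \<open>P \<noteq> 0\<close> by auto
          show "\<bar>real_of_int e\<bar> \<le> C * M ^ 14" using PM[of 0] bound(1) e by simp
          show "g dvd e" if "g dvd homog d P a b" for a b g
          proof -
            have "d = 0" using False by simp
            then show ?thesis using that e by (simp add: homog_const)
          qed
        qed
      qed
      define G where "G = P ^ 2 - pCons 0 (Q ^ 2)"
      have hG: "homog (2 * d + 1) G a b = b * (homog d P a b) ^ 2 - a * (homog d Q a b) ^ 2" for a b
      proof -
        have "homog (1 + (d + d)) (1 * (P * P)) a b = homog 1 1 a b * homog (d + d) (P * P) a b"
          using dPQ degree_mult_le[of P P] by (intro homog_mult) auto
        moreover have "homog (d + d) (P * P) a b = homog d P a b * homog d P a b"
          using dPQ by (intro homog_mult) auto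
        moreover have "homog (d + d) (Q * Q) a b = homog d Q a b * homog d Q a b"
          using dPQ by (intro homog_mult) auto
        moreover have "homog (Suc (d + d)) (pCons 0 (Q * Q)) a b = a * homog (d + d) (Q * Q) a b"
          by (simp add: homog_pCons)
        moreover have "homog 1 1 a b = b" by (simp add: one_pCons homog_const)
        ultimately show ?thesis
          by (simp add: G_def homog_diff power2_eq_square mult_2)
      qed
      have dG: "degree G \<le> 2 * d + 1"
      proof -
        have "degree (P * P) \<le> 2 * d + 1" "degree (Q * Q) \<le> 2 * d"
          using degree_mult_le[of P P] degree_mult_le[of Q Q] dPQ by auto
        then show ?thesis
          unfolding G_def power2_eq_square by (intro degree_diff_le) (auto intro: order_trans[OF degree_pCons_le])
      qed
      have main: "homog 3 H a b = 0 \<or>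
           (\<exists>g. g \<noteq> 0 \<and> g dvd r \<and> homog (2*d+1) G a b = (b * v ^ 2 - a * u ^ 2) * g ^ 2)"
        if "b > 0" "u > 0" "v > 0" "coprime a b" "coprime u v" "u * homog 3 E a b + v * homog 3 F a b = 0"
        for a b u v
      proof -
        from split[OF that(2,3,5,6,1)] consider "homog 3 H a b = 0"
          | g where "homog d P a b = g * v" "homog d Q a b = - (g * u)" by blast
        then show ?thesis
        proof cases
          case 2
          have gr: "g dvd r" using rd[OF that(4)] 2 by simp
          moreover have "g \<noteq> 0"
          proof
            assume "g = 0"
            then have "homog d P a b = 0" "homog d Q a b = 0" using 2 by auto
            \<comment> \<open>If both values were \<open>0\<close>, every integer would be a common
              divisor of them; but \<open>\<bar>r\<bar> + 1\<close> cannot divide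
              \<open>r \<noteq> 0\<close>.\<close>
            then have "\<bar>r\<bar> + 1 dvd r" using rd[OF that(4), of "\<bar>r\<bar> + 1"] by simp
            then show False using r(1) zdvd_imp_le[of "\<bar>r\<bar> + 1" "\<bar>r\<bar>"] by simp
          qed
          moreover have "homog (2*d+1) G a b = (b * v ^ 2 - a * u ^ 2) * g ^ 2"
            by (simp only: hG 2) (simp add: power_mult_distrib algebra_simps)
          ultimately show ?thesis by blast
        qed simp
      qed
      have "\<forall>\<gamma>. G \<noteq> monom \<gamma> (2 * d + 1)"
        using square_minus_X_times_square_neq_monom[OF cop False] by (simp add: G_def d_def)
      then show ?thesis
        using r H0 dH dG main
        by (intro exI[of _ "2 * d + 1"] exI[of _ G] exI[of _ r] exI[of _ H]) simp
    qed
  qed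
qed

subsection \<open>Pairs on parallel lines\<close>

text \<open>As \<open>p\<close> and \<open>q\<close> are coprime, the line fixes \<open>b\<close>
  modulo \<open>q\<close>, so \<open>b div q\<close> separates its points.\<close>

lemma card_lattice_line:
  fixes p q j :: int and B :: real
  assumes cop: "coprime p q" and q: "q \<ge> 1" and B: "B \<ge> 0"
    and T: "\<And>a b. (a, b) \<in> T \<Longrightarrow> a * q - b * p = j \<and> 0 < b \<and> real_of_int b < 2 * B"
  shows "finite T" "real (card T) \<le> 2 * B / real_of_int q + 1"
proof -
  define f where "f = (\<lambda>(a::int, b::int). b div q)"
  have inj: "inj_on f T"
  proof (rule inj_onI, clarify)
    fix a b a' b' assume z: "(a, b) \<in> T" "(a', b') \<in> T" and eq: "f (a, b) = f (a', b')"
    have "(a - a') * q = (b - b') * p" using T[OF z(1)] T[OF z(2)] by (simp add: algebra_simps)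
    then have "q dvd (b - b') * p" by (metis dvd_triv_right)
    then have "q dvd b - b'" using cop by (simp add: coprime_commute coprime_dvd_mult_left_iff)
    then have "b mod q = b' mod q" by (simp add: mod_eq_dvd_iff)
    then have b: "b = b'" using eq unfolding f_def by (metis div_mult_mod_eq prod.simps(2))
    moreover have "a * q = j + b * p" "a' * q = j + b' * p"
      using T[OF z(1)] T[OF z(2)] by linarith+
    ultimately have "a * q = a' * q" by simp
    then show "a = a' \<and> b = b'" using b q by simp
  qed
  have sub: "f ` T \<subseteq> {0..\<lfloor>2 * B / real_of_int q\<rfloor>}"
  proof clarify
    fix a b assume z: "(a, b) \<in> T"
    have "real_of_int (b div q) \<le> real_of_int b / real_of_int q" by (rule real_of_int_div4)
    also have "\<dots> \<le> 2 * B / real_of_int q" using T[OF z] q by (intro divide_right_mono) auto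
    finally have "b div q \<le> \<lfloor>2 * B / real_of_int q\<rfloor>" by (simp add: le_floor_iff)
    moreover have "0 \<le> b div q" using T[OF z] q by (simp add: pos_imp_zdiv_nonneg_iff)
    ultimately show "f (a, b) \<in> {0..\<lfloor>2 * B / real_of_int q\<rfloor>}" by (simp add: f_def)
  qed
  show "finite T" using inj sub by (metis finite_atLeastAtMost_int finite_imageD finite_subset)
  have "card T = card (f ` T)" using inj by (simp add: card_image)
  also have "\<dots> \<le> card {0..\<lfloor>2 * B / real_of_int q\<rfloor>}" using sub by (intro card_mono) auto
  also have "\<dots> = nat (\<lfloor>2 * B / real_of_int q\<rfloor> + 1)" by simp
  finally have "real (card T) \<le> real (nat (\<lfloor>2 * B / real_of_int q\<rfloor> + 1))" by simp
  also have "\<dots> = real_of_int (\<lfloor>2 * B / real_of_int q\<rfloor> + 1)"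
    using q B by simp
  also have "\<dots> \<le> 2 * B / real_of_int q + 1" by simp
  finally show "real (card T) \<le> 2 * B / real_of_int q + 1" .
qed

text \<open>A line \<open>a q - b p = j\<close> carries about \<open>B / q\<close> pairs, too many
  if \<open>q\<close> is small; this set collects the pairs on such lines. The condition
  \<open>1 \<le> p\<close> leaves out the direction \<open>0 / 1\<close>, whose lines are
  \<open>a = j\<close>: for small \<open>A\<close> they would cover the whole box, and they have to
  be treated through the shape of the form \<open>G\<close> instead.\<close>

definition near_small_fractions :: "real \<Rightarrow> real \<Rightarrow> real \<Rightarrow> nat \<Rightarrow> (int \<times> int) set" where
  "near_small_fractions A B Q J =
    {(a, b). 0 < a \<and> real_of_int a < 2 * A \<and> B \<le> real_of_int b \<and> real_of_int b < 2 * B \<and>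
      (\<exists>p q. 1 \<le> p \<and> 1 \<le> q \<and> real_of_int q \<le> Q \<and> coprime p q \<and> \<bar>a * q - b * p\<bar> \<le> int J)}"

text \<open>A line with denominator \<open>q\<close> holds at most \<open>3 B / q\<close> pairs and
  there are at most \<open>4 A q / B\<close> numerators, so every \<open>q\<close> contributes
  equally. Compared with the trivial bound of order \<open>A B\<close>, the gain is about
  \<open>B / (J Q)\<close>.\<close>

lemma card_near_small_fractions:
  fixes A B Q :: real and J :: nat
  assumes A: "A > 0" and B: "2 * real J \<le> B" "B > 0" and Q: "Q \<le> B" "Q \<ge> 0"
  defines "Bad \<equiv> near_small_fractions A B Q J"
  shows "finite Bad" "real (card Bad) \<le> 12 * A * (2 * real J + 1) * Q"
proof -
  define T where "T = (\<lambda>(q::int) (p::int) (j::int). {(a::int, b::int). coprime p q \<and> a * q - b * p = j \<and>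
    0 < b \<and> real_of_int b < 2 * B})"
  have finT: "finite (T q p j)" and cardT: "real (card (T q p j)) \<le> 2 * B / real_of_int q + 1"
    if "q \<ge> 1" for q p j
  proof -
    have "finite (T q p j) \<and> real (card (T q p j)) \<le> 2 * B / real_of_int q + 1"
    proof (cases "coprime p q")
      case True
      show ?thesis
        using card_lattice_line[OF True that, of B "T q p j" j] B by (auto simp: T_def)
    next
      case False
      then show ?thesis using B that by (simp add: T_def)
    qed
    then show "finite (T q p j)" "real (card (T q p j)) \<le> 2 * B / real_of_int q + 1" by auto
  qed
  define Pq where "Pq = (\<lambda>q::int. {1..\<lfloor>4 * A * real_of_int q / B\<rfloor>})"
  define U where "U = (\<Union>q\<in>{1..\<lfloor>Q\<rfloor>}. \<Union>p\<in>Pq q. \<Union>j\<in>{- int J..int J}. T q p j)"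
  have sub: "Bad \<subseteq> U"
  proof clarify
    fix a b assume "(a, b) \<in> Bad"
    then obtain p q where a: "0 < a" "real_of_int a < 2 * A" and b: "B \<le> real_of_int b" "real_of_int b < 2 * B"
      and p: "1 \<le> p" and q: "1 \<le> q" "real_of_int q \<le> Q" and cop: "coprime p q"
      and J: "\<bar>a * q - b * p\<bar> \<le> int J"
      unfolding Bad_def near_small_fractions_def by blast
    have "real_of_int (b * p) \<le> real_of_int (a * q) + real J" using J by linarith
    moreover have "B * real_of_int p \<le> real_of_int b * real_of_int p" using b p by (intro mult_right_mono) auto
    moreover have "real_of_int a * real_of_int q \<le> 2 * A * real_of_int q" using a q by (intro mult_right_mono) auto
    \<comment> \<open>Because \<open>p \<ge> 1\<close> and \<open>2 J \<le> B\<close>, the error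
      \<open>J\<close> is at most half of \<open>B p\<close> and can be absorbed on the
      left.\<close>
    moreover have "B * 1 \<le> B * real_of_int p" using p B by (intro mult_left_mono) auto
    ultimately have "B * real_of_int p \<le> 4 * A * real_of_int q"
      using B unfolding of_int_mult by linarith
    then have "real_of_int p \<le> 4 * A * real_of_int q / B" using B by (simp add: field_simps)
    then have "p \<in> Pq q" using p by (simp add: Pq_def le_floor_iff)
    moreover have "q \<in> {1..\<lfloor>Q\<rfloor>}" using q by (simp add: le_floor_iff)
    moreover have "a * q - b * p \<in> {- int J..int J}" using J by auto
    moreover have "(a, b) \<in> T q p (a * q - b * p)" using a b cop B by (auto simp: T_def)
    ultimately show "(a, b) \<in> U" unfolding U_def by blast
  qed
  have finU: "finite U" unfolding U_def Pq_def using finT by auto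
  show "finite Bad" using sub finU by (rule finite_subset)
  have "real (card Bad) \<le> real (card U)" using sub finU by (simp add: card_mono)
  also have "real (card U) \<le> real (\<Sum>q\<in>{1..\<lfloor>Q\<rfloor>}. \<Sum>p\<in>Pq q. \<Sum>j\<in>{- int J..int J}. card (T q p j))"
    unfolding U_def of_nat_le_iff
    by (intro order_trans[OF card_UN_le] sum_mono) (auto simp: Pq_def)
  also have "\<dots> = (\<Sum>q\<in>{1..\<lfloor>Q\<rfloor>}. \<Sum>p\<in>Pq q. \<Sum>j\<in>{- int J..int J}. real (card (T q p j)))" by simp
  also have "\<dots> \<le> (\<Sum>q\<in>{1..\<lfloor>Q\<rfloor>}. 12 * A * (2 * real J + 1))"
  proof (rule sum_mono)
    fix q assume "q \<in> {1..\<lfloor>Q\<rfloor>}"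
    then have q: "1 \<le> q" "real_of_int q \<le> Q" by (auto simp: le_floor_iff)
    have le: "2 * B / real_of_int q + 1 \<le> 3 * B / real_of_int q"
      using q Q by (simp add: field_simps)
    have "(\<Sum>p\<in>Pq q. \<Sum>j\<in>{- int J..int J}. real (card (T q p j)))
      \<le> (\<Sum>p\<in>Pq q. \<Sum>j\<in>{- int J..int J}. 3 * B / real_of_int q)"
      using cardT[OF q(1)] le by (intro sum_mono) (meson order_trans)
    also have "\<dots> = real (card (Pq q)) * ((2 * real J + 1) * (3 * B / real_of_int q))" by simp
    also have "real (card (Pq q)) \<le> 4 * A * real_of_int q / B"
    proof -
      have "0 \<le> 4 * A * real_of_int q / B" using A B q by simp
      then have "0 \<le> \<lfloor>4 * A * real_of_int q / B\<rfloor>" by simp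
      then show ?thesis by (simp add: Pq_def)
    qed
    then have "real (card (Pq q)) * ((2 * real J + 1) * (3 * B / real_of_int q))
      \<le> 4 * A * real_of_int q / B * ((2 * real J + 1) * (3 * B / real_of_int q))"
      using B q by (intro mult_right_mono) auto
    also have "\<dots> = 12 * A * (2 * real J + 1)" using B q by (simp add: field_simps)
    finally show "(\<Sum>p\<in>Pq q. \<Sum>j\<in>{- int J..int J}. real (card (T q p j))) \<le> 12 * A * (2 * real J + 1)" .
  qed
  also have "\<dots> = real (nat \<lfloor>Q\<rfloor>) * (12 * A * (2 * real J + 1))" by simp
  also have "\<dots> \<le> Q * (12 * A * (2 * real J + 1))"
    using Q A by (intro mult_right_mono) auto
  finally show "real (card Bad) \<le> 12 * A * (2 * real J + 1) * Q" by (simp add: mult_ac)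
qed

text \<open>On the line \<open>a q - b p = j\<close> the form equals \<open>j\<^sup>n f(b / (j q))\<close> with a polynomial \<open>f\<close> that does not
  depend on \<open>j\<close>. The two alternatives correspond to \<open>f\<close> being nonconstant or constant; in the latter case
  \<open>j\<^sup>n\<close>, and hence \<open>j\<close> because \<open>n\<close> is odd, is determined by \<open>g\<close>.\<close>

lemma card_form_values_on_lines:
  fixes G :: "int poly" and c p q r :: int and B :: real and J :: nat
  assumes n: "odd n" "n \<le> 7" and G: "degree G \<le> n" "\<forall>\<gamma>. G \<noteq> monom \<gamma> n"
    and c: "c \<noteq> 0" and r: "r \<noteq> 0" and pq: "coprime p q" "p \<ge> 0" "q \<ge> 1" and B: "B \<ge> 0"
    and S: "\<And>a b. (a, b) \<in> S \<Longrightarrow> 0 < a \<and> 0 < b \<and> coprime a b \<and> real_of_int b < 2 * B \<and>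
        \<bar>a * q - b * p\<bar> \<le> int J \<and> (\<exists>g. g \<noteq> 0 \<and> g dvd r \<and> homog n G a b = c * g ^ 2)"
  shows "real (card S) \<le> 1 + 7 * real (card {g. g dvd r}) * (2 * real J + 1) \<or>
    p \<ge> 1 \<and> real (card S) \<le> 1 + real (card {g. g dvd r}) * (2 * B / real_of_int q + 1)"
proof -
  define \<tau> where "\<tau> = card {g. g dvd r}"
  have fin_r: "finite {g. g dvd r}" using r by simp
  have n0: "n > 0" using n by (cases n) auto
  \<comment> \<open>With \<open>x = b / (j q)\<close> the line gives
    \<open>a / j = 1 / q + p x\<close> and \<open>b / j = q x\<close>. Thus \<open>f(x)\<close> is
    the value of the form \<open>G\<close> at this point, and homogeneity takes out
    \<open>j^n\<close>.\<close>
  define f :: "real poly" where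
    "f = (\<Sum>i\<le>n. smult (real_of_int (coeff G i))
      ([:1 / real_of_int q, real_of_int p:] ^ i * [:0, real_of_int q:] ^ (n - i)))"
  have deg_f: "degree f \<le> n"
  proof -
    have "degree ([:1 / real_of_int q, real_of_int p:] ^ i * [:0, real_of_int q:] ^ (n - i)) \<le> n"
      if "i \<le> n" for i
    proof -
      have "degree ([:1 / real_of_int q, real_of_int p:] ^ i) \<le> 1 * i"
        by (rule order_trans[OF degree_power_le]) (auto intro!: mult_right_mono)
      moreover have "degree ([:0, real_of_int q:] ^ (n - i)) \<le> 1 * (n - i)"
        by (rule order_trans[OF degree_power_le]) (auto intro!: mult_right_mono)
      ultimately show ?thesis
        using degree_mult_le[of "[:1 / real_of_int q, real_of_int p:] ^ i" "[:0, real_of_int q:] ^ (n - i)"] that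
        by linarith
    qed
    then show ?thesis unfolding f_def by (intro degree_sum_le) (auto intro: order_trans[OF degree_smult_le])
  qed
  have key: "real_of_int (homog n G a b)
      = real_of_int (a * q - b * p) ^ n * poly f (real_of_int b / (real_of_int (a * q - b * p) * real_of_int q))"
    if j: "a * q - b * p \<noteq> 0" for a b
  proof -
    define j where "j = real_of_int (a * q - b * p)"
    have j0: "j \<noteq> 0" unfolding j_def of_int_eq_0_iff by (rule j)
    have aj: "1 / real_of_int q + real_of_int b / (j * real_of_int q) * real_of_int p = real_of_int a / j"
    proof -
      have "real_of_int a * real_of_int q = j + real_of_int b * real_of_int p" by (simp add: j_def)
      then show ?thesis using j0 pq by (simp add: field_simps)
    qed
    have bj: "real_of_int b / (j * real_of_int q) * real_of_int q = real_of_int b / j" using pq by simp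
    have "j ^ n * poly f (real_of_int b / (j * real_of_int q))
      = j ^ n * (\<Sum>i\<le>n. real_of_int (coeff G i) * ((real_of_int a / j) ^ i * (real_of_int b / j) ^ (n - i)))"
      using aj bj by (simp add: f_def poly_sum mult.commute)
    also have "\<dots> = (\<Sum>i\<le>n. real_of_int (coeff G i) * real_of_int a ^ i * real_of_int b ^ (n - i))"
      unfolding sum_distrib_left
    proof (rule sum.cong)
      fix i assume i: "i \<in> {..n}"
      have "j ^ n = j ^ i * j ^ (n - i)" using i by (simp flip: power_add)
      then show "j ^ n * (real_of_int (coeff G i) * ((real_of_int a / j) ^ i * (real_of_int b / j) ^ (n - i)))
        = real_of_int (coeff G i) * real_of_int a ^ i * real_of_int b ^ (n - i)"
        using j0 by (simp add: power_divide)
    qed simp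
    also have "\<dots> = real_of_int (homog n G a b)" by (simp add: homog_def)
    finally show ?thesis by (simp add: j_def)
  qed
  define S1 where "S1 = {(a, b) \<in> S. a * q - b * p \<noteq> 0}"
  define V where "V = (\<lambda>g j. {(a, b) \<in> S1. a * q - b * p = j \<and> homog n G a b = c * g ^ 2})"
  have finV: "finite (V g j)" and cardV: "real (card (V g j)) \<le> 2 * B / real_of_int q + 1" for g j
    using card_lattice_line[OF pq(1,3) B, of "V g j" j] S by (auto simp: V_def S1_def)
  have S1V: "S1 = (\<Union>(g, j)\<in>{g. g dvd r \<and> g \<noteq> 0} \<times> {- int J..int J}. V g j)"
    using S by (fastforce simp: V_def S1_def abs_le_iff)
  have finS1: "finite S1" unfolding S1V using finV fin_r by (auto intro: finite_subset[of _ "{g. g dvd r}"])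
  \<comment> \<open>On the line through the origin the only positive coprime pair is
    \<open>(p, q)\<close>; this accounts for the summand \<open>1\<close> in both bounds.\<close>
  have "S \<subseteq> insert (p, q) S1"
  proof clarify
    fix a b assume z: "(a, b) \<in> S" "(a, b) \<notin> S1"
    then have "a * q = b * p" by (simp add: S1_def)
    moreover have "coprime a b" "0 < a" "0 < b" using S[OF z(1)] by auto
    ultimately have eq: "a * q = b * p" and ab: "coprime a b" "coprime b a" "0 < a" "0 < b"
      by (auto simp: coprime_commute)
    have qp: "coprime q p" using pq(1) by (simp add: coprime_commute)
    have "a dvd b * p" "b dvd a * q" "q dvd p * b" "p dvd q * a"
      using eq by (metis dvd_triv_left dvd_triv_right mult.commute)+
    then have "a dvd p" "b dvd q" "q dvd b" "p dvd a"
      using ab qp pq(1) by (simp_all add: coprime_dvd_mult_right_iff)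
    then show "a = p \<and> b = q" using ab pq by (simp add: zdvd_antisym_nonneg)
  qed
  then have "card S \<le> card (insert (p, q) S1)" using finS1 by (intro card_mono) auto
  then have cS: "card S \<le> 1 + card S1" by (simp add: card_insert_if finS1 split: if_splits)
  show ?thesis
  proof (cases "degree f = 0")
    case False
    have small: "card (V g j) \<le> 7" if "g \<noteq> 0" for g j
    proof (cases "j = 0")
      case True
      then have "V g j = {}" by (auto simp: V_def S1_def)
      then show ?thesis by simp
    next
      case j: False
      define h where "h = f - [:real_of_int (c * g ^ 2) / real_of_int j ^ n:]"
      have h0: "h \<noteq> 0" using False unfolding h_def by auto
      have dh: "degree h \<le> n" unfolding h_def using deg_f by (intro degree_diff_le) auto
      have "card (V g j) \<le> card {x. poly h x = 0}"
      proof (rule card_inj_on_le[where f = "\<lambda>(a, b). real_of_int b / (real_of_int j * real_of_int q)"])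
        show "inj_on (\<lambda>(a, b). real_of_int b / (real_of_int j * real_of_int q)) (V g j)"
        proof (rule inj_onI, clarify)
          fix a b a' b' assume z: "(a, b) \<in> V g j" "(a', b') \<in> V g j"
            and "real_of_int b / (real_of_int j * real_of_int q) = real_of_int b' / (real_of_int j * real_of_int q)"
          then have b: "b = b'" using j pq by simp
          moreover have "a * q = a' * q" using z b by (auto simp: V_def algebra_simps)
          ultimately show "a = a' \<and> b = b'" using pq by simp
        qed
        show "(\<lambda>(a, b). real_of_int b / (real_of_int j * real_of_int q)) ` V g j \<subseteq> {x. poly h x = 0}"
        proof clarify
          fix a b assume "(a, b) \<in> V g j"
          then have ab: "a * q - b * p = j" "homog n G a b = c * g ^ 2" by (auto simp: V_def)
          have "real_of_int (c * g ^ 2) = real_of_int j ^ n * poly f (real_of_int b / (real_of_int j * real_of_int q))"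
            using key[of a b] ab j by simp
          then show "poly h (real_of_int b / (real_of_int j * real_of_int q)) = 0"
            using j by (simp add: h_def)
        qed
        show "finite {x. poly h x = 0}" using h0 by (rule poly_roots_finite)
      qed
      also have "\<dots> \<le> degree h" using h0 by (rule card_poly_roots_bound)
      finally show ?thesis using dh n by simp
    qed
    have "card S1 \<le> (\<Sum>(g, j)\<in>{g. g dvd r \<and> g \<noteq> 0} \<times> {- int J..int J}. card (V g j))"
      unfolding S1V using fin_r
      by (intro order_trans[OF card_UN_le] order_eq_refl sum.cong) (auto intro: finite_subset[of _ "{g. g dvd r}"])
    also have "\<dots> \<le> (\<Sum>(g, j)\<in>{g. g dvd r \<and> g \<noteq> 0} \<times> {- int J..int J}. 7)"
      using small by (intro sum_mono) auto
    also have "\<dots> = card {g. g dvd r \<and> g \<noteq> 0} * (2 * J + 1) * 7"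
    proof -
      have "nat (2 * int J + 1) = 2 * J + 1" by simp
      then show ?thesis by (simp add: card_cartesian_product case_prod_unfold)
    qed
    also have "\<dots> \<le> \<tau> * (2 * J + 1) * 7"
      unfolding \<tau>_def using fin_r by (intro mult_right_mono card_mono) auto
    finally have "real (card S1) \<le> real (\<tau> * (2 * J + 1) * 7)" by (simp only: of_nat_le_iff)
    then show ?thesis using cS by (simp add: \<tau>_def algebra_simps)
  next
    case True
    then obtain \<gamma> where \<gamma>: "f = [:\<gamma>:]" using degree0_coeffs by auto
    \<comment> \<open>For \<open>p = 0\<close> and \<open>q = 1\<close> the polynomial
      \<open>f\<close> is \<open>G\<close> with the order of its coefficients reversed. If it is
      constant, the form is a multiple of \<open>a^n\<close>, which the hypothesis on
      \<open>G\<close> excludes.\<close>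
    have p1: "p \<ge> 1"
    proof (rule ccontr)
      assume "\<not> p \<ge> 1"
      then have "p = 0" using pq(2) by simp
      moreover from this have "is_unit q" using pq(1) by simp
      ultimately have p0: "p = 0" "q = 1" using pq(3) by auto
      have "coeff G i = 0" if "i < n" for i
      proof -
        have "f = (\<Sum>i\<le>n. monom (real_of_int (coeff G i)) (n - i))"
          by (simp add: f_def p0 monom_altdef one_pCons[symmetric])
        then have "coeff f (n - i) = (\<Sum>k\<le>n. if n - k = n - i then real_of_int (coeff G k) else 0)"
          by (simp add: coeff_sum)
        also have "\<dots> = (\<Sum>k\<le>n. if k = i then real_of_int (coeff G k) else 0)"
          using that by (intro sum.cong) auto
        also have "\<dots> = real_of_int (coeff G i)" using that by simp
        finally have "coeff f (n - i) = real_of_int (coeff G i)" .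
        moreover have "coeff f (n - i) = 0" using \<gamma> that by (simp add: coeff_pCons split: nat.splits)
        ultimately show ?thesis by simp
      qed
      then have "G = monom (coeff G n) n"
        using G(1) by (intro poly_eqI) (metis coeff_eq_0 coeff_monom le_less_trans linorder_neqE_nat)
      then show False using G(2) by blast
    qed
    define W where "W = (\<lambda>g. {(a, b) \<in> S1. homog n G a b = c * g ^ 2})"
    have WV: "\<exists>j. W g \<subseteq> V g j" if g: "g \<noteq> 0" for g
    proof (cases "W g = {}")
      case False
      then obtain a b where ab: "(a, b) \<in> W g" by auto
      have "a' * q - b' * p = a * q - b * p" if ab': "(a', b') \<in> W g" for a' b'
      proof -
        have e: "real_of_int (c * g ^ 2) = real_of_int (a * q - b * p) ^ n * \<gamma>"
          if "(a, b) \<in> W g" for a b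
          using key[of a b] that by (simp add: W_def S1_def \<gamma>)
        have "\<gamma> \<noteq> 0" using e[OF ab] c g by auto
        then have "real_of_int (a * q - b * p) ^ n = real_of_int (a' * q - b' * p) ^ n"
          using e[OF ab] e[OF ab'] by simp
        then have "real_of_int (a * q - b * p) = real_of_int (a' * q - b' * p)"
          using n(1) by (metis odd_real_root_power_cancel)
        then show ?thesis by linarith
      qed
      then have "W g \<subseteq> V g (a * q - b * p)" by (auto simp: V_def W_def)
      then show ?thesis by blast
    qed auto
    have cW: "real (card (W g)) \<le> 2 * B / real_of_int q + 1" if g: "g \<noteq> 0" for g
    proof -
      obtain j where "W g \<subseteq> V g j" using WV[OF g] by blast
      then have "card (W g) \<le> card (V g j)" using finV by (intro card_mono)
      then show ?thesis using cardV[of g j] by linarith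
    qed
    have "S1 = (\<Union>g\<in>{g. g dvd r \<and> g \<noteq> 0}. W g)"
      using S by (fastforce simp: W_def S1_def)
    then have "card S1 \<le> (\<Sum>g\<in>{g. g dvd r \<and> g \<noteq> 0}. card (W g))"
      using fin_r by (auto intro!: card_UN_le intro: finite_subset[of _ "{g. g dvd r}"])
    then have "real (card S1) \<le> (\<Sum>g\<in>{g. g dvd r \<and> g \<noteq> 0}. real (card (W g)))"
      by (metis of_nat_le_iff of_nat_sum)
    also have "\<dots> \<le> (\<Sum>g\<in>{g. g dvd r \<and> g \<noteq> 0}. 2 * B / real_of_int q + 1)"
      using cW by (intro sum_mono) auto
    also have "\<dots> = real (card {g. g dvd r \<and> g \<noteq> 0}) * (2 * B / real_of_int q + 1)" by simp
    also have "\<dots> \<le> real \<tau> * (2 * B / real_of_int q + 1)"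
      unfolding \<tau>_def using fin_r B pq by (intro mult_right_mono) (auto intro!: card_mono)
    finally show ?thesis using cS p1 by (simp add: \<tau>_def)
  qed
qed

subsection \<open>The auxiliary cubic forms\<close>

lemma taylor_shift:
  fixes x :: "nat \<Rightarrow> real"
  shows "(\<Sum>i<n. x i * s ^ i) = (\<Sum>m<n. (\<Sum>i<n. real (i choose m) * s0 ^ (i - m) * x i) * (s - s0) ^ m)"
proof -
  have "s ^ i = (\<Sum>m<n. real (i choose m) * (s - s0) ^ m * s0 ^ (i - m))" if "i < n" for i
  proof -
    have "s ^ i = ((s - s0) + s0) ^ i" by simp
    also have "\<dots> = (\<Sum>m\<le>i. real (i choose m) * (s - s0) ^ m * s0 ^ (i - m))"
      by (rule binomial_ring)
    also have "\<dots> = (\<Sum>m<n. real (i choose m) * (s - s0) ^ m * s0 ^ (i - m))"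
      using that by (intro sum.mono_neutral_left) auto
    finally show ?thesis .
  qed
  then have "(\<Sum>i<n. x i * s ^ i)
    = (\<Sum>i<n. \<Sum>m<n. real (i choose m) * s0 ^ (i - m) * x i * (s - s0) ^ m)"
    by (intro sum.cong) (auto simp: sum_distrib_left mult_ac)
  also have "\<dots> = (\<Sum>m<n. \<Sum>i<n. real (i choose m) * s0 ^ (i - m) * x i * (s - s0) ^ m)"
    by (rule sum.swap)
  finally show ?thesis by (simp add: sum_distrib_right)
qed

text \<open>The eight unknown coefficients \<open>x\<^sub>i\<close> are those of \<open>h(s) = E(s\<^sup>2) + s F(s\<^sup>2)\<close>. At a point of the
  cell with \<open>t = a / b\<close> and \<open>s = \<surd>t\<close> one has \<open>u E + v F = b\<^sup>3 (u h(s) + (v - u s) F(t))\<close>. The first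
  summand is small if the first five Taylor coefficients of \<open>h\<close> at \<open>s0\<close> are small, and the second one,
  where \<open>v - u s\<close> is tiny, if the Taylor coefficients of \<open>F\<close> at \<open>s0\<^sup>2\<close> are not too large.\<close>

lemma auxiliary_polynomial:
  fixes A B U K s0 :: real
  defines "Y \<equiv> A * B" and "T \<equiv> A * U ^ 2" and "s1 \<equiv> sqrt (A / B)"
  assumes A: "A \<ge> 1" and B: "B \<ge> 1" and U: "U \<ge> 1" and K: "K \<ge> 1"
    and big1: "2 ^ 221 * K ^ 11 < Y" and big2: "2 ^ 221 * K ^ 13 * T < Y ^ 3"
    and s0: "s1 / 2 \<le> s0" "s0 \<le> 2 * s1"
  shows "\<exists>E F :: int poly. (E \<noteq> 0 \<or> F \<noteq> 0) \<and> degree E \<le> 3 \<and> degree F \<le> 3 \<and>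
    (\<forall>i. \<bar>real_of_int (coeff E i)\<bar> \<le> Y ^ 9 \<and> \<bar>real_of_int (coeff F i)\<bar> \<le> Y ^ 9) \<and>
    (\<forall>a b u v. A \<le> real_of_int a \<longrightarrow> real_of_int a < 2 * A \<longrightarrow>
       B \<le> real_of_int b \<longrightarrow> real_of_int b < 2 * B \<longrightarrow>
       U \<le> real_of_int u \<longrightarrow> real_of_int u < 2 * U \<longrightarrow> 0 < v \<longrightarrow> \<bar>b * v ^ 2 - a * u ^ 2\<bar> \<le> 2 \<longrightarrow>
       \<bar>sqrt (real_of_int a / real_of_int b) - s0\<bar> \<le> s1 * (K / Y) \<longrightarrow>
       u * homog 3 E a b + v * homog 3 F a b = 0)"
proof -
  \<comment> \<open>The large parameter of the construction; its inverse \<open>\<kappa>\<close> is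
    the half-width of the cell relative to \<open>s1\<close>.\<close>
  define X0 where "X0 = Y / K"
  define \<kappa> where "\<kappa> = K / Y"
  \<comment> \<open>Chosen so that the Taylor terms of \<open>h\<close> of order at least
    \<open>5\<close> are small without any condition: they are at most of size
    \<open>Z \<kappa>^5\<close>, and \<open>X0 \<kappa> = 1\<close>.\<close>
  define Z where "Z = X0 ^ 5 / 2 ^ 24"
  \<comment> \<open>\<open>16 W\<close> bounds \<open>b^3 \<bar>v - u s\<bar>\<close>: the equation
    gives \<open>\<bar>v - u s\<bar> (v + u s) \<le> 2 / b\<close>, and \<open>v + u s\<close> is at
    least \<open>U s1 / 2\<close>.\<close>
  define W where "W = B ^ 2 / (U * s1)"
  \<comment> \<open>Balances the unknowns: as \<open>s\<close> has the size of \<open>s1\<close>,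
    every monomial of \<open>U B^3 h(s)\<close> may be about as large as \<open>Z\<close>.\<close>
  define M where "M = (\<lambda>i::nat. Z / (U * B ^ 3 * s1 ^ i))"
  \<comment> \<open>Rows \<open>0\<close> to \<open>4\<close> are the Taylor coefficients of
    \<open>h\<close> at \<open>s0\<close>, rows \<open>5\<close> to \<open>8\<close> those of
    \<open>F\<close> at \<open>s0^2\<close>; the unknowns of \<open>F\<close> are the
    \<open>x i\<close> with odd \<open>i\<close>. Each row is scaled by the power of the half-width
    that belongs to it, and in the variable \<open>t = s^2\<close> the half-width is at most
    \<open>4 \<kappa> s1^2\<close>.\<close>
  define c where "c = (\<lambda>k i::nat. if k < 5
      then U * B ^ 3 * (s1 * \<kappa>) ^ k * (real (i choose k) * s0 ^ (i - k))
      else if odd i then W * (4 * \<kappa> * s1 ^ 2) ^ (k - 5) * (real ((i div 2) choose (k - 5)) * (s0 ^ 2) ^ (i div 2 - (k - 5)))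
      else 0)"
  define \<Lambda> where "\<Lambda> = (\<lambda>k::nat. if k < 5 then 2 ^ 17 * Z * \<kappa> ^ k else 2 ^ 17 * Z * \<kappa> ^ (k - 5) / T)"
  have Y1: "Y \<ge> 1" unfolding Y_def using mult_mono[of 1 A 1 B] A B by simp
  have T1: "T \<ge> 1" unfolding T_def using mult_mono[of 1 A 1 "U ^ 2"] A one_le_power[OF U, of 2] by simp
  have s1: "s1 > 0" using A B by (simp add: s1_def)
  have s12: "s1 ^ 2 = A / B" using A B by (simp add: s1_def)
  have s0p: "s0 > 0" using s0 s1 by linarith
  have big1': "2 ^ 221 * K ^ 10 < X0"
  proof -
    have "2 ^ 221 * K ^ 10 * K < Y" using big1 by (simp add: mult.assoc flip: power_Suc2)
    then show ?thesis using K by (simp add: X0_def less_divide_eq)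
  qed
  have big2': "2 ^ 221 * K ^ 10 * T < X0 ^ 3"
  proof -
    have "K ^ 13 = K ^ 10 * K ^ 3" by (simp flip: power_add)
    then have "2 ^ 221 * K ^ 10 * T * K ^ 3 = 2 ^ 221 * K ^ 13 * T" by (simp only: mult_ac)
    then have "2 ^ 221 * K ^ 10 * T * K ^ 3 < Y ^ 3" using big2 by (rule ord_eq_less_trans)
    then show ?thesis using K by (simp add: X0_def power_divide less_divide_eq)
  qed
  have K10: "1 \<le> K ^ 10" using K by (rule one_le_power)
  have X01: "1 \<le> X0" using big1' K10 by simp
  have TX: "T \<le> X0 ^ 3"
  proof -
    have "1 * T \<le> 2 ^ 221 * K ^ 10 * T" using K10 T1 by (intro mult_right_mono) auto
    then show ?thesis using big2' by simp
  qed
  have XK: "X0 * \<kappa> = 1" using Y1 K by (simp add: X0_def \<kappa>_def)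
  have \<kappa>0: "\<kappa> > 0" using Y1 K by (simp add: \<kappa>_def)
  have \<kappa>1: "\<kappa> \<le> 1"
  proof -
    have "1 * \<kappa> \<le> X0 * \<kappa>" using X01 \<kappa>0 by (intro mult_right_mono) auto
    then show ?thesis using XK by simp
  qed
  have Z0: "Z > 0" using X01 by (simp add: Z_def)
  have UB: "U * B ^ 3 > 0" using U B by simp
  have W0: "W > 0" using U B s1 by (simp add: W_def)
  have ratio: "s0 / s1 \<le> 2" "s0 / s1 > 0" using s0 s1 s0p by (auto simp: field_simps)
  have XKp: "X0 ^ 5 * \<kappa> ^ m = X0 ^ (5 - m)" if "m \<le> 5" for m
  proof -
    have "X0 ^ 5 = X0 ^ (5 - m) * X0 ^ m" using that by (simp flip: power_add)
    then have "X0 ^ 5 * \<kappa> ^ m = X0 ^ (5 - m) * (X0 * \<kappa>) ^ m" by (simp add: power_mult_distrib)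
    then show ?thesis using XK by simp
  qed
  have term1: "U * B ^ 3 * (s1 * \<kappa>) ^ m * (real (i choose m) * s0 ^ (i - m)) * M i \<le> 2 ^ 14 * Z * \<kappa> ^ m"
    if i: "i < 8" for m i
  proof (cases "m \<le> i")
    case True
    have "s1 ^ i = s1 ^ m * s1 ^ (i - m)" using True by (simp flip: power_add)
    then have "U * B ^ 3 * (s1 * \<kappa>) ^ m * (real (i choose m) * s0 ^ (i - m)) * M i
      = real (i choose m) * (s0 / s1) ^ (i - m) * (Z * \<kappa> ^ m)"
      using UB s1 U B by (simp add: M_def power_mult_distrib power_divide field_simps)
    also have "\<dots> \<le> 2 ^ 7 * 2 ^ 7 * (Z * \<kappa> ^ m)"
    proof (intro mult_right_mono mult_mono)
      have "real (i choose m) \<le> real (2 ^ i)" by (metis binomial_le_pow2 of_nat_le_iff)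
      also have "\<dots> = 2 ^ i" by simp
      also have "(2::real) ^ i \<le> 2 ^ 7" using i by (intro power_increasing) auto
      finally show "real (i choose m) \<le> 2 ^ 7" .
      have "(s0 / s1) ^ (i - m) \<le> 2 ^ (i - m)" using ratio by (intro power_mono) auto
      also have "(2::real) ^ (i - m) \<le> 2 ^ 7" using i by (intro power_increasing) auto
      finally show "(s0 / s1) ^ (i - m) \<le> 2 ^ 7" .
    qed (use Z0 \<kappa>0 ratio in auto)
    finally show ?thesis by simp
  next
    case False
    then show ?thesis using Z0 \<kappa>0 by (simp add: binomial_eq_0)
  qed
  have term2: "W * (4 * \<kappa> * s1 ^ 2) ^ j * (real (k choose j) * (s0 ^ 2) ^ (k - j)) * M (2 * k + 1)
      \<le> 2 ^ 14 * Z * \<kappa> ^ j / T" if k: "k < 4" for k j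
  proof (cases "j \<le> k")
    case True
    have e: "s1 ^ (2 * k + 1) = s1 * (s1 ^ 2) ^ j * (s1 ^ 2) ^ (k - j)"
    proof -
      have "s1 ^ (2 * k + 1) = s1 * (s1 ^ 2) ^ k" by (simp add: power_mult)
      also have "(s1 ^ 2) ^ k = (s1 ^ 2) ^ j * (s1 ^ 2) ^ (k - j)" using True by (simp flip: power_add)
      finally show ?thesis by (simp add: mult.assoc)
    qed
    have r: "(s0 ^ 2) ^ (k - j) = ((s0 / s1) ^ 2) ^ (k - j) * (s1 ^ 2) ^ (k - j)"
      using s1 by (simp add: power_divide)
    have "W * (4 * \<kappa> * s1 ^ 2) ^ j * (real (k choose j) * (s0 ^ 2) ^ (k - j)) * M (2 * k + 1)
      = (B ^ 2 / (U * s1)) / (U * B ^ 3 * s1) * (4 ^ j * (real (k choose j) * ((s0 / s1) ^ 2) ^ (k - j)) * (Z * \<kappa> ^ j))"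
      unfolding M_def W_def e r using s1 U B by (simp add: power_mult_distrib mult_ac)
    also have "(B ^ 2 / (U * s1)) / (U * B ^ 3 * s1) = 1 / T"
    proof -
      have "(B ^ 2 / (U * s1)) / (U * B ^ 3 * s1) = B ^ 2 / (U ^ 2 * B ^ 3 * s1 ^ 2)"
        by (simp add: power2_eq_square mult_ac)
      also have "\<dots> = 1 / T"
        unfolding s12 T_def using A B U by (simp add: field_simps power2_eq_square power3_eq_cube)
      finally show ?thesis .
    qed
    also have "1 / T * (4 ^ j * (real (k choose j) * ((s0 / s1) ^ 2) ^ (k - j)) * (Z * \<kappa> ^ j))
      \<le> 1 / T * (2 ^ 14 * (Z * \<kappa> ^ j))"
    proof (intro mult_left_mono mult_right_mono)
      have "real (k choose j) \<le> real (2 ^ k)" by (metis binomial_le_pow2 of_nat_le_iff)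
      also have "\<dots> = 2 ^ k" by simp
      also have "(2::real) ^ k \<le> 2 ^ 3" using k by (intro power_increasing) auto
      finally have 1: "real (k choose j) \<le> 8" by simp
      have "((s0 / s1) ^ 2) ^ (k - j) \<le> (2 ^ 2) ^ (k - j)" using ratio by (intro power_mono) auto
      then have "4 ^ j * (real (k choose j) * ((s0 / s1) ^ 2) ^ (k - j)) \<le> 4 ^ j * (8 * 4 ^ (k - j))"
        using 1 by (intro mult_left_mono mult_mono) auto
      also have "\<dots> = 8 * 4 ^ k" using True by (simp flip: power_add)
      also have "(4::real) ^ k \<le> 4 ^ 3" using k by (intro power_increasing) auto
      finally show "4 ^ j * (real (k choose j) * ((s0 / s1) ^ 2) ^ (k - j)) \<le> 2 ^ 14" by simp
    qed (use Z0 \<kappa>0 T1 in auto)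
    finally show ?thesis by simp
  next
    case False
    then show ?thesis using Z0 \<kappa>0 T1 by (simp add: binomial_eq_0)
  qed
  have M0: "M i > 0" for i using Z0 UB s1 by (simp add: M_def)
  have c0: "c k i \<ge> 0" for k i
    using UB s1 \<kappa>0 s0p W0 by (auto simp: c_def)
  have cM: "(\<Sum>i<8. \<bar>c k i\<bar> * M i) \<le> \<Lambda> k" if "k < 9" for k
  proof -
    have "\<bar>c k i\<bar> * M i \<le> \<Lambda> k / 8" if i: "i < 8" for i
    proof (cases "k < 5")
      case True
      then show ?thesis using c0[of k i] term1[OF i, of k] by (simp add: c_def \<Lambda>_def)
    next
      case False
      show ?thesis
      proof (cases "odd i")
        case True
        then have "i = 2 * (i div 2) + 1" "i div 2 < 4" using i by auto
        then show ?thesis using False True c0[of k i] term2[of "i div 2" "k - 5"]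
          by (simp add: c_def \<Lambda>_def)
      next
        case even: False
        then show ?thesis using False Z0 \<kappa>0 T1 by (simp add: c_def \<Lambda>_def)
      qed
    qed
    then have "(\<Sum>i<8. \<bar>c k i\<bar> * M i) \<le> (\<Sum>i<(8::nat). \<Lambda> k / 8)" by (intro sum_mono) auto
    then show ?thesis by simp
  qed
  \<comment> \<open>The volume of the coefficient box. The exponents \<open>0\<close> to
    \<open>7\<close> of \<open>s1\<close> add up to \<open>28\<close>, and
    \<open>s1^2 = A / B\<close> makes \<open>U\<close>, \<open>A\<close> and \<open>B\<close>
    combine to \<open>T^4 Y^10\<close>.\<close>
  have prodM: "(\<Prod>i<8. M i) = X0 ^ 30 / (2 ^ 192 * T ^ 4 * K ^ 10)"
  proof -
    have geom: "(\<Prod>i<(8::nat). q * r ^ i) = q ^ 8 * r ^ 28" for q r :: real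
    proof -
      have "(\<Prod>i<(8::nat). q * r ^ i) = q ^ 8 * r ^ (\<Sum>i<8. i)"
        by (simp add: prod.distrib power_sum)
      then show ?thesis by (simp add: lessThan_nat_numeral)
    qed
    have "M i = Z / (U * B ^ 3) * (1 / s1) ^ i" for i by (simp add: M_def power_divide)
    then have "(\<Prod>i<8. M i) = (Z / (U * B ^ 3)) ^ 8 * (1 / s1) ^ 28" by (simp only: geom)
    also have "\<dots> = Z ^ 8 / (U ^ 8 * B ^ 24 * (s1 ^ 2) ^ 14)"
      by (simp add: power_divide power_mult_distrib flip: power_mult)
    also have "U ^ 8 * B ^ 24 * (s1 ^ 2) ^ 14 = T ^ 4 * Y ^ 10"
    proof -
      have eB: "B ^ 24 = B ^ 10 * B ^ 14" and eA: "A ^ 14 = A ^ 4 * A ^ 10" by (simp_all flip: power_add)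
      have "B ^ 24 * (A / B) ^ 14 = B ^ 10 * A ^ 14"
      proof -
        have "y * z * (w / z) = y * w" if "z \<noteq> 0" for y z w :: real using that by simp
        moreover have "B ^ 14 \<noteq> 0" using B by simp
        ultimately show ?thesis unfolding eB power_divide by blast
      qed
      then have "U ^ 8 * B ^ 24 * (A / B) ^ 14 = U ^ 8 * (B ^ 10 * A ^ 14)" by (simp only: mult.assoc)
      also have "\<dots> = (A * U ^ 2) ^ 4 * (A * B) ^ 10"
      proof -
        have "(U ^ 2) ^ 4 = U ^ 8" by (simp flip: power_mult)
        then show ?thesis by (simp only: power_mult_distrib eA mult_ac)
      qed
      finally show ?thesis by (simp only: s12 T_def Y_def)
    qed
    also have "Y ^ 10 = X0 ^ 10 * K ^ 10" using K by (simp add: X0_def power_divide)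
    also have "Z ^ 8 = X0 ^ 30 * X0 ^ 10 / 2 ^ 192"
      by (simp add: Z_def power_divide flip: power_mult power_add)
    also have "X0 ^ 30 * X0 ^ 10 / 2 ^ 192 / (T ^ 4 * (X0 ^ 10 * K ^ 10)) = X0 ^ 30 / (2 ^ 192 * T ^ 4 * K ^ 10)"
    proof -
      have "p * q / d / (t * (q * k)) = p / (d * t * k)" if "q \<noteq> 0" for p q d t k :: real
        using that by (simp add: divide_divide_eq_left mult_ac)
      moreover have "X0 ^ 10 \<noteq> 0" using X01 by simp
      ultimately show ?thesis by blast
    qed
    finally show ?thesis .
  qed
  \<comment> \<open>The tolerance \<open>1 / 2^9\<close> is dictated by the end of the proof, where
    the two parts add up to at most \<open>16 * 17 / 2^9 + 16 * 4 / 2^9 < 1\<close>.\<close>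
  have "\<exists>x :: nat \<Rightarrow> int. (\<exists>i<8. x i \<noteq> 0) \<and> (\<forall>i<8. \<bar>real_of_int (x i)\<bar> \<le> M i) \<and>
    (\<forall>k<9. \<bar>\<Sum>i<8. c k i * real_of_int (x i)\<bar> < 1 / 2 ^ 9)"
  proof (rule siegel_pigeonhole[where n = 8 and m = 9 and c = c and M = M and \<delta> = "\<lambda>_. 1 / 2 ^ 9" and \<Lambda> = \<Lambda>])
    have f1: "2 * \<Lambda> m / (1 / 2 ^ 9) + 1 \<le> 9 * X0 ^ (5 - m)" if "m < 5" for m
    proof -
      have "2 * \<Lambda> m / (1 / 2 ^ 9) = 8 * (X0 ^ 5 * \<kappa> ^ m)" using that by (simp add: \<Lambda>_def Z_def)
      also have "\<dots> = 8 * X0 ^ (5 - m)" using XKp that by simp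
      finally show ?thesis using one_le_power[OF X01, of "5 - m"] by simp
    qed
    have f2: "2 * \<Lambda> (5 + j) / (1 / 2 ^ 9) + 1 = 8 * X0 ^ (5 - j) / T + 1" if "j < 4" for j
    proof -
      have "2 * \<Lambda> (5 + j) / (1 / 2 ^ 9) = 8 * (X0 ^ 5 * \<kappa> ^ j) / T" by (simp add: \<Lambda>_def Z_def)
      then show ?thesis using XKp that by simp
    qed
    \<comment> \<open>The conditions with \<open>j \<le> 2\<close> absorb the \<open>1\<close>
      because \<open>T \<le> X0^3\<close>. In the one with \<open>j = 3\<close>, \<open>T\<close>
      may exceed \<open>X0^2\<close> and then the \<open>1\<close> dominates; this case confines
      \<open>T\<close> to less than about \<open>X0^3\<close>.\<close>
    have f3: "8 * X0 ^ (5 - j) / T + 1 \<le> 9 * X0 ^ (5 - j) / T" if "j \<le> 2" for j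
    proof -
      have "X0 ^ 3 \<le> X0 ^ (5 - j)" using X01 that by (intro power_increasing) auto
      then have "T \<le> X0 ^ (5 - j)" using TX by linarith
      then show ?thesis using T1 by (simp add: field_simps)
    qed
    have pos: "0 \<le> 2 * \<Lambda> k / (1 / 2 ^ 9) + 1" for k using Z0 \<kappa>0 T1 by (simp add: \<Lambda>_def)
    have "(\<Prod>k<9. 2 * \<Lambda> k / (1 / 2 ^ 9) + 1)
      = (\<Prod>k<5. 2 * \<Lambda> k / (1 / 2 ^ 9) + 1) * (\<Prod>j<3. 2 * \<Lambda> (5 + j) / (1 / 2 ^ 9) + 1)
        * (2 * \<Lambda> (5 + 3) / (1 / 2 ^ 9) + 1)"
      by (simp add: lessThan_nat_numeral mult_ac)
    also have "\<dots> \<le> (\<Prod>k<5. 9 * X0 ^ (5 - k)) * (\<Prod>j<3. 9 * X0 ^ (5 - j) / T) * (8 * X0 ^ 2 / T + 1)"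
    proof (intro mult_mono prod_mono conjI prod_nonneg)
      fix j :: nat assume "j \<in> {..<3}"
      then show "2 * \<Lambda> (5 + j) / (1 / 2 ^ 9) + 1 \<le> 9 * X0 ^ (5 - j) / T"
        using f2[of j] f3[of j] by simp
    next
      show "2 * \<Lambda> (5 + 3) / (1 / 2 ^ 9) + 1 \<le> 8 * X0 ^ 2 / T + 1" using f2[of 3] by simp
    qed (use f1 pos X01 T1 in \<open>auto intro!: mult_nonneg_nonneg prod_nonneg\<close>)
    also have "(\<Prod>k<5. 9 * X0 ^ (5 - k)) = 9 ^ 5 * X0 ^ 15"
      by (simp add: lessThan_nat_numeral eval_nat_numeral)
    also have "(\<Prod>j<3. 9 * X0 ^ (5 - j) / T) = 9 ^ 3 * X0 ^ 12 / T ^ 3"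
      by (simp add: lessThan_nat_numeral eval_nat_numeral)
    also have "9 ^ 5 * X0 ^ 15 * (9 ^ 3 * X0 ^ 12 / T ^ 3) * (8 * X0 ^ 2 / T + 1)
      = 9 ^ 8 * (8 * X0 ^ 2 + T) * X0 ^ 27 / T ^ 4"
    proof -
      have "8 * X0 ^ 2 / T + 1 = (8 * X0 ^ 2 + T) / T" using T1 by (simp add: field_simps)
      moreover have "X0 ^ 27 = X0 ^ 15 * X0 ^ 12" "T ^ 4 = T ^ 3 * T" by (simp_all flip: power_add power_Suc2)
      ultimately show ?thesis by simp
    qed
    \<comment> \<open>This amounts to \<open>9^8 (8 X0^2 + T) 2^192 K^10 < X0^3\<close>. The factor
      \<open>2^192\<close> comes from \<open>Z^8\<close>, and \<open>9^9 < 2^29\<close> leads to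
      \<open>2^221\<close>. In the hypotheses \<open>K^10\<close> appears as \<open>K^11\<close> and
      \<open>K^13\<close> because \<open>X0 = Y / K\<close>.\<close>
    also have "\<dots> < X0 ^ 30 / (2 ^ 192 * T ^ 4 * K ^ 10)"
    proof -
      have a: "2 ^ 221 * K ^ 10 * X0 ^ 2 < X0 ^ 3"
        using mult_strict_right_mono[OF big1', of "X0 ^ 2"] X01 by (simp add: power2_eq_square power3_eq_cube mult.assoc)
      have e: "(2::real) ^ 221 = 2 ^ 29 * 2 ^ 192" by (simp flip: power_add)
      have gen: "p * (m * (8 * y + t) * (q * k)) = m * (8 * (p * q * k * y) + p * q * k * t)"
        for p m q k y t :: real by (simp add: algebra_simps)
      have "2 ^ 29 * (9 ^ 8 * (8 * X0 ^ 2 + T) * (2 ^ 192 * K ^ 10))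
        = 9 ^ 8 * (8 * (2 ^ 221 * K ^ 10 * X0 ^ 2) + 2 ^ 221 * K ^ 10 * T)"
        unfolding e by (rule gen)
      also have "\<dots> < 9 ^ 8 * (9 * X0 ^ 3)" using a big2' by simp
      also have "\<dots> \<le> 2 ^ 29 * X0 ^ 3" using X01 by simp
      finally have "9 ^ 8 * (8 * X0 ^ 2 + T) * (2 ^ 192 * K ^ 10) < X0 ^ 3"
        by (rule mult_left_less_imp_less) simp
      then have "9 ^ 8 * (8 * X0 ^ 2 + T) * (2 ^ 192 * K ^ 10) * X0 ^ 27 < X0 ^ 3 * X0 ^ 27"
        using X01 by (intro mult_strict_right_mono) auto
      then have l: "9 ^ 8 * (8 * X0 ^ 2 + T) * X0 ^ 27 * (2 ^ 192 * K ^ 10) < X0 ^ 30"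
        by (simp add: mult_ac flip: power_add)
      have d: "2 ^ 192 * K ^ 10 > 0" "T ^ 4 > 0" using K T1 by auto
      have "9 ^ 8 * (8 * X0 ^ 2 + T) * X0 ^ 27 < X0 ^ 30 / (2 ^ 192 * K ^ 10)"
        using l d by (simp only: less_divide_eq if_True)
      then have "9 ^ 8 * (8 * X0 ^ 2 + T) * X0 ^ 27 / T ^ 4 < X0 ^ 30 / (2 ^ 192 * K ^ 10) / T ^ 4"
        using d by (intro divide_strict_right_mono) auto
      also have "\<dots> = X0 ^ 30 / (2 ^ 192 * T ^ 4 * K ^ 10)" by (simp add: mult_ac)
      finally show ?thesis .
    qed
    finally show "(\<Prod>k<9. 2 * \<Lambda> k / (1 / 2 ^ 9) + 1) < (\<Prod>i<8. M i)" unfolding prodM .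
  qed (use M0 cM in \<open>auto intro: less_imp_le\<close>)
  then obtain x :: "nat \<Rightarrow> int" where x: "(\<exists>i<8. x i \<noteq> 0) \<and> (\<forall>i<8. \<bar>real_of_int (x i)\<bar> \<le> M i) \<and>
    (\<forall>k<9. \<bar>\<Sum>i<8. c k i * real_of_int (x i)\<bar> < 1 / 2 ^ 9)"
    by (rule exE)
  note x0 = x[THEN conjunct1] and xM = x[THEN conjunct2, THEN conjunct1, rule_format]
    and xc = x[THEN conjunct2, THEN conjunct2, rule_format]
  define E where "E = [:x 0, x 2, x 4, x 6:]"
  define F where "F = [:x 1, x 3, x 5, x 7:]"
  \<comment> \<open>The worst case is \<open>A = 1\<close>, where \<open>1 / s1 = \<surd>Y\<close>;
    in general \<open>1 / s1^i \<le> Y^4\<close> for \<open>i < 8\<close>, and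
    \<open>Z \<le> Y^5\<close>.\<close>
  have MY: "M i \<le> Y ^ 9" if "i < 8" for i
  proof -
    have "1 / s1 = sqrt (B / A)" using A B by (simp add: s1_def real_sqrt_divide)
    also have "\<dots> \<le> sqrt Y"
    proof -
      have "B / A \<le> B / 1" using A B by (intro divide_left_mono) auto
      moreover have "B * 1 \<le> B * A" using A B by (intro mult_left_mono) auto
      ultimately have "B / A \<le> B * A" by simp
      then show ?thesis by (simp add: Y_def mult.commute)
    qed
    finally have "(1 / s1) ^ i \<le> (sqrt Y) ^ i" using s1 by (intro power_mono) auto
    also have "\<dots> \<le> (sqrt Y) ^ 8" using Y1 that by (intro power_increasing) auto
    also have "(sqrt Y) ^ 8 = ((sqrt Y) ^ 2) ^ 4" by (simp flip: power_mult)
    also have "\<dots> = Y ^ 4" using Y1 by simp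
    finally have 1: "(1 / s1) ^ i \<le> Y ^ 4" .
    have 2: "Z \<le> Y ^ 5"
    proof -
      have "X0 \<le> Y" using K Y1 by (simp add: X0_def divide_le_eq)
      then have "X0 ^ 5 \<le> Y ^ 5" using X01 by (intro power_mono) auto
      moreover have "Z \<le> X0 ^ 5" using X01 by (simp add: Z_def)
      ultimately show ?thesis by simp
    qed
    have 3: "1 \<le> U * B ^ 3" using mult_mono[of 1 U 1 "B ^ 3"] U one_le_power[OF B, of 3] by simp
    have "M i = (Z * (1 / s1) ^ i) / (U * B ^ 3)" by (simp add: M_def power_divide)
    also have "\<dots> \<le> (Z * (1 / s1) ^ i) / 1"
      using 3 Z0 s1 by (intro divide_left_mono) auto
    also have "\<dots> \<le> Y ^ 5 * Y ^ 4" using 1 2 Z0 s1 Y1 by (simp only: div_by_1) (intro mult_mono, auto)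
    also have "\<dots> = Y ^ 9" by (simp flip: power_add)
    finally show ?thesis .
  qed
  have xY: "\<bar>real_of_int (x i)\<bar> \<le> Y ^ 9" if "i < 8" for i
    using xM[OF that] MY[OF that] by linarith
  show ?thesis
  proof (rule exI[of _ E], rule exI[of _ F], intro conjI allI impI)
    show "E \<noteq> 0 \<or> F \<noteq> 0"
    proof (rule ccontr)
      assume "\<not> (E \<noteq> 0 \<or> F \<noteq> 0)"
      then have "x 0 = 0" "x 1 = 0" "x 2 = 0" "x 3 = 0" "x 4 = 0" "x 5 = 0" "x 6 = 0" "x 7 = 0"
        by (auto simp: E_def F_def)
      moreover obtain i where "i < 8" "x i \<noteq> 0" using x0 by blast
      moreover from \<open>i < 8\<close> have "i \<in> {0, 1, 2, 3, 4, 5, 6, 7}" by auto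
      ultimately show False by auto
    qed
    show "degree E \<le> 3" "degree F \<le> 3" by (simp_all add: E_def F_def)
    show "\<bar>real_of_int (coeff E i)\<bar> \<le> Y ^ 9" for i
      using xY Y1 by (auto simp: E_def coeff_pCons split: nat.splits)
    show "\<bar>real_of_int (coeff F i)\<bar> \<le> Y ^ 9" for i
      using xY Y1 by (auto simp: F_def coeff_pCons split: nat.splits)
  next
    fix ai bi ui vi :: int
    assume a': "A \<le> real_of_int ai" "real_of_int ai < 2 * A" and b': "B \<le> real_of_int bi" "real_of_int bi < 2 * B"
      and u': "U \<le> real_of_int ui" "real_of_int ui < 2 * U" and v': "0 < vi"
      and eq': "\<bar>bi * vi ^ 2 - ai * ui ^ 2\<bar> \<le> 2"
      and close': "\<bar>sqrt (real_of_int ai / real_of_int bi) - s0\<bar> \<le> s1 * (K / Y)"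
    define a b u v where "a = real_of_int ai" and "b = real_of_int bi" and "u = real_of_int ui" and "v = real_of_int vi"
    note abuv = a_def b_def u_def v_def
    have a: "A \<le> a" "a < 2 * A" and b: "B \<le> b" "b < 2 * B" and u: "U \<le> u" "u < 2 * U" and v: "0 < v"
      using a' b' u' v' by (auto simp: abuv)
    have eq: "\<bar>b * v ^ 2 - a * u ^ 2\<bar> \<le> 2"
    proof -
      have "\<bar>real_of_int (bi * vi ^ 2 - ai * ui ^ 2)\<bar> \<le> 2" using eq' by linarith
      then show ?thesis by (simp add: abuv)
    qed
    have pos: "a > 0" "b > 0" "u > 0" using a b u A B U by linarith+
    define t where "t = a / b"
    define s where "s = sqrt t"
    have t0: "t > 0" using pos by (simp add: t_def)
    have s2: "s ^ 2 = t" and s_pos: "s > 0" using t0 by (auto simp: s_def)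
    have close: "\<bar>s - s0\<bar> \<le> s1 * \<kappa>" using close' by (simp add: s_def t_def abuv \<kappa>_def)
    have s_ge: "s1 / 2 \<le> s"
    proof -
      have "A / B / 4 \<le> t"
      proof -
        have "A / (4 * B) \<le> a / b" using a b A B by (intro frac_le) auto
        then show ?thesis by (simp add: t_def)
      qed
      then have "sqrt (A / B / 4) \<le> s" unfolding s_def by simp
      moreover have "sqrt (A / B / 4) = s1 / sqrt 4" unfolding s1_def by (rule real_sqrt_divide)
      ultimately show ?thesis by simp
    qed
    have s_le: "s \<le> 2 * s1"
    proof -
      have "a / b \<le> (4 * A) / B" using a b A B by (intro frac_le) auto
      then have "t \<le> 4 * (A / B)" by (simp add: t_def)
      then have "s \<le> sqrt (4 * (A / B))" unfolding s_def by simp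
      moreover have "sqrt (4 * (A / B)) = sqrt 4 * s1" unfolding s1_def by (rule real_sqrt_mult)
      ultimately show ?thesis by simp
    qed
    define h where "h = (\<Sum>i<8. real_of_int (x i) * s ^ i)"
    define f where "f = (\<Sum>k<4. real_of_int (x (2 * k + 1)) * t ^ k)"
    have split: "real_of_int (ui * homog 3 E ai bi + vi * homog 3 F ai bi)
      = b ^ 3 * (u * h + (v - u * s) * f)"
    proof -
      have hE: "real_of_int (homog 3 E ai bi) = b ^ 3 * (real_of_int (x 0) + real_of_int (x 2) * t + real_of_int (x 4) * t ^ 2 + real_of_int (x 6) * t ^ 3)"
      proof -
        have "real_of_int (homog 3 E ai bi) = real_of_int (x 0) * b ^ 3 + real_of_int (x 2) * a * b ^ 2
          + real_of_int (x 4) * a ^ 2 * b + real_of_int (x 6) * a ^ 3"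
          by (simp add: homog_def E_def abuv eval_nat_numeral)
        also have "\<dots> = b ^ 3 * (real_of_int (x 0) + real_of_int (x 2) * t + real_of_int (x 4) * t ^ 2 + real_of_int (x 6) * t ^ 3)"
          using pos by (simp add: t_def field_simps power2_eq_square power3_eq_cube)
        finally show ?thesis .
      qed
      have hF: "real_of_int (homog 3 F ai bi) = b ^ 3 * f"
      proof -
        have "real_of_int (homog 3 F ai bi) = real_of_int (x 1) * b ^ 3 + real_of_int (x 3) * a * b ^ 2
          + real_of_int (x 5) * a ^ 2 * b + real_of_int (x 7) * a ^ 3"
          by (simp add: homog_def F_def abuv eval_nat_numeral)
        also have "\<dots> = b ^ 3 * (real_of_int (x 1) + real_of_int (x 3) * t + real_of_int (x 5) * t ^ 2 + real_of_int (x 7) * t ^ 3)"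
          using pos by (simp add: t_def field_simps power2_eq_square power3_eq_cube)
        also have "\<dots> = b ^ 3 * f" by (simp add: f_def lessThan_nat_numeral)
        finally show ?thesis .
      qed
      have h: "h = (real_of_int (x 0) + real_of_int (x 2) * t + real_of_int (x 4) * t ^ 2 + real_of_int (x 6) * t ^ 3) + s * f"
        unfolding h_def f_def s2[symmetric] by (simp add: lessThan_nat_numeral eval_nat_numeral algebra_simps)
      show ?thesis by (simp add: hE hF h abuv[symmetric] algebra_simps)
    qed
    have hb: "U * B ^ 3 * \<bar>h\<bar> \<le> 17 / 2 ^ 9"
    proof -
      define hm where "hm = (\<lambda>m. \<Sum>i<8. real (i choose m) * s0 ^ (i - m) * real_of_int (x i))"
      have L: "U * B ^ 3 * (s1 * \<kappa>) ^ m * \<bar>hm m\<bar> \<le> (if m < 5 then 1 / 2 ^ 9 else 1 / 2 ^ 7)" if "m < 8" for m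
      proof -
        have e: "U * B ^ 3 * (s1 * \<kappa>) ^ m * \<bar>hm m\<bar>
          = \<bar>\<Sum>i<8. U * B ^ 3 * (s1 * \<kappa>) ^ m * (real (i choose m) * s0 ^ (i - m)) * real_of_int (x i)\<bar>"
        proof -
          have "U * B ^ 3 * (s1 * \<kappa>) ^ m * \<bar>hm m\<bar> = \<bar>U * B ^ 3 * (s1 * \<kappa>) ^ m * hm m\<bar>"
            using U B s1 \<kappa>0 by (simp add: abs_mult)
          then show ?thesis by (simp add: hm_def sum_distrib_left mult_ac)
        qed
        show ?thesis
        proof (cases "m < 5")
          case True
          then show ?thesis using xc[of m] unfolding e by (simp add: c_def)
        next
          case False
          have "U * B ^ 3 * (s1 * \<kappa>) ^ m * \<bar>hm m\<bar> \<le> (\<Sum>i<(8::nat). 2 ^ 14 * Z * \<kappa> ^ m)"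
            unfolding e
          proof (rule order_trans[OF sum_abs], rule sum_mono)
            fix i :: nat assume i: "i \<in> {..<8}"
            have "\<bar>U * B ^ 3 * (s1 * \<kappa>) ^ m * (real (i choose m) * s0 ^ (i - m)) * real_of_int (x i)\<bar>
              = U * B ^ 3 * (s1 * \<kappa>) ^ m * (real (i choose m) * s0 ^ (i - m)) * \<bar>real_of_int (x i)\<bar>"
              using U B s1 \<kappa>0 s0p by (simp add: abs_mult)
            also have "\<dots> \<le> U * B ^ 3 * (s1 * \<kappa>) ^ m * (real (i choose m) * s0 ^ (i - m)) * M i"
              using xM[of i] i UB s1 \<kappa>0 s0p by (intro mult_left_mono) auto
            also have "\<dots> \<le> 2 ^ 14 * Z * \<kappa> ^ m" using term1[of i m] i by simp
            finally show "\<bar>U * B ^ 3 * (s1 * \<kappa>) ^ m * (real (i choose m) * s0 ^ (i - m)) * real_of_int (x i)\<bar> \<le> 2 ^ 14 * Z * \<kappa> ^ m" .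
          qed
          also have "\<dots> = (X0 ^ 5 * \<kappa> ^ m) / 2 ^ 7" by (simp add: Z_def)
          also have "\<kappa> ^ m = \<kappa> ^ 5 * \<kappa> ^ (m - 5)" using False by (simp flip: power_add)
          also have "X0 ^ 5 * (\<kappa> ^ 5 * \<kappa> ^ (m - 5)) / 2 ^ 7 = \<kappa> ^ (m - 5) / 2 ^ 7"
            using XKp[of 5] by simp
          also have "\<dots> \<le> 1 / 2 ^ 7" using \<kappa>0 \<kappa>1 by (intro divide_right_mono power_le_one) auto
          finally show ?thesis using False by simp
        qed
      qed
      have "U * B ^ 3 * \<bar>h\<bar> = U * B ^ 3 * \<bar>\<Sum>m<8. hm m * (s - s0) ^ m\<bar>"
        unfolding h_def hm_def by (subst taylor_shift[of _ _ 8 s0]) simp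
      also have "\<dots> \<le> U * B ^ 3 * (\<Sum>m<8. \<bar>hm m\<bar> * (s1 * \<kappa>) ^ m)"
      proof (intro mult_left_mono order_trans[OF sum_abs] sum_mono)
        fix m :: nat
        have "\<bar>s - s0\<bar> ^ m \<le> (s1 * \<kappa>) ^ m" using close by (intro power_mono) auto
        then show "\<bar>hm m * (s - s0) ^ m\<bar> \<le> \<bar>hm m\<bar> * (s1 * \<kappa>) ^ m"
          by (simp add: abs_mult power_abs mult_left_mono)
      qed (use UB in auto)
      also have "\<dots> = (\<Sum>m<8. U * B ^ 3 * (s1 * \<kappa>) ^ m * \<bar>hm m\<bar>)"
        by (simp add: sum_distrib_left mult_ac)
      also have "\<dots> \<le> (\<Sum>m<(8::nat). if m < 5 then 1 / 2 ^ 9 else 1 / 2 ^ 7)"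
        using L by (intro sum_mono) auto
      also have "\<dots> = 17 / 2 ^ 9" by (simp add: lessThan_nat_numeral)
      finally show ?thesis .
    qed
    have fb: "W * \<bar>f\<bar> \<le> 4 / 2 ^ 9"
    proof -
      define fj where "fj = (\<lambda>j. \<Sum>k<4. real (k choose j) * (s0 ^ 2) ^ (k - j) * real_of_int (x (2 * k + 1)))"
      have L: "W * (4 * \<kappa> * s1 ^ 2) ^ j * \<bar>fj j\<bar> \<le> 1 / 2 ^ 9" if "j < 4" for j
      proof -
        define w where "w = (\<lambda>k. W * (4 * \<kappa> * s1 ^ 2) ^ j * (real (k choose j) * (s0 ^ 2) ^ (k - j)))"
        have "W * (4 * \<kappa> * s1 ^ 2) ^ j * \<bar>fj j\<bar> = \<bar>W * (4 * \<kappa> * s1 ^ 2) ^ j * fj j\<bar>"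
          using W0 \<kappa>0 s1 by (simp add: abs_mult)
        also have "W * (4 * \<kappa> * s1 ^ 2) ^ j * fj j = (\<Sum>k<4. w k * real_of_int (x (2 * k + 1)))"
          by (simp add: fj_def w_def sum_distrib_left mult_ac)
        also have "\<dots> = (\<Sum>i<8. (if odd i then w (i div 2) else 0) * real_of_int (x i))"
          by (simp add: lessThan_nat_numeral)
        also have "\<dots> = (\<Sum>i<8. c (5 + j) i * real_of_int (x i))"
          by (intro sum.cong) (auto simp: c_def w_def)
        finally show ?thesis using xc[of "5 + j"] that by simp
      qed
      have tt: "\<bar>t - s0 ^ 2\<bar> \<le> 4 * \<kappa> * s1 ^ 2"
      proof -
        have "t - s0 ^ 2 = (s - s0) * (s + s0)" by (simp add: s2[symmetric] power2_eq_square algebra_simps)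
        then have "\<bar>t - s0 ^ 2\<bar> = \<bar>s - s0\<bar> * (s + s0)" using s_pos s0p by (simp add: abs_mult)
        also have "\<dots> \<le> (s1 * \<kappa>) * (4 * s1)" using close s_le s0 s1 \<kappa>0 s_pos s0p by (intro mult_mono) auto
        finally show ?thesis by (simp add: power2_eq_square mult_ac)
      qed
      have "W * \<bar>f\<bar> = W * \<bar>\<Sum>j<4. fj j * (t - s0 ^ 2) ^ j\<bar>"
        unfolding f_def fj_def by (subst taylor_shift[of _ _ 4 "s0 ^ 2"]) simp
      also have "\<dots> \<le> W * (\<Sum>j<4. \<bar>fj j\<bar> * (4 * \<kappa> * s1 ^ 2) ^ j)"
      proof (intro mult_left_mono order_trans[OF sum_abs] sum_mono)
        fix m :: nat
        have "\<bar>t - s0 ^ 2\<bar> ^ m \<le> (4 * \<kappa> * s1 ^ 2) ^ m" using tt by (intro power_mono) auto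
        then show "\<bar>fj m * (t - s0 ^ 2) ^ m\<bar> \<le> \<bar>fj m\<bar> * (4 * \<kappa> * s1 ^ 2) ^ m"
          by (simp add: abs_mult power_abs mult_left_mono)
      qed (use W0 in auto)
      also have "\<dots> = (\<Sum>j<4. W * (4 * \<kappa> * s1 ^ 2) ^ j * \<bar>fj j\<bar>)"
        by (simp add: sum_distrib_left mult_ac)
      also have "\<dots> \<le> (\<Sum>j<(4::nat). 1 / 2 ^ 9)" using L by (intro sum_mono) auto
      finally show ?thesis by simp
    qed
    have part1: "b ^ 3 * u * \<bar>h\<bar> \<le> 16 * (17 / 2 ^ 9)"
    proof -
      have "b ^ 3 \<le> (2 * B) ^ 3" using b B by (intro power_mono) auto
      then have "b ^ 3 * u \<le> (2 * B) ^ 3 * (2 * U)" using u U B by (intro mult_mono) auto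
      then have "b ^ 3 * u * \<bar>h\<bar> \<le> (2 * B) ^ 3 * (2 * U) * \<bar>h\<bar>" by (intro mult_right_mono) auto
      also have "\<dots> = 16 * (U * B ^ 3 * \<bar>h\<bar>)" by (simp add: power_mult_distrib)
      finally show ?thesis using hb by linarith
    qed
    have part2: "b ^ 3 * \<bar>v - u * s\<bar> * \<bar>f\<bar> \<le> 16 * (4 / 2 ^ 9)"
    proof -
      have "(v - u * s) * (v + u * s) = v ^ 2 - u ^ 2 * t" by (simp add: s2[symmetric] power2_eq_square algebra_simps)
      also have "\<dots> = (b * v ^ 2 - a * u ^ 2) / b" using pos by (simp add: t_def field_simps)
      finally have "\<bar>v - u * s\<bar> * \<bar>v + u * s\<bar> = \<bar>(b * v ^ 2 - a * u ^ 2) / b\<bar>" by (simp flip: abs_mult)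
      also have "\<dots> \<le> 2 / b" using eq pos by (simp add: divide_right_mono)
      finally have 1: "\<bar>v - u * s\<bar> * \<bar>v + u * s\<bar> \<le> 2 / b" .
      have "U * (s1 / 2) \<le> u * s" using u s_ge U s1 by (intro mult_mono) auto
      then have us: "U * s1 / 2 \<le> \<bar>v + u * s\<bar>" using v by linarith
      have "\<bar>v - u * s\<bar> * (U * s1 / 2) \<le> 2 / b"
        using mult_left_mono[OF us, of "\<bar>v - u * s\<bar>"] 1 by simp
      then have "\<bar>v - u * s\<bar> * b \<le> 4 / (U * s1)" using pos U s1 by (simp add: field_simps)
      then have "b ^ 2 * (\<bar>v - u * s\<bar> * b) \<le> (2 * B) ^ 2 * (4 / (U * s1))"
        using b pos B U s1 by (intro mult_mono power_mono) auto
      then have "b ^ 3 * \<bar>v - u * s\<bar> \<le> 16 * W" by (simp add: W_def power2_eq_square power3_eq_cube mult_ac)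
      then have "b ^ 3 * \<bar>v - u * s\<bar> * \<bar>f\<bar> \<le> 16 * W * \<bar>f\<bar>" by (intro mult_right_mono) auto
      then show ?thesis using fb by linarith
    qed
    have "\<bar>real_of_int (ui * homog 3 E ai bi + vi * homog 3 F ai bi)\<bar>
      \<le> b ^ 3 * u * \<bar>h\<bar> + b ^ 3 * \<bar>v - u * s\<bar> * \<bar>f\<bar>"
    proof -
      have "\<bar>b ^ 3 * (u * h + (v - u * s) * f)\<bar> = b ^ 3 * \<bar>u * h + (v - u * s) * f\<bar>"
        using pos by (simp add: abs_mult)
      also have "\<dots> \<le> b ^ 3 * (\<bar>u * h\<bar> + \<bar>(v - u * s) * f\<bar>)"
        using pos by (intro mult_left_mono abs_triangle_ineq) auto
      also have "\<dots> = b ^ 3 * u * \<bar>h\<bar> + b ^ 3 * \<bar>v - u * s\<bar> * \<bar>f\<bar>"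
        using pos by (simp add: abs_mult distrib_left mult.assoc)
      finally show ?thesis unfolding split .
    qed
    then have "\<bar>real_of_int (ui * homog 3 E ai bi + vi * homog 3 F ai bi)\<bar> < 1"
      using part1 part2 by simp
    then show "ui * homog 3 E ai bi + vi * homog 3 F ai bi = 0" by linarith
  qed
qed

subsection \<open>Counting in a dyadic box\<close>

text \<open>Pairs \<open>(a, b)\<close> are counted and not solutions, because \<open>D\<close> is
  recovered from \<open>a b\<close>; hence \<open>u\<close> and \<open>v\<close> are only required
  to exist. Their size matters only through \<open>U\<close>, since the equation determines
  \<open>v\<close> from the other three.\<close>

definition near_pell_box :: "real \<Rightarrow> real \<Rightarrow> real \<Rightarrow> int \<Rightarrow> (int \<times> int) set" where
  "near_pell_box A B U c = {(a, b). A \<le> real_of_int a \<and> real_of_int a < 2 * A \<and>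
     B \<le> real_of_int b \<and> real_of_int b < 2 * B \<and> coprime a b \<and>
     (\<exists>u v. U \<le> real_of_int u \<and> real_of_int u < 2 * U \<and> 0 < v \<and> coprime u v \<and> b * v ^ 2 - a * u ^ 2 = c)}"

text \<open>A positive coprime pair is determined by the quotient \<open>a / b\<close>, which is a
  root of a nonzero polynomial. This bounds the pairs lost to the common factor of the two auxiliary
  forms.\<close>

lemma card_homog_roots:
  assumes H: "H \<noteq> 0" "degree H \<le> 3"
    and S: "\<And>a b. (a, b) \<in> S \<Longrightarrow> 0 < a \<and> 0 < b \<and> coprime a b \<and> homog 3 H a b = 0"
  shows "card S \<le> 3"
proof -
  define h where "h = map_poly real_of_int H"
  have h0: "h \<noteq> 0" using H by (simp add: h_def map_poly_eq_0_iff)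
  have "card S \<le> card {x. poly h x = 0}"
  proof (rule card_inj_on_le[where f = "\<lambda>(a, b). real_of_int a / real_of_int b"])
    show "inj_on (\<lambda>(a, b). real_of_int a / real_of_int b) S"
    proof (rule inj_onI, clarify)
      fix a b a' b' assume z: "(a, b) \<in> S" "(a', b') \<in> S"
        and eq: "real_of_int a / real_of_int b = real_of_int a' / real_of_int b'"
      note ab = S[OF z(1)] S[OF z(2)]
      have "real_of_int (a * b') = real_of_int (a' * b)" using eq ab by (simp add: field_simps)
      then have e: "a * b' = a' * b" by (simp only: of_int_eq_iff)
      have "a dvd a' * b" "a' dvd a * b'" "b dvd a * b'" "b' dvd a' * b"
        using e by (metis dvd_triv_left dvd_triv_right)+
      then have "a dvd a'" "a' dvd a" "b dvd b'" "b' dvd b"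
        using ab by (simp_all add: coprime_dvd_mult_left_iff coprime_dvd_mult_right_iff coprime_commute)
      then show "a = a' \<and> b = b'" using ab by (simp add: zdvd_antisym_nonneg)
    qed
    show "(\<lambda>(a, b). real_of_int a / real_of_int b) ` S \<subseteq> {x. poly h x = 0}"
    proof clarify
      fix a b assume z: "(a, b) \<in> S"
      note ab = S[OF z]
      have "real_of_int (homog 3 H a b) = real_of_int b ^ 3 * poly h (real_of_int a / real_of_int b)"
        unfolding h_def using H ab by (intro homog_eq_poly) auto
      then show "poly h (real_of_int a / real_of_int b) = 0" using ab by simp
    qed
    show "finite {x. poly h x = 0}" using h0 by (rule poly_roots_finite)
  qed
  also have "\<dots> \<le> degree h" using h0 by (rule card_poly_roots_bound)
  also have "degree h \<le> degree H" unfolding h_def by (rule map_poly_degree_leq)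
  finally show ?thesis using H by simp
qed

text \<open>Joins the auxiliary forms of one cell with a rational approximation of
  \<open>s0^2\<close>. In the bound, \<open>4\<close> stands for three zeros of the common factor
  and one point on the line through the origin; the next summand treats \<open>2 J + 1\<close> lines
  with at most seven points for each \<open>g\<close>, the last one a form that is constant on the
  lines, where removing the pairs near small fractions leaves only \<open>q > Q\<close>.\<close>

lemma card_cell_bound:
  "\<exists>(C::real) N::nat. C \<ge> 1 \<and> (\<forall>A B U K Q s0 c S. A \<ge> 1 \<longrightarrow> B \<ge> A \<longrightarrow> U \<ge> 1 \<longrightarrow> K \<ge> 1 \<longrightarrow> Q > 0 \<longrightarrow>
     2 ^ 221 * K ^ 11 < A * B \<longrightarrow> 2 ^ 221 * K ^ 13 * (A * U ^ 2) < (A * B) ^ 3 \<longrightarrow>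
     sqrt (A / B) / 2 \<le> s0 \<longrightarrow> s0 \<le> 2 * sqrt (A / B) \<longrightarrow> c \<noteq> 0 \<longrightarrow> \<bar>c\<bar> \<le> 2 \<longrightarrow>
     S \<subseteq> near_pell_box A B U c \<longrightarrow>
     (\<forall>(a, b)\<in>S. \<bar>sqrt (real_of_int a / real_of_int b) - s0\<bar> \<le> sqrt (A / B) * (K / (A * B))) \<longrightarrow>
     (\<exists>r. r \<noteq> 0 \<and> \<bar>real_of_int r\<bar> \<le> C * (A * B) ^ N \<and>
       real (card (S - near_small_fractions A B Q (nat \<lceil>12 * sqrt K\<rceil>))) \<le>
         4 + 7 * real (card {g. g dvd r}) * (2 * real (nat \<lceil>12 * sqrt K\<rceil>) + 1) +
         real (card {g. g dvd r}) * (2 * B / Q + 1)))"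
proof -
  obtain C :: real and N where C1: "C \<ge> 1" and aux: "\<forall>(E :: int poly) F (M :: real). E \<noteq> 0 \<or> F \<noteq> 0 \<longrightarrow>
     degree E \<le> 3 \<longrightarrow> degree F \<le> 3 \<longrightarrow> M \<ge> 1 \<longrightarrow>
     (\<forall>i. \<bar>real_of_int (coeff E i)\<bar> \<le> M \<and> \<bar>real_of_int (coeff F i)\<bar> \<le> M) \<longrightarrow>
     (\<exists>n G r H. odd n \<and> n \<le> 7 \<and> degree G \<le> n \<and> (\<forall>\<gamma>. G \<noteq> monom \<gamma> n) \<and>
       r \<noteq> 0 \<and> \<bar>real_of_int r\<bar> \<le> C * M ^ N \<and> H \<noteq> 0 \<and> degree H \<le> 3 \<and>
       (\<forall>a b u v. b > 0 \<longrightarrow> u > 0 \<longrightarrow> v > 0 \<longrightarrow> coprime a b \<longrightarrow> coprime u v \<longrightarrow>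
         u * homog 3 E a b + v * homog 3 F a b = 0 \<longrightarrow> homog 3 H a b = 0 \<or>
         (\<exists>g. g \<noteq> 0 \<and> g dvd r \<and> homog n G a b = (b * v ^ 2 - a * u ^ 2) * g ^ 2)))"
    using auxiliary_form by (elim exE conjE) (rule that)
  show ?thesis
  proof (rule exI[of _ C], rule exI[of _ "9 * N"], intro conjI allI impI)
    show "C \<ge> 1" by (rule C1)
    fix A B U K Q s0 :: real and c :: int and S :: "(int \<times> int) set"
    assume A: "A \<ge> 1" and AB: "B \<ge> A" and U: "U \<ge> 1" and K: "K \<ge> 1" and Q: "Q > 0"
      and big1: "2 ^ 221 * K ^ 11 < A * B" and big2: "2 ^ 221 * K ^ 13 * (A * U ^ 2) < (A * B) ^ 3"
      and s0: "sqrt (A / B) / 2 \<le> s0" "s0 \<le> 2 * sqrt (A / B)" and c: "c \<noteq> 0" "\<bar>c\<bar> \<le> 2"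
      and S: "S \<subseteq> near_pell_box A B U c"
      and close: "\<forall>(a, b)\<in>S. \<bar>sqrt (real_of_int a / real_of_int b) - s0\<bar> \<le> sqrt (A / B) * (K / (A * B))"
    define Y where "Y = A * B"
    define J where "J = nat \<lceil>12 * sqrt K\<rceil>"
    have B: "B \<ge> 1" using A AB by linarith
    have Y1: "Y \<ge> 1" unfolding Y_def using mult_mono[of 1 A 1 B] A B by simp
    from auxiliary_polynomial[OF A B U K big1 big2 s0, folded Y_def]
    obtain E F :: "int poly" where EF: "E \<noteq> 0 \<or> F \<noteq> 0" "degree E \<le> 3" "degree F \<le> 3"
      and cEF: "\<forall>i. \<bar>real_of_int (coeff E i)\<bar> \<le> Y ^ 9 \<and> \<bar>real_of_int (coeff F i)\<bar> \<le> Y ^ 9"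
      and van: "\<forall>a b u v. A \<le> real_of_int a \<longrightarrow> real_of_int a < 2 * A \<longrightarrow>
       B \<le> real_of_int b \<longrightarrow> real_of_int b < 2 * B \<longrightarrow>
       U \<le> real_of_int u \<longrightarrow> real_of_int u < 2 * U \<longrightarrow> 0 < v \<longrightarrow> \<bar>b * v ^ 2 - a * u ^ 2\<bar> \<le> 2 \<longrightarrow>
       \<bar>sqrt (real_of_int a / real_of_int b) - s0\<bar> \<le> sqrt (A / B) * (K / Y) \<longrightarrow>
       u * homog 3 E a b + v * homog 3 F a b = 0"
      by (elim exE conjE) (rule that)
    have Y9: "Y ^ 9 \<ge> 1" using Y1 by (rule one_le_power)
    from mp[OF mp[OF mp[OF mp[OF mp[OF spec[OF spec[OF spec[OF aux]]] EF(1)] EF(2)] EF(3)] Y9] cEF]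
    obtain n G r H where n: "odd n" "n \<le> 7" and G: "degree G \<le> n" "\<forall>\<gamma>. G \<noteq> monom \<gamma> n"
      and r: "r \<noteq> 0" "\<bar>real_of_int r\<bar> \<le> C * (Y ^ 9) ^ N" and H: "H \<noteq> 0" "degree H \<le> 3"
      and form: "\<forall>a b u v. b > 0 \<longrightarrow> u > 0 \<longrightarrow> v > 0 \<longrightarrow> coprime a b \<longrightarrow> coprime u v \<longrightarrow>
         u * homog 3 E a b + v * homog 3 F a b = 0 \<longrightarrow> homog 3 H a b = 0 \<or>
         (\<exists>g. g \<noteq> 0 \<and> g dvd r \<and> homog n G a b = (b * v ^ 2 - a * u ^ 2) * g ^ 2)"
      by (elim exE conjE) (rule that)
    define S' where "S' = S - near_small_fractions A B Q J"
    define SH where "SH = {(a, b) \<in> S'. homog 3 H a b = 0}"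
    define SG where "SG = S' - SH"
    have box: "A \<le> real_of_int a \<and> real_of_int a < 2 * A \<and> B \<le> real_of_int b \<and> real_of_int b < 2 * B \<and>
      0 < a \<and> 0 < b \<and> coprime a b \<and> (homog 3 H a b = 0 \<or> (\<exists>g. g \<noteq> 0 \<and> g dvd r \<and> homog n G a b = c * g ^ 2))"
      if "(a, b) \<in> S" for a b
    proof -
      have "(a, b) \<in> near_pell_box A B U c" using that S by blast
      then obtain u v where 1: "A \<le> real_of_int a" "real_of_int a < 2 * A" "B \<le> real_of_int b" "real_of_int b < 2 * B"
        "coprime a b" and u: "U \<le> real_of_int u" "real_of_int u < 2 * U" and v: "0 < v" "coprime u v"
        and eq: "b * v ^ 2 - a * u ^ 2 = c"
        unfolding near_pell_box_def by blast
      have pos: "0 < a" "0 < b" "0 < u" using 1 u A B U by linarith+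
      have "\<bar>sqrt (real_of_int a / real_of_int b) - s0\<bar> \<le> sqrt (A / B) * (K / Y)"
        using close that unfolding Y_def by blast
      then have "u * homog 3 E a b + v * homog 3 F a b = 0"
        using van[rule_format, OF 1(1-4) u v(1)] eq c by simp
      then show ?thesis using form pos v 1 eq by blast
    qed
    have cH: "card SH \<le> 3"
      by (rule card_homog_roots[OF H]) (use box in \<open>auto simp: SH_def S'_def\<close>)
    have sK: "sqrt K \<ge> 1" "sqrt K > 0" using K by auto
    have BK: "2 * sqrt K \<le> B"
    proof -
      have "K ^ 1 \<le> K ^ 11" using K by (intro power_increasing) auto
      then have "4 * K ^ 1 \<le> 2 ^ 221 * K ^ 11" using K by (intro mult_mono) auto
      then have "4 * K \<le> A * B" using big1 by simp
      also have "\<dots> \<le> B * B" using AB B by (intro mult_right_mono) auto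
      finally have "sqrt (4 * K) \<le> sqrt (B ^ 2)" by (simp only: real_sqrt_le_iff power2_eq_square)
      then show ?thesis using B by (simp add: real_sqrt_mult)
    qed
    \<comment> \<open>For \<open>q \<le> L\<close> the width of the cell contributes about
      \<open>B q K / B^2\<close> to \<open>a q - b p\<close>, and the approximation error about
      \<open>B / L\<close>. The choice \<open>B / \<surd>K\<close> makes both of order
      \<open>\<surd>K\<close>; the constants add up to \<open>12\<close>.\<close>
    define L where "L = nat \<lfloor>B / sqrt K\<rfloor>"
    have BsK: "2 \<le> B / sqrt K" using BK sK by (simp add: field_simps)
    have L: "L > 0" "real L \<le> B / sqrt K" "B / (2 * sqrt K) \<le> real L"
      using BsK unfolding L_def by linarith+
    obtain p q where pq: "coprime p q" "0 < q" "q \<le> int L"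
      and dir: "\<bar>real_of_int q * s0 ^ 2 - real_of_int p\<bar> < 1 / real L"
      using Dirichlet_approx_coprime[OF L(1)] by blast
    have s1: "sqrt (A / B) > 0" using A B by simp
    then have s0p: "s0 > 0" using s0 by linarith
    have p0: "p \<ge> 0"
    proof -
      have "1 / real L \<le> 1" using L(1) by simp
      moreover have "0 < real_of_int q * s0 ^ 2" using pq s0p by simp
      ultimately have "real_of_int p > -1" using dir by linarith
      then show ?thesis by linarith
    qed
    have line: "\<bar>a * q - b * p\<bar> \<le> int J" if z: "(a, b) \<in> S" for a b
    proof -
      note ab = box[OF z]
      define t where "t = real_of_int a / real_of_int b"
      have t0: "t > 0" using ab by (simp add: t_def)
      have bt: "real_of_int b * t = real_of_int a" using ab by (simp add: t_def)
      have sle: "sqrt t \<le> 2 * sqrt (A / B)"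
      proof -
        have "t \<le> (4 * A) / B" unfolding t_def using ab A B by (intro frac_le) auto
        then have "sqrt t \<le> sqrt (4 * (A / B))" by simp
        also have "\<dots> = sqrt 4 * sqrt (A / B)" by (rule real_sqrt_mult)
        finally show ?thesis by simp
      qed
      have "\<bar>t - s0 ^ 2\<bar> = \<bar>sqrt t - s0\<bar> * (sqrt t + s0)"
      proof -
        have "t = sqrt t ^ 2" using t0 by simp
        then have "t - s0 ^ 2 = (sqrt t - s0) * (sqrt t + s0)"
          by (simp add: power2_eq_square algebra_simps)
        then show ?thesis using t0 s0p by (simp add: abs_mult)
      qed
      also have "\<dots> \<le> (sqrt (A / B) * (K / (A * B))) * (4 * sqrt (A / B))"
        using close z sle s0 s0p t0 A B K by (intro mult_mono) (auto simp: t_def)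
      also have "\<dots> = 4 * (sqrt (A / B)) ^ 2 * (K / (A * B))"
      proof -
        have "y * k * (4 * y) = 4 * y ^ 2 * k" for y k :: real by (simp add: power2_eq_square)
        then show ?thesis .
      qed
      also have "\<dots> = 4 * K / B ^ 2" using A B by (simp add: field_simps power2_eq_square)
      finally have tt: "\<bar>t - s0 ^ 2\<bar> \<le> 4 * K / B ^ 2" .
      have "real_of_int q * \<bar>t - s0 ^ 2\<bar> \<le> (B / sqrt K) * (4 * K / B ^ 2)"
        using tt pq L by (intro mult_mono) auto
      also have "\<dots> = 4 * sqrt K / B" using B sK K by (simp add: field_simps power2_eq_square)
      finally have 1: "real_of_int q * \<bar>t - s0 ^ 2\<bar> \<le> 4 * sqrt K / B" .
      have "1 / real L \<le> 1 / (B / (2 * sqrt K))" using L B sK by (intro divide_left_mono) auto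
      then have 2: "\<bar>real_of_int q * s0 ^ 2 - real_of_int p\<bar> \<le> 2 * sqrt K / B" using dir by simp
      have "real_of_int (a * q - b * p)
        = real_of_int b * (real_of_int q * (t - s0 ^ 2) + (real_of_int q * s0 ^ 2 - real_of_int p))"
        by (simp add: bt[symmetric] algebra_simps)
      then have "\<bar>real_of_int (a * q - b * p)\<bar>
        = real_of_int b * \<bar>real_of_int q * (t - s0 ^ 2) + (real_of_int q * s0 ^ 2 - real_of_int p)\<bar>"
        using ab by (simp add: abs_mult)
      also have "\<dots> \<le> (2 * B) * (4 * sqrt K / B + 2 * sqrt K / B)"
      proof (intro mult_mono order_trans[OF abs_triangle_ineq] add_mono)
        show "\<bar>real_of_int q * (t - s0 ^ 2)\<bar> \<le> 4 * sqrt K / B" using 1 pq by (simp add: abs_mult)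
      qed (use ab 2 B in auto)
      also have "\<dots> = 12 * sqrt K" using B by (simp add: field_simps)
      finally have "real_of_int \<bar>a * q - b * p\<bar> \<le> 12 * sqrt K" by simp
      then show ?thesis unfolding J_def by linarith
    qed
    define \<tau> where "\<tau> = real (card {g. g dvd r})"
    have lines: "real (card SG) \<le> 1 + 7 * \<tau> * (2 * real J + 1) \<or>
      p \<ge> 1 \<and> real (card SG) \<le> 1 + \<tau> * (2 * B / real_of_int q + 1)"
      unfolding \<tau>_def
    proof (rule card_form_values_on_lines[OF n G c(1) r(1) pq(1) p0])
      show "1 \<le> q" "0 \<le> B" using pq B by auto
      fix a b assume "(a, b) \<in> SG"
      then have z: "(a, b) \<in> S" and "homog 3 H a b \<noteq> 0" by (auto simp: SG_def SH_def S'_def)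
      then show "0 < a \<and> 0 < b \<and> coprime a b \<and> real_of_int b < 2 * B \<and>
        \<bar>a * q - b * p\<bar> \<le> int J \<and> (\<exists>g. g \<noteq> 0 \<and> g dvd r \<and> homog n G a b = c * g ^ 2)"
        using box[OF z] line[OF z] by blast
    qed
    have cG: "real (card SG) \<le> 1 + 7 * \<tau> * (2 * real J + 1) + \<tau> * (2 * B / Q + 1)"
      using lines
    proof
      assume "real (card SG) \<le> 1 + 7 * \<tau> * (2 * real J + 1)"
      moreover have "0 \<le> \<tau> * (2 * B / Q + 1)" using B Q by (simp add: \<tau>_def)
      ultimately show ?thesis by linarith
    next
      assume *: "p \<ge> 1 \<and> real (card SG) \<le> 1 + \<tau> * (2 * B / real_of_int q + 1)"
      have J0: "0 \<le> 7 * \<tau> * (2 * real J + 1)" by (simp add: \<tau>_def)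
      show ?thesis
      proof (cases "SG = {}")
        case True
        moreover have "0 \<le> \<tau> * (2 * B / Q + 1)" using B Q by (simp add: \<tau>_def)
        ultimately show ?thesis using J0 by simp
      next
        case False
        then obtain a b where z: "(a, b) \<in> SG" by auto
        then have zS: "(a, b) \<in> S" and nb: "(a, b) \<notin> near_small_fractions A B Q J"
          by (auto simp: SG_def S'_def)
        \<comment> \<open>The whole cell lies on lines of the same direction \<open>p / q\<close>,
          so \<open>q \<le> Q\<close> together with \<open>p \<ge> 1\<close> would put each of its
          points into the removed set.\<close>
        have "\<not> real_of_int q \<le> Q"
        proof
          assume "real_of_int q \<le> Q"
          moreover have "1 \<le> q" using pq by simp
          ultimately have "(a, b) \<in> near_small_fractions A B Q J"
            unfolding near_small_fractions_def using box[OF zS] line[OF zS] * pq by blast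
          then show False using nb by simp
        qed
        then have "2 * B / real_of_int q \<le> 2 * B / Q" using Q B by (intro divide_left_mono) auto
        then have "\<tau> * (2 * B / real_of_int q + 1) \<le> \<tau> * (2 * B / Q + 1)"
          by (intro mult_left_mono) (auto simp: \<tau>_def)
        then show ?thesis using * J0 by linarith
      qed
    qed
    have "S' = SH \<union> SG" by (auto simp: SG_def SH_def)
    then have "card S' \<le> card SH + card SG" by (metis card_Un_le)
    then have "real (card S') \<le> 3 + real (card SG)" using cH by linarith
    then have "real (card S') \<le> 4 + 7 * \<tau> * (2 * real J + 1) + \<tau> * (2 * B / Q + 1)" using cG by linarith
    moreover have "\<bar>real_of_int r\<bar> \<le> C * (A * B) ^ (9 * N)" using r(2) by (simp add: Y_def power_mult)
    ultimately show "\<exists>r. r \<noteq> 0 \<and> \<bar>real_of_int r\<bar> \<le> C * (A * B) ^ (9 * N) \<and>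
       real (card (S - near_small_fractions A B Q (nat \<lceil>12 * sqrt K\<rceil>))) \<le>
         4 + 7 * real (card {g. g dvd r}) * (2 * real (nat \<lceil>12 * sqrt K\<rceil>) + 1) +
         real (card {g. g dvd r}) * (2 * B / Q + 1)"
      using r(1) unfolding S'_def \<tau>_def J_def by blast
  qed
qed

lemma card_near_pell_box_trivial:
  assumes "A \<ge> 1" "B \<ge> 1"
  shows "finite (near_pell_box A B U c)" "real (card (near_pell_box A B U c)) \<le> 4 * (A * B)"
proof -
  have interval: "real (card {\<lceil>x\<rceil>..\<lceil>2 * x\<rceil> - 1}) \<le> 2 * x" if "x \<ge> 1" for x :: real
  proof -
    have "\<lceil>x\<rceil> \<le> \<lceil>2 * x\<rceil>" using that by (intro ceiling_mono) auto
    then have "real (card {\<lceil>x\<rceil>..\<lceil>2 * x\<rceil> - 1}) = real_of_int (\<lceil>2 * x\<rceil> - \<lceil>x\<rceil>)" by simp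
    also have "\<dots> \<le> 2 * x" using that by linarith
    finally show ?thesis .
  qed
  have sub: "near_pell_box A B U c \<subseteq> {\<lceil>A\<rceil>..\<lceil>2 * A\<rceil> - 1} \<times> {\<lceil>B\<rceil>..\<lceil>2 * B\<rceil> - 1}"
    unfolding near_pell_box_def by (auto simp: ceiling_le_iff less_ceiling_iff zle_diff1_eq)
  then show "finite (near_pell_box A B U c)" by (rule finite_subset) auto
  have "card (near_pell_box A B U c) \<le> card ({\<lceil>A\<rceil>..\<lceil>2 * A\<rceil> - 1} \<times> {\<lceil>B\<rceil>..\<lceil>2 * B\<rceil> - 1})"
    by (rule card_mono[OF _ sub]) auto
  then have "real (card (near_pell_box A B U c))
    \<le> real (card {\<lceil>A\<rceil>..\<lceil>2 * A\<rceil> - 1}) * real (card {\<lceil>B\<rceil>..\<lceil>2 * B\<rceil> - 1})"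
    by (simp only: card_cartesian_product of_nat_mult[symmetric] of_nat_le_iff)
  also have "\<dots> \<le> (2 * A) * (2 * B)" using interval assms by (intro mult_mono) auto
  finally show "real (card (near_pell_box A B U c)) \<le> 4 * (A * B)" by simp
qed

lemma card_int_divisors:
  fixes r :: int
  assumes "r \<noteq> 0"
  shows "card {g. g dvd r} \<le> 2 * card {d. d dvd nat \<bar>r\<bar>}"
proof -
  have fin: "finite {d. d dvd nat \<bar>r\<bar>}" using assms by (intro finite_divisors_nat) simp
  have "{g. g dvd r} \<subseteq> int ` {d. d dvd nat \<bar>r\<bar>} \<union> (\<lambda>d. - int d) ` {d. d dvd nat \<bar>r\<bar>}"
  proof
    fix g assume "g \<in> {g. g dvd r}"
    then have "nat \<bar>g\<bar> dvd nat \<bar>r\<bar>" by (simp add: nat_abs_dvd_iff)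
    moreover have "g = int (nat \<bar>g\<bar>) \<or> g = - int (nat \<bar>g\<bar>)" by linarith
    ultimately show "g \<in> int ` {d. d dvd nat \<bar>r\<bar>} \<union> (\<lambda>d. - int d) ` {d. d dvd nat \<bar>r\<bar>}" by blast
  qed
  then have "card {g. g dvd r} \<le> card (int ` {d. d dvd nat \<bar>r\<bar>} \<union> (\<lambda>d. - int d) ` {d. d dvd nat \<bar>r\<bar>})"
    using fin by (intro card_mono) auto
  also have "\<dots> \<le> card (int ` {d. d dvd nat \<bar>r\<bar>}) + card ((\<lambda>d. - int d) ` {d. d dvd nat \<bar>r\<bar>})"
    by (rule card_Un_le)
  also have "\<dots> \<le> card {d. d dvd nat \<bar>r\<bar>} + card {d. d dvd nat \<bar>r\<bar>}"
    using fin by (intro add_mono card_image_le)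
  finally show ?thesis by simp
qed

text \<open>With \<open>K = Y powr \<kappa>\<close> there are at most \<open>3 Y / K\<close> cells,
  each with \<open>O(K powr (4 / 5))\<close> pairs, which saves \<open>K powr (1 / 5)\<close>; the
  pairs near small fractions number only \<open>O(Y K powr (- 1 / 4))\<close>.\<close>

lemma near_pell_box_bound:
  fixes \<theta> :: real
  assumes "\<theta> < 3"
  shows "\<exists>C c. C \<ge> 1 \<and> c > 0 \<and> c < 1 \<and> (\<forall>A B U k. A \<ge> 1 \<longrightarrow> B \<ge> A \<longrightarrow> U \<ge> 1 \<longrightarrow>
    A * U ^ 2 \<le> (A * B) powr \<theta> \<longrightarrow> k \<noteq> 0 \<longrightarrow> \<bar>k\<bar> \<le> 2 \<longrightarrow>
    real (card (near_pell_box A B U k)) \<le> C * (A * B) powr (1 - c))"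
proof -
  \<comment> \<open>The cell bound requires \<open>12 \<kappa> \<le> 1\<close> and
    \<open>14 \<kappa> + \<theta> \<le> 3\<close>; the latter uses
    \<open>\<theta> < 3\<close>.\<close>
  define \<kappa> where "\<kappa> = min 1 (3 - \<theta>) / 26"
  have \<kappa>: "\<kappa> > 0" "26 * \<kappa> \<le> 1" "26 * \<kappa> \<le> 3 - \<theta>" using assms by (auto simp: \<kappa>_def)
  from card_cell_bound obtain C1 :: real and N :: nat where C1: "C1 \<ge> 1"
    and cell: "\<forall>A B U K Q s0 c S. A \<ge> 1 \<longrightarrow> B \<ge> A \<longrightarrow> U \<ge> 1 \<longrightarrow> K \<ge> 1 \<longrightarrow> Q > 0 \<longrightarrow>
     2 ^ 221 * K ^ 11 < A * B \<longrightarrow> 2 ^ 221 * K ^ 13 * (A * U ^ 2) < (A * B) ^ 3 \<longrightarrow>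
     sqrt (A / B) / 2 \<le> s0 \<longrightarrow> s0 \<le> 2 * sqrt (A / B) \<longrightarrow> c \<noteq> 0 \<longrightarrow> \<bar>c\<bar> \<le> 2 \<longrightarrow>
     S \<subseteq> near_pell_box A B U c \<longrightarrow>
     (\<forall>(a, b)\<in>S. \<bar>sqrt (real_of_int a / real_of_int b) - s0\<bar> \<le> sqrt (A / B) * (K / (A * B))) \<longrightarrow>
     (\<exists>r. r \<noteq> 0 \<and> \<bar>real_of_int r\<bar> \<le> C1 * (A * B) ^ N \<and>
       real (card (S - near_small_fractions A B Q (nat \<lceil>12 * sqrt K\<rceil>))) \<le>
         4 + 7 * real (card {g. g dvd r}) * (2 * real (nat \<lceil>12 * sqrt K\<rceil>) + 1) +
         real (card {g. g dvd r}) * (2 * B / Q + 1))"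
    by (elim exE conjE) (rule that)
  \<comment> \<open>As \<open>\<bar>r\<bar> \<le> C1 Y^N\<close>, this exponent leaves
    \<open>O(K powr (1 / 20))\<close> divisors of \<open>r\<close>.\<close>
  define \<epsilon> where "\<epsilon> = \<kappa> / (20 * (real N + 1))"
  have \<epsilon>: "\<epsilon> > 0" "\<epsilon> \<le> 1" "real N * \<epsilon> \<le> \<kappa> / 20"
  proof -
    show "\<epsilon> > 0" using \<kappa> by (simp add: \<epsilon>_def)
    have "\<epsilon> \<le> \<kappa> / 20" unfolding \<epsilon>_def using \<kappa> by (intro divide_left_mono) auto
    then show "\<epsilon> \<le> 1" using \<kappa> by simp
    show "real N * \<epsilon> \<le> \<kappa> / 20" unfolding \<epsilon>_def using \<kappa> by (simp add: field_simps)
  qed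
  obtain C2 where C2: "C2 \<ge> 1" and div: "\<And>n::nat. n > 0 \<Longrightarrow> real (card {d. d dvd n}) \<le> C2 * real n powr \<epsilon>"
    using card_divisors_le_powr[OF \<epsilon>(1)] by blast
  define C3 where "C3 = 2 * C2 * C1"
  have C3: "C3 \<ge> 1" using mult_mono[of 1 C2 1 C1] C1 C2 by (simp add: C3_def)
  define C where "C = max (600 * C3 + 324) (4 * 2 ^ 221)"
  have main: "real (card (near_pell_box A B U k)) \<le> C * (A * B) powr (1 - \<kappa> / 5)"
    if A: "A \<ge> 1" and AB: "B \<ge> A" and U: "U \<ge> 1" and T: "A * U ^ 2 \<le> (A * B) powr \<theta>"
      and k: "k \<noteq> 0" "\<bar>k\<bar> \<le> 2" for A B U :: real and k :: int
  proof -
    define Y where "Y = A * B"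
    define K where "K = Y powr \<kappa>"
    have B: "B \<ge> 1" using A AB by linarith
    have Y1: "Y \<ge> 1" unfolding Y_def using mult_mono[of 1 A 1 B] A B by simp
    have K1: "K \<ge> 1" unfolding K_def using Y1 \<kappa> by (simp add: ge_one_powr_ge_zero)
    have Kpow: "K powr x = Y powr (\<kappa> * x)" for x by (simp add: K_def powr_powr)
    have Knat: "K ^ m = Y powr (\<kappa> * real m)" for m
      using K1 by (subst powr_realpow[symmetric]) (auto simp: Kpow)
    have Yc: "Y powr (1 - \<kappa> / 5) = Y * K powr (- 1 / 5)"
    proof -
      have "1 - \<kappa> / 5 = 1 + \<kappa> * (- 1 / 5)" by simp
      then have "Y powr (1 - \<kappa> / 5) = Y powr 1 * Y powr (\<kappa> * (- 1 / 5))" by (simp only: powr_add)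
      then show ?thesis using Y1 by (simp only: Kpow powr_one)
    qed
    show ?thesis
    proof (cases "K > 2 ^ 221")
      \<comment> \<open>For bounded \<open>K\<close> the trivial bound suffices; the second entry of
        the maximum in \<open>C\<close> is made for this case.\<close>
      case False
      have "K powr (1 / 5) \<le> K powr 1" using K1 by (intro powr_mono) auto
      then have K5: "K powr (1 / 5) \<le> 2 ^ 221" using False K1 by simp
      have "real (card (near_pell_box A B U k)) \<le> 4 * Y"
        using card_near_pell_box_trivial[OF A B] by (simp add: Y_def)
      also have "Y = K powr (1 / 5) * Y powr (1 - \<kappa> / 5)"
      proof -
        have "K powr (1 / 5) * K powr (- 1 / 5) = K powr (1 / 5 + - 1 / 5)" by (simp only: powr_add)
        then have "K powr (1 / 5) * K powr (- 1 / 5) = 1" using K1 by simp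
        then have "K powr (1 / 5) * (Y * K powr (- 1 / 5)) = Y" by (metis mult.left_commute mult.right_neutral)
        then show ?thesis unfolding Yc by simp
      qed
      also have "4 * (K powr (1 / 5) * Y powr (1 - \<kappa> / 5)) \<le> 4 * (2 ^ 221 * Y powr (1 - \<kappa> / 5))"
        using K5 by (intro mult_left_mono mult_right_mono) auto
      also have "\<dots> = (4 * 2 ^ 221) * Y powr (1 - \<kappa> / 5)" by simp
      also have "\<dots> \<le> C * Y powr (1 - \<kappa> / 5)" by (intro mult_right_mono) (auto simp: C_def)
      finally show ?thesis by (simp add: Y_def)
    next
      case True
      have big1: "2 ^ 221 * K ^ 11 < A * B"
      proof -
        have "2 ^ 221 * K ^ 11 < K * K ^ 11" using True K1 by (intro mult_strict_right_mono) auto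
        also have "\<dots> = Y powr (\<kappa> * 12)" using Knat[of 12] by (simp flip: power_Suc)
        also have "\<dots> \<le> Y powr 1" using Y1 \<kappa> by (intro powr_mono) auto
        finally show ?thesis using Y1 by (simp add: Y_def)
      qed
      have big2: "2 ^ 221 * K ^ 13 * (A * U ^ 2) < (A * B) ^ 3"
      proof -
        have "2 ^ 221 * K ^ 13 < K * K ^ 13" using True K1 by (intro mult_strict_right_mono) auto
        also have "\<dots> = Y powr (\<kappa> * 14)" using Knat[of 14] by (simp flip: power_Suc)
        finally have "2 ^ 221 * K ^ 13 * (A * U ^ 2) < Y powr (\<kappa> * 14) * (A * U ^ 2)"
          using A U by (intro mult_strict_right_mono) auto
        also have "\<dots> \<le> Y powr (\<kappa> * 14) * Y powr \<theta>"
          using T by (intro mult_left_mono) (auto simp: Y_def)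
        also have "\<dots> = Y powr (\<kappa> * 14 + \<theta>)" by (simp add: powr_add)
        also have "\<dots> \<le> Y powr 3" using Y1 \<kappa> by (intro powr_mono) auto
        also have "\<dots> = Y ^ 3" using Y1 by (simp add: powr_numeral)
        finally show ?thesis by (simp add: Y_def)
      qed
      define J where "J = nat \<lceil>12 * sqrt K\<rceil>"
      \<comment> \<open>The exponent of \<open>K\<close> has to exceed \<open>1 / 2\<close>, so that
        few pairs are removed, and to stay below \<open>1\<close>, so that \<open>B / Q\<close>
        points for each divisor remain fewer than \<open>K\<close>. With \<open>3 / 4\<close> and
        the \<open>1 / 20\<close> for the divisors the total is \<open>4 / 5\<close>.\<close>
      define Q where "Q = B / K powr (3 / 4)"
      define s1 where "s1 = sqrt (A / B)"
      define \<delta> where "\<delta> = s1 * (K / Y)"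
      define Bad where "Bad = near_small_fractions A B Q J"
      define Bx where "Bx = near_pell_box A B U k"
      have s1: "s1 > 0" using A B by (simp add: s1_def)
      have \<delta>: "\<delta> > 0" using s1 K1 Y1 by (simp add: \<delta>_def)
      have Q: "Q > 0" using B K1 by (simp add: Q_def)
      have sqK: "sqrt K = K powr (1 / 2)" using K1 by (simp add: powr_half_sqrt)
      have sqK1: "sqrt K \<ge> 1" using K1 by simp
      have J: "real J \<le> 13 * sqrt K" using sqK1 unfolding J_def by linarith
      have KY: "K \<le> Y"
      proof -
        have "Y powr \<kappa> \<le> Y powr 1" using Y1 \<kappa> by (intro powr_mono) auto
        then show ?thesis using Y1 by (simp add: K_def)
      qed
      have percell: "real (card (S - Bad)) \<le> 200 * C3 * K powr (4 / 5)"
        if S: "S \<subseteq> Bx" and close: "\<And>a b a' b'. (a, b) \<in> S \<Longrightarrow> (a', b') \<in> S \<Longrightarrow>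
          \<bar>sqrt (real_of_int a / real_of_int b) - sqrt (real_of_int a' / real_of_int b')\<bar> \<le> \<delta>" for S
      proof (cases "S = {}")
        case True
        then show ?thesis using C3 by simp
      next
        case False
        then obtain a0 b0 where z0: "(a0, b0) \<in> S" by auto
        \<comment> \<open>The centre is taken at a point of the cell: a cell of length
          \<open>\<delta>\<close> then lies within \<open>\<delta>\<close> of it, and the bounds for
          \<open>s0\<close> follow from those for \<open>a0\<close> and \<open>b0\<close>.\<close>
        define s0 where "s0 = sqrt (real_of_int a0 / real_of_int b0)"
        have ab0: "A \<le> real_of_int a0" "real_of_int a0 < 2 * A" "B \<le> real_of_int b0" "real_of_int b0 < 2 * B"
          using z0 S unfolding Bx_def near_pell_box_def by auto
        have s0_ge: "s1 / 2 \<le> s0"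
        proof -
          have "A / (4 * B) \<le> real_of_int a0 / real_of_int b0" using ab0 A B by (intro frac_le) auto
          then have "A / B / 4 \<le> real_of_int a0 / real_of_int b0" by simp
          then have "sqrt (A / B / 4) \<le> s0" unfolding s0_def by (simp only: real_sqrt_le_iff)
          moreover have "sqrt (A / B / 4) = s1 / sqrt 4" unfolding s1_def by (rule real_sqrt_divide)
          ultimately show ?thesis by simp
        qed
        have s0_le: "s0 \<le> 2 * s1"
        proof -
          have "real_of_int a0 / real_of_int b0 \<le> (4 * A) / B" using ab0 A B by (intro frac_le) auto
          then have "real_of_int a0 / real_of_int b0 \<le> 4 * (A / B)" by simp
          then have "s0 \<le> sqrt (4 * (A / B))" unfolding s0_def by (simp only: real_sqrt_le_iff)
          moreover have "sqrt (4 * (A / B)) = sqrt 4 * s1" unfolding s1_def by (rule real_sqrt_mult)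
          ultimately show ?thesis by simp
        qed
        have cl: "\<forall>(a, b)\<in>S. \<bar>sqrt (real_of_int a / real_of_int b) - s0\<bar> \<le> sqrt (A / B) * (K / (A * B))"
          using close z0 unfolding s0_def \<delta>_def s1_def Y_def by blast
        from cell[rule_format, OF A AB U K1 Q big1 big2 s0_ge[unfolded s1_def] s0_le[unfolded s1_def] k S[unfolded Bx_def] cl[rule_format]]
        obtain r where r: "r \<noteq> 0" "\<bar>real_of_int r\<bar> \<le> C1 * Y ^ N"
          and cS: "real (card (S - Bad)) \<le> 4 + 7 * real (card {g. g dvd r}) * (2 * real J + 1) +
            real (card {g. g dvd r}) * (2 * B / Q + 1)"
          unfolding Y_def Bad_def J_def by blast
        define \<tau> where "\<tau> = C3 * K powr (1 / 20)"
        have \<tau>: "real (card {g. g dvd r}) \<le> \<tau>"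
        proof -
          have "real (card {g. g dvd r}) \<le> 2 * real (card {d. d dvd nat \<bar>r\<bar>})"
            using card_int_divisors[OF r(1)] by linarith
          also have "\<dots> \<le> 2 * (C2 * real (nat \<bar>r\<bar>) powr \<epsilon>)" using div[of "nat \<bar>r\<bar>"] r(1) by simp
          also have "real (nat \<bar>r\<bar>) = \<bar>real_of_int r\<bar>" by simp
          also have "\<bar>real_of_int r\<bar> powr \<epsilon> \<le> (C1 * Y ^ N) powr \<epsilon>"
            using r(2) \<epsilon> by (intro powr_mono2) auto
          also have "(C1 * Y ^ N) powr \<epsilon> = C1 powr \<epsilon> * Y powr (real N * \<epsilon>)"
            using C1 Y1 by (simp add: powr_mult powr_powr flip: powr_realpow)
          also have "C1 powr \<epsilon> * Y powr (real N * \<epsilon>) \<le> C1 powr 1 * Y powr (\<kappa> * (1 / 20))"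
          proof (rule mult_mono)
            show "C1 powr \<epsilon> \<le> C1 powr 1" using C1 \<epsilon> by (intro powr_mono) auto
            show "Y powr (real N * \<epsilon>) \<le> Y powr (\<kappa> * (1 / 20))" using Y1 \<epsilon> by (intro powr_mono) auto
          qed auto
          also have "\<dots> = C1 * K powr (1 / 20)" using C1 by (simp add: Kpow)
          finally show ?thesis using C2 by (simp add: \<tau>_def C3_def mult_ac)
        qed
        have pw: "K powr x \<le> K powr (4 / 5)" if "x \<le> 4 / 5" for x using K1 that by (intro powr_mono) auto
        have \<tau>0: "\<tau> \<ge> 0" using C3 by (simp add: \<tau>_def)
        have J27: "2 * real J + 1 \<le> 27 * sqrt K" using J sqK1 by linarith
        have 1: "7 * real (card {g. g dvd r}) * (2 * real J + 1) \<le> 189 * C3 * K powr (4 / 5)"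
        proof -
          have "7 * real (card {g. g dvd r}) * (2 * real J + 1) \<le> 7 * \<tau> * (27 * sqrt K)"
            using \<tau> J27 \<tau>0 by (intro mult_mono) auto
          also have "\<dots> = 189 * C3 * K powr (1 / 20 + 1 / 2)"
          proof -
            have "7 * (C3 * y) * (27 * z) = 189 * C3 * (y * z)" for y z by simp
            then show ?thesis by (simp only: \<tau>_def sqK powr_add)
          qed
          also have "\<dots> \<le> 189 * C3 * K powr (4 / 5)" using C3 pw[of "1 / 20 + 1 / 2"] by (intro mult_left_mono) auto
          finally show ?thesis .
        qed
        have 2: "real (card {g. g dvd r}) * (2 * B / Q + 1) \<le> 3 * C3 * K powr (4 / 5)"
        proof -
          have "1 \<le> K powr (3 / 4)" using K1 by (simp add: ge_one_powr_ge_zero)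
          moreover have "2 * B / Q = 2 * K powr (3 / 4)" using B K1 by (simp add: Q_def)
          ultimately have "real (card {g. g dvd r}) * (2 * B / Q + 1) \<le> \<tau> * (3 * K powr (3 / 4))"
            using \<tau> \<tau>0 by (intro mult_mono) auto
          also have "\<dots> = 3 * C3 * K powr (1 / 20 + 3 / 4)"
          proof -
            have "(C3 * y) * (3 * z) = 3 * C3 * (y * z)" for y z by simp
            then show ?thesis by (simp only: \<tau>_def powr_add)
          qed
          also have "\<dots> = 3 * C3 * K powr (4 / 5)" by simp
          finally show ?thesis .
        qed
        have 3: "4 \<le> 4 * C3 * K powr (4 / 5)"
          using mult_mono[of 1 C3 1 "K powr (4 / 5)"] C3 K1 by (simp add: ge_one_powr_ge_zero)
        have "0 \<le> C3 * K powr (4 / 5)" using C3 by simp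
        then show ?thesis using cS 1 2 3 by simp
      qed
      define idx where "idx = (\<lambda>(a, b). nat \<lfloor>sqrt (real_of_int a / real_of_int b) / \<delta>\<rfloor>)"
      \<comment> \<open>\<open>\<surd>(a / b)\<close> is at most \<open>2 s1\<close> and
        \<open>\<delta> = s1 K / Y\<close>, so no cell has an index above
        \<open>2 Y / K\<close>.\<close>
      define M where "M = nat \<lfloor>2 * Y / K\<rfloor>"
      define cel where "cel = (\<lambda>i. {z \<in> Bx. idx z = i})"
      have finBx: "finite Bx" unfolding Bx_def using card_near_pell_box_trivial[OF A B] by simp
      have Bx: "0 < a \<and> 0 < b \<and> sqrt (real_of_int a / real_of_int b) \<le> 2 * s1"
        if "(a, b) \<in> Bx" for a b
      proof -
        have ab: "A \<le> real_of_int a" "real_of_int a < 2 * A" "B \<le> real_of_int b" "real_of_int b < 2 * B"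
          using that unfolding Bx_def near_pell_box_def by auto
        have "real_of_int a / real_of_int b \<le> (4 * A) / B" using ab A B by (intro frac_le) auto
        then have "sqrt (real_of_int a / real_of_int b) \<le> sqrt (4 * (A / B))" by (simp only: real_sqrt_le_iff times_divide_eq_right)
        moreover have "sqrt (4 * (A / B)) = sqrt 4 * s1" unfolding s1_def by (rule real_sqrt_mult)
        ultimately have "sqrt (real_of_int a / real_of_int b) \<le> 2 * s1" by (simp only: real_sqrt_four)
        moreover have "0 < a" "0 < b" using ab A B by linarith+
        ultimately show ?thesis by blast
      qed
      have union: "Bx - Bad \<subseteq> (\<Union>i\<in>{..M}. cel i - Bad)"
      proof clarify
        fix a b assume z: "(a, b) \<in> Bx" "(a, b) \<notin> Bad"
        have "sqrt (real_of_int a / real_of_int b) / \<delta> \<le> 2 * s1 / \<delta>"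
          using Bx[OF z(1)] \<delta> by (intro divide_right_mono) auto
        also have "\<dots> = 2 * Y / K" using s1 by (simp add: \<delta>_def)
        finally have "idx (a, b) \<le> M" unfolding idx_def M_def by (simp add: floor_mono nat_mono)
        then show "(a, b) \<in> (\<Union>i\<in>{..M}. cel i - Bad)" using z by (auto simp: cel_def)
      qed
      have cellc: "real (card (cel i - Bad)) \<le> 200 * C3 * K powr (4 / 5)" for i
      proof (rule percell)
        show "cel i \<subseteq> Bx" by (auto simp: cel_def)
        fix a b a' b' assume z: "(a, b) \<in> cel i" "(a', b') \<in> cel i"
        have nn: "0 \<le> sqrt (real_of_int a / real_of_int b) / \<delta>" "0 \<le> sqrt (real_of_int a' / real_of_int b') / \<delta>"
          using Bx[of a b] Bx[of a' b'] z \<delta> by (auto simp: cel_def)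
        have "nat \<lfloor>sqrt (real_of_int a / real_of_int b) / \<delta>\<rfloor> = nat \<lfloor>sqrt (real_of_int a' / real_of_int b') / \<delta>\<rfloor>"
          using z by (simp add: cel_def idx_def)
        then have "\<lfloor>sqrt (real_of_int a / real_of_int b) / \<delta>\<rfloor> = \<lfloor>sqrt (real_of_int a' / real_of_int b') / \<delta>\<rfloor>"
          using nn by (simp add: nat_eq_iff)
        then have "\<bar>sqrt (real_of_int a / real_of_int b) / \<delta> - sqrt (real_of_int a' / real_of_int b') / \<delta>\<bar> \<le> 1"
          by linarith
        then have "\<bar>sqrt (real_of_int a / real_of_int b) - sqrt (real_of_int a' / real_of_int b')\<bar> / \<delta> \<le> 1"
          using \<delta> by (simp add: abs_divide flip: diff_divide_distrib)
        then show "\<bar>sqrt (real_of_int a / real_of_int b) - sqrt (real_of_int a' / real_of_int b')\<bar> \<le> \<delta>"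
          using \<delta> by (simp add: divide_le_eq)
      qed
      have "card (Bx - Bad) \<le> (\<Sum>i\<in>{..M}. card (cel i - Bad))"
        using finBx by (intro order_trans[OF card_mono[OF _ union] card_UN_le]) (auto simp: cel_def)
      then have "real (card (Bx - Bad)) \<le> (\<Sum>i\<in>{..M}. real (card (cel i - Bad)))"
        by (metis of_nat_le_iff of_nat_sum)
      also have "\<dots> \<le> (\<Sum>i\<in>{..M}. 200 * C3 * K powr (4 / 5))" using cellc by (intro sum_mono)
      also have "\<dots> = real (M + 1) * (200 * C3 * K powr (4 / 5))" by simp
      also have "real (M + 1) \<le> 3 * Y / K"
      proof -
        have "1 \<le> Y / K" using KY K1 by simp
        moreover have "real M \<le> 2 * Y / K" unfolding M_def using Y1 K1 by simp
        ultimately show ?thesis by simp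
      qed
      then have "real (M + 1) * (200 * C3 * K powr (4 / 5)) \<le> 3 * Y / K * (200 * C3 * K powr (4 / 5))"
        using C3 by (intro mult_right_mono) auto
      also have "\<dots> = 600 * C3 * (Y * K powr (- 1 / 5))"
      proof -
        have "K powr (- 1 / 5) = K powr (4 / 5 - 1)" by simp
        also have "\<dots> = K powr (4 / 5) / K powr 1" by (rule powr_diff)
        also have "\<dots> = K powr (4 / 5) / K" using K1 by simp
        finally show ?thesis by simp
      qed
      finally have c1: "real (card (Bx - Bad)) \<le> 600 * C3 * (Y * K powr (- 1 / 5))" .
      have KB: "K \<le> B"
      proof -
        have "K ^ 2 \<le> 2 ^ 221 * K ^ 11"
        proof -
          have "K ^ 2 \<le> K ^ 11" using K1 by (intro power_increasing) auto
          also have "\<dots> \<le> 2 ^ 221 * K ^ 11" using K1 by simp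
          finally show ?thesis .
        qed
        also have "\<dots> \<le> A * B" using big1 by simp
        also have "\<dots> \<le> B * B" using AB B by (intro mult_right_mono) auto
        finally have "K ^ 2 \<le> B ^ 2" by (simp only: power2_eq_square)
        then show ?thesis by (rule power2_le_imp_le) (use B in simp)
      qed
      have J2: "2 * real J \<le> B"
      proof -
        have "26 ^ 2 \<le> K" using True by simp
        then have "26 \<le> sqrt K" by (rule real_le_rsqrt)
        then have "26 * sqrt K \<le> sqrt K * sqrt K" using sqK1 by (intro mult_right_mono) auto
        also have "\<dots> = K" using K1 by simp
        finally show ?thesis using J KB by linarith
      qed
      have QB: "Q \<le> B"
        unfolding Q_def using B K1 by (simp add: divide_le_eq ge_one_powr_ge_zero)
      note bad = card_near_small_fractions[OF _ J2 _ QB, of A, folded Bad_def]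
      have finBad: "finite Bad" using bad(1) A B Q by simp
      have "real (card Bad) \<le> 12 * A * (2 * real J + 1) * Q" using bad(2) A B Q by simp
      also have "\<dots> \<le> 12 * A * (27 * sqrt K) * Q"
      proof -
        have "2 * real J + 1 \<le> 27 * sqrt K" using J sqK1 by linarith
        then show ?thesis using A Q by (intro mult_right_mono mult_left_mono) auto
      qed
      also have "\<dots> = 324 * (Y * (K powr (1 / 2) / K powr (3 / 4)))" by (simp add: sqK Q_def Y_def)
      also have "K powr (1 / 2) / K powr (3 / 4) = K powr (1 / 2 - 3 / 4)" by (simp only: powr_diff)
      also have "324 * (Y * K powr (1 / 2 - 3 / 4)) \<le> 324 * (Y * K powr (- 1 / 5))"
        using K1 Y1 by (intro mult_left_mono powr_mono) auto
      finally have c2: "real (card Bad) \<le> 324 * (Y * K powr (- 1 / 5))" .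
      have "card Bx \<le> card ((Bx - Bad) \<union> Bad)" using finBx finBad by (intro card_mono) auto
      also have "\<dots> \<le> card (Bx - Bad) + card Bad" by (rule card_Un_le)
      finally have "real (card Bx) \<le> real (card (Bx - Bad)) + real (card Bad)" by linarith
      also have "\<dots> \<le> (600 * C3 + 324) * (Y * K powr (- 1 / 5))" using c1 c2 by (simp add: distrib_right)
      also have "\<dots> \<le> C * (Y * K powr (- 1 / 5))" using Y1 by (intro mult_right_mono) (auto simp: C_def)
      finally show ?thesis using Yc by (simp add: Bx_def Y_def)
    qed
  qed
  show ?thesis
  proof (rule exI[of _ C], rule exI[of _ "\<kappa> / 5"], intro conjI allI impI)
    show "1 \<le> C" by (simp add: C_def)
    show "0 < \<kappa> / 5" "\<kappa> / 5 < 1" using \<kappa> by auto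
  qed (rule main)
qed

subsection \<open>The Pell equation\<close>

lemma nonsquare_pell_norm_nonzero:
  fixes h k :: int
  assumes "\<not> is_square (D::nat)" "k \<noteq> 0"
  shows "h ^ 2 \<noteq> int D * k ^ 2"
proof
  assume eq: "h ^ 2 = int D * k ^ 2"
  then have "k ^ 2 dvd h ^ 2" by simp
  then have "k dvd h" by simp
  then obtain m where m: "h = k * m" by (elim dvdE)
  then have "k ^ 2 * m ^ 2 = k ^ 2 * int D" using eq by (simp add: power_mult_distrib mult.commute)
  then have "m ^ 2 = int D" using assms(2) by simp
  then have "int ((nat \<bar>m\<bar>) ^ 2) = int D" by simp
  then have "D = (nat \<bar>m\<bar>) ^ 2" by (simp only: of_nat_eq_iff)
  then show False using assms(1) by (auto simp: is_nth_power_def)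
qed

text \<open>Dirichlet's theorem makes \<open>\<bar>k \<surd>D - h\<bar>\<close> smaller than
  \<open>1 / N\<close> with \<open>k \<le> N\<close>, and the norm is this number times
  \<open>k \<surd>D + h\<close>. Finitely many pairs would keep
  \<open>\<bar>k \<surd>D - h\<bar>\<close> away from \<open>0\<close>, since
  \<open>\<surd>D\<close> is irrational.\<close>

lemma infinite_small_pell_norms:
  assumes D: "\<not> is_square (D::nat)" "D > 1"
  shows "infinite {(h::int, k::int). h > 0 \<and> k > 0 \<and> \<bar>real_of_int (h ^ 2 - int D * k ^ 2)\<bar> \<le> 2 * sqrt (real D) + 1}"
    (is "infinite ?S")
proof
  assume fin: "finite ?S"
  define \<theta> where "\<theta> = sqrt (real D)"
  have \<theta>2: "\<theta> ^ 2 = real D" by (simp add: \<theta>_def)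
  have \<theta>1: "\<theta> > 1" using D(2) by (simp add: \<theta>_def)
  have approx: "\<exists>h k. (h, k) \<in> ?S \<and> \<bar>real_of_int k * \<theta> - real_of_int h\<bar> < 1 / real N" if N0: "N > 0" for N
  proof -
    obtain h k where k: "0 < k" "k \<le> int N" and hk: "\<bar>real_of_int k * \<theta> - real_of_int h\<bar> < 1 / real N"
      using Dirichlet_approx[OF N0] by blast
    have N1: "1 / real N \<le> 1" using N0 by simp
    have k1: "1 \<le> real_of_int k" using k by linarith
    have "1 * \<theta> \<le> real_of_int k * \<theta>" using k1 \<theta>1 by (intro mult_right_mono) auto
    then have h0: "real_of_int h > 0" using hk N1 \<theta>1 by linarith
    have "\<bar>real_of_int (h ^ 2 - int D * k ^ 2)\<bar> = \<bar>real_of_int k * \<theta> - real_of_int h\<bar> * (real_of_int k * \<theta> + real_of_int h)"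
    proof -
      have "real_of_int (h ^ 2 - int D * k ^ 2) = - ((real_of_int k * \<theta> - real_of_int h) * (real_of_int k * \<theta> + real_of_int h))"
        by (simp add: \<theta>2[symmetric] power2_eq_square algebra_simps)
      then show ?thesis using h0 k1 \<theta>1 by (simp add: abs_mult)
    qed
    also have "\<dots> \<le> 1 / real N * (2 * real N * \<theta> + 1)"
    proof (rule mult_mono)
      have "real_of_int k * \<theta> \<le> real N * \<theta>" using k \<theta>1 by (intro mult_right_mono) auto
      then show "real_of_int k * \<theta> + real_of_int h \<le> 2 * real N * \<theta> + 1" using hk N1 by linarith
    qed (use hk h0 k1 \<theta>1 in auto)
    also have "\<dots> = 2 * \<theta> + 1 / real N" using N0 by (simp add: field_simps)
    also have "\<dots> \<le> 2 * \<theta> + 1" using N1 by simp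
    finally have "(h, k) \<in> ?S" using k h0 by (simp add: \<theta>_def)
    then show ?thesis using hk by blast
  qed
  define f where "f = (\<lambda>(h::int, k::int). \<bar>real_of_int k * \<theta> - real_of_int h\<bar>)"
  have fpos: "f z > 0" if "z \<in> ?S" for z
  proof -
    obtain h k where z: "z = (h, k)" by (cases z)
    have "real_of_int k * \<theta> \<noteq> real_of_int h"
    proof
      assume "real_of_int k * \<theta> = real_of_int h"
      then have "(real_of_int h) ^ 2 = real D * (real_of_int k) ^ 2" by (metis \<theta>2 mult.commute power_mult_distrib)
      then have "real_of_int (h ^ 2) = real_of_int (int D * k ^ 2)" by simp
      then have "h ^ 2 = int D * k ^ 2" by (simp only: of_int_eq_iff)
      then show False using nonsquare_pell_norm_nonzero[OF D(1), of k h] that z by simp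
    qed
    then show ?thesis by (simp add: f_def z)
  qed
  have "?S \<noteq> {}" using approx[of 1] by auto
  then have "Min (f ` ?S) > 0" using fin fpos by (subst Min_gr_iff) auto
  then obtain N where N: "1 / real (Suc N) < Min (f ` ?S)" using reals_Archimedean
    by (auto simp: inverse_eq_divide)
  obtain h k where hk: "(h, k) \<in> ?S" "\<bar>real_of_int k * \<theta> - real_of_int h\<bar> < 1 / real (Suc N)"
    using approx[of "Suc N"] by blast
  have "Min (f ` ?S) \<le> f (h, k)" using fin hk(1) by (intro Min_le) auto
  then show False using N hk(2) by (simp add: f_def)
qed

text \<open>Two distinct pairs with the same norm \<open>m\<close> and the same residues modulo
  \<open>m\<close> have a quotient with integral coordinates and norm \<open>1\<close>.\<close>

lemma pell_solution_exists:
  assumes D: "\<not> is_square (D::nat)" "D > 1"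
  shows "\<exists>x y::int. y > 0 \<and> x > 0 \<and> x ^ 2 - int D * y ^ 2 = 1"
proof -
  define S where "S = {(h::int, k::int). h > 0 \<and> k > 0 \<and> \<bar>real_of_int (h ^ 2 - int D * k ^ 2)\<bar> \<le> 2 * sqrt (real D) + 1}"
  have inf: "infinite S" unfolding S_def by (rule infinite_small_pell_norms[OF D])
  define nrm where "nrm = (\<lambda>(h::int, k::int). h ^ 2 - int D * k ^ 2)"
  define F where "F = (\<lambda>z. (nrm z, fst z mod \<bar>nrm z\<bar>, snd z mod \<bar>nrm z\<bar>))"
  define M where "M = \<lceil>2 * sqrt (real D) + 1\<rceil>"
  have nz: "nrm z \<noteq> 0" if "z \<in> S" for z
    using nonsquare_pell_norm_nonzero[OF D(1)] that by (auto simp: S_def nrm_def)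
  have "F ` S \<subseteq> {-M..M} \<times> {0..M} \<times> {0..M}"
  proof (rule image_subsetI)
    fix z assume z: "z \<in> S"
    have "real_of_int \<bar>nrm z\<bar> \<le> 2 * sqrt (real D) + 1" using z by (auto simp: S_def nrm_def)
    then have 1: "\<bar>nrm z\<bar> \<le> M" unfolding M_def by linarith
    have "0 < \<bar>nrm z\<bar>" using nz[OF z] by simp
    then have "0 \<le> fst z mod \<bar>nrm z\<bar>" "fst z mod \<bar>nrm z\<bar> < \<bar>nrm z\<bar>"
      "0 \<le> snd z mod \<bar>nrm z\<bar>" "snd z mod \<bar>nrm z\<bar> < \<bar>nrm z\<bar>"
      by (simp_all add: pos_mod_bound)
    then have "nrm z \<in> {-M..M}" "fst z mod \<bar>nrm z\<bar> \<in> {0..M}" "snd z mod \<bar>nrm z\<bar> \<in> {0..M}"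
      using 1 unfolding atLeastAtMost_iff by linarith+
    then show "F z \<in> {-M..M} \<times> {0..M} \<times> {0..M}" unfolding F_def by blast
  qed
  then have "finite (F ` S)" by (rule finite_subset) auto
  then obtain z0 where z0: "z0 \<in> S" "infinite {z \<in> S. F z = F z0}"
    using pigeonhole_infinite[OF inf] by blast
  then have "{z \<in> S. F z = F z0} - {z0} \<noteq> {}" by (metis finite.emptyI finite_Diff_insert finite_Diff2 finite.insertI)
  then obtain z1 where z1: "z1 \<in> S" "F z1 = F z0" "z1 \<noteq> z0" by blast
  obtain a b where ab: "z0 = (a, b)" by (cases z0)
  obtain c d where cd: "z1 = (c, d)" by (cases z1)
  define m where "m = nrm z0"
  have m0: "m \<noteq> 0" using nz[OF z0(1)] by (simp add: m_def)
  have pos: "a > 0" "b > 0" "c > 0" "d > 0" using z0(1) z1(1) by (auto simp: S_def ab cd)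
  have nab: "a ^ 2 - int D * b ^ 2 = m" by (simp add: m_def nrm_def ab)
  have ncd: "c ^ 2 - int D * d ^ 2 = m" using z1(2) by (simp add: m_def nrm_def ab cd F_def)
  have "c mod \<bar>m\<bar> = a mod \<bar>m\<bar>" "d mod \<bar>m\<bar> = b mod \<bar>m\<bar>"
    using z1(2) by (auto simp: F_def m_def ab cd)
  then have "\<bar>m\<bar> dvd c - a" "\<bar>m\<bar> dvd d - b" by (simp_all add: mod_eq_dvd_iff)
  then have "m dvd c - a" "m dvd d - b" by simp_all
  then obtain r s where r: "c = a + m * r" and s: "d = b + m * s"
    by (metis add.commute diff_add_cancel dvdE)
  \<comment> \<open>The quotient \<open>(c + d \<surd>D) / (a + b \<surd>D)\<close>, written with
    \<open>c = a + m r\<close> and \<open>d = b + m s\<close> so that no division occurs.\<close>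
  define x where "x = a * r - int D * b * s + 1"
  define y where "y = a * s - b * r"
  have mx: "a * c - int D * b * d = m * x" using nab by (simp add: x_def r s power2_eq_square algebra_simps)
  have my: "a * d - b * c = m * y" by (simp add: y_def r s algebra_simps)
  have "m ^ 2 * (x ^ 2 - int D * y ^ 2) = (a * c - int D * b * d) ^ 2 - int D * (a * d - b * c) ^ 2"
    unfolding mx my by (simp add: power2_eq_square algebra_simps)
  also have "\<dots> = (a ^ 2 - int D * b ^ 2) * (c ^ 2 - int D * d ^ 2)" by (simp add: power2_eq_square algebra_simps)
  also have "\<dots> = m ^ 2 * 1" unfolding nab ncd by (simp add: power2_eq_square)
  finally have sol: "x ^ 2 - int D * y ^ 2 = 1" using m0 by simp
  have y0: "y \<noteq> 0"
  proof
    assume "y = 0"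
    then have e: "a * d = b * c" using my by simp
    have "d ^ 2 * m = (a * d) ^ 2 - int D * b ^ 2 * d ^ 2" by (simp add: nab[symmetric] power2_eq_square algebra_simps)
    also have "\<dots> = b ^ 2 * m" unfolding e by (simp add: ncd[symmetric] power2_eq_square algebra_simps)
    finally have "d ^ 2 = b ^ 2" using m0 by simp
    then have "d = b" using pos by (simp add: power2_eq_iff)
    then have "a = c" using e pos by simp
    then show False using z1(3) \<open>d = b\<close> ab cd by simp
  qed
  have x0: "x \<noteq> 0"
  proof
    assume "x = 0"
    then have "int D * y ^ 2 = -1" using sol by simp
    moreover have "0 \<le> int D * y ^ 2" by simp
    ultimately show False by linarith
  qed
  show ?thesis
    using x0 y0 sol by (intro exI[of _ "\<bar>x\<bar>"] exI[of _ "\<bar>y\<bar>"]) simp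
qed

section \<open>The group of Pell solutions and its generator\<close>

lemma pell_real_mult:
  assumes "g \<in> pell_real D ` pell_solutions D" "h \<in> pell_real D ` pell_solutions D"
  shows "g * h \<in> pell_real D ` pell_solutions D"
proof -
  obtain a b where g: "a ^ 2 - int D * b ^ 2 = 1" "g = real_of_int a + real_of_int b * sqrt (real D)"
    using assms(1) by (auto simp: pell_real_def pell_solutions_def)
  obtain c d where h: "c ^ 2 - int D * d ^ 2 = 1" "h = real_of_int c + real_of_int d * sqrt (real D)"
    using assms(2) by (auto simp: pell_real_def pell_solutions_def)
  have "(a * c + int D * b * d) ^ 2 - int D * (a * d + b * c) ^ 2
    = (a ^ 2 - int D * b ^ 2) * (c ^ 2 - int D * d ^ 2)" by (simp add: power2_eq_square algebra_simps)
  then have "(a * c + int D * b * d, a * d + b * c) \<in> pell_solutions D" using g h by (simp add: pell_solutions_def)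
  moreover have "pell_real D (a * c + int D * b * d, a * d + b * c) = g * h"
  proof -
    have "sqrt (real D) * sqrt (real D) = real D" by simp
    then have "g * h = real_of_int a * real_of_int c + real D * real_of_int b * real_of_int d
      + (real_of_int a * real_of_int d + real_of_int b * real_of_int c) * sqrt (real D)"
      unfolding g(2) h(2) by (simp add: distrib_left distrib_right mult_ac)
    then show ?thesis by (simp add: pell_real_def)
  qed
  ultimately show ?thesis by (metis imageI)
qed

lemma pell_real_inverse:
  assumes "g \<in> pell_real D ` pell_solutions D"
  shows "inverse g \<in> pell_real D ` pell_solutions D"
proof -
  obtain a b where g: "a ^ 2 - int D * b ^ 2 = 1" "g = real_of_int a + real_of_int b * sqrt (real D)"
    using assms by (auto simp: pell_real_def pell_solutions_def)
  have "g * (real_of_int a - real_of_int b * sqrt (real D)) = real_of_int (a ^ 2 - int D * b ^ 2)"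
  proof -
    have "sqrt (real D) * sqrt (real D) = real D" by simp
    then show ?thesis unfolding g(2) by (simp add: power2_eq_square algebra_simps)
  qed
  then have "g * (real_of_int a - real_of_int b * sqrt (real D)) = 1" using g by simp
  then have "inverse g = real_of_int a - real_of_int b * sqrt (real D)" by (metis inverse_unique)
  moreover have "(a, - b) \<in> pell_solutions D" using g by (simp add: pell_solutions_def)
  ultimately show ?thesis by (auto simp: pell_real_def intro!: image_eqI[of _ _ "(a, - b)"])
qed

lemma pell_real_uminus:
  assumes "g \<in> pell_real D ` pell_solutions D"
  shows "- g \<in> pell_real D ` pell_solutions D"
proof -
  obtain a b where g: "a ^ 2 - int D * b ^ 2 = 1" "g = real_of_int a + real_of_int b * sqrt (real D)"
    using assms by (auto simp: pell_real_def pell_solutions_def)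
  then show ?thesis
    by (intro image_eqI[of _ _ "(- a, - b)"]) (auto simp: pell_real_def pell_solutions_def)
qed

lemma pell_real_one: "1 \<in> pell_real D ` pell_solutions D"
  by (intro image_eqI[of _ _ "(1, 0)"]) (auto simp: pell_real_def pell_solutions_def)

lemma pell_real_powi:
  assumes "e \<in> pell_real D ` pell_solutions D"
  shows "e powi n \<in> pell_real D ` pell_solutions D"
proof -
  have "e ^ m \<in> pell_real D ` pell_solutions D" for m
    by (induction m) (auto simp: pell_real_one intro: pell_real_mult[OF assms])
  then show ?thesis by (auto simp: power_int_def power_inverse intro: pell_real_inverse)
qed

text \<open>The count needs only one nontrivial solution with \<open>T\<close> bounded by the
  fundamental one. But \<open>pell_fundamental\<close> is a definite description, so the least
  positive solution has to be shown to generate the group.\<close>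

lemma pell_fundamental_solution:
  assumes D: "\<not> is_square (D::nat)" "D > 1"
  shows "\<exists>T U::int. T > 1 \<and> U > 0 \<and> T ^ 2 - int D * U ^ 2 = 1 \<and> real_of_int T \<le> pell_fundamental D"
proof -
  define P where "P = (\<lambda>n::nat. n > 0 \<and> (\<exists>x::int. x > 0 \<and> x ^ 2 - int D * (int n) ^ 2 = 1))"
  obtain x0 y0 :: int where xy0: "y0 > 0" "x0 > 0" "x0 ^ 2 - int D * y0 ^ 2 = 1"
    using pell_solution_exists[OF D] by blast
  have "P (nat y0)" unfolding P_def using xy0 by auto
  \<comment> \<open>Among positive solutions, minimality of the second coordinate also minimises the
    first one and hence the real number.\<close>
  define y1 where "y1 = (LEAST n. P n)"
  have Py: "P y1" unfolding y1_def using \<open>P (nat y0)\<close> by (rule LeastI)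
  then obtain x1 where x1: "y1 > 0" "x1 > 0" "x1 ^ 2 - int D * (int y1) ^ 2 = 1" unfolding P_def by blast
  define w where "w = sqrt (real D)"
  have w: "w > 1" "w ^ 2 = real D" using D by (auto simp: w_def)
  define e where "e = real_of_int x1 + real_of_int (int y1) * w"
  have ein: "e \<in> pell_real D ` pell_solutions D"
    using x1 by (intro image_eqI[of _ _ "(x1, int y1)"]) (auto simp: pell_real_def pell_solutions_def e_def w_def)
  have x1e: "real_of_int x1 \<le> e" using w by (simp add: e_def)
  have e1: "e > 1"
  proof -
    have "real_of_int x1 \<ge> 1" "real_of_int (int y1) * w > 0" using x1 w by auto
    then show ?thesis unfolding e_def by linarith
  qed
  have sub: "g \<in> {s * e powi n | s n. s \<in> {1, -1}}"
    if g: "g \<in> pell_real D ` pell_solutions D" "g > 0" for g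
  proof -
    \<comment> \<open>Division with remainder: dividing by \<open>e powi n\<close> brings
      \<open>g\<close> into the range from \<open>1\<close> up to, but excluding, \<open>e\<close>,
      where minimality leaves only \<open>1\<close>.\<close>
    define n where "n = \<lfloor>ln g / ln e\<rfloor>"
    have le: "ln e > 0" using e1 by simp
    define h where "h = g * inverse (e powi n)"
    have en: "e powi n > 0" using e1 by simp
    have hG: "h \<in> pell_real D ` pell_solutions D"
      unfolding h_def by (rule pell_real_mult[OF g(1) pell_real_inverse[OF pell_real_powi[OF ein]]])
    have hp: "h > 0" unfolding h_def using g en by simp
    have lnh: "ln h = ln g - real_of_int n * ln e"
    proof -
      have "ln (e powi n) = real_of_int n * ln e" using e1 by (subst powr_real_of_int'[symmetric]) (auto simp: ln_powr)
      moreover have "h = g / e powi n" by (simp add: h_def divide_inverse)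
      ultimately show ?thesis by (simp only: ln_divide_pos[OF g(2) en])
    qed
    have "real_of_int n \<le> ln g / ln e" "ln g / ln e < real_of_int n + 1" by (auto simp: n_def)
    then have "real_of_int n * ln e \<le> ln g" "ln g < (real_of_int n + 1) * ln e"
      using le by (simp_all add: le_divide_eq divide_less_eq)
    then have "0 \<le> ln h" "ln h < ln e" unfolding lnh by (auto simp: algebra_simps)
    then have h1: "1 \<le> h" "h < e" using hp e1 by (auto simp: ln_less_cancel_iff)
    have "h = 1"
    proof (rule ccontr)
      assume "h \<noteq> 1"
      then have hgt: "h > 1" using h1 by simp
      obtain T U where TU: "T ^ 2 - int D * U ^ 2 = 1" "h = real_of_int T + real_of_int U * w"
        using hG by (auto simp: pell_real_def pell_solutions_def w_def)
      have "h * (real_of_int T - real_of_int U * w) = real_of_int (T ^ 2 - int D * U ^ 2)"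
        unfolding TU(2) by (simp add: w(2)[symmetric] power2_eq_square algebra_simps)
      then have prod: "h * (real_of_int T - real_of_int U * w) = 1" using TU by simp
      \<comment> \<open>The conjugate \<open>1 / h\<close> is positive and smaller than
        \<open>h\<close>; the sum and the difference of the two show that \<open>T\<close> and
        \<open>U\<close> are positive.\<close>
      then have conj: "real_of_int T - real_of_int U * w = 1 / h" using hp by (simp add: field_simps)
      have "1 / h < 1" "1 / h > 0" using hgt by auto
      then have "real_of_int T > 0" "real_of_int U * w > 0" using conj TU(2) hgt by linarith+
      then have TU0: "T > 0" "U > 0" using w by (auto simp: zero_less_mult_iff)
      then have "P (nat U)" unfolding P_def using TU(1) by auto
      then have "y1 \<le> nat U" unfolding y1_def by (rule Least_le)
      then have yU: "int y1 \<le> U" using TU0 by linarith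
      then have "(int y1) ^ 2 \<le> U ^ 2" by (intro power_mono) auto
      then have "int D * (int y1) ^ 2 \<le> int D * U ^ 2" by (intro mult_left_mono) auto
      then have "x1 ^ 2 \<le> T ^ 2" using x1(3) TU(1) by linarith
      then have xT: "x1 \<le> T" by (rule power2_le_imp_le) (use TU0 in simp)
      have "real_of_int (int y1) \<le> real_of_int U" using yU by (simp only: of_int_le_iff)
      then have "real_of_int (int y1) * w \<le> real_of_int U * w" using w by (intro mult_right_mono) auto
      then have "e \<le> h" unfolding e_def TU(2) using xT by (intro add_mono) auto
      then show False using h1 by simp
    qed
    then have "g = 1 * e powi n" using en by (simp add: h_def field_simps)
    then show ?thesis by blast
  qed
  have "is_pell_fundamental D e"
    unfolding is_pell_fundamental_def
  proof (intro conjI e1 equalityI subsetI)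
    fix g assume g: "g \<in> pell_real D ` pell_solutions D"
    have g0: "g \<noteq> 0"
    proof
      assume "g = 0"
      obtain T U where TU: "T ^ 2 - int D * U ^ 2 = 1" "g = real_of_int T + real_of_int U * w"
        using g by (auto simp: pell_real_def pell_solutions_def w_def)
      have "g * (real_of_int T - real_of_int U * w) = real_of_int (T ^ 2 - int D * U ^ 2)"
        unfolding TU(2) by (simp add: w(2)[symmetric] power2_eq_square algebra_simps)
      then show False using TU \<open>g = 0\<close> by simp
    qed
    show "g \<in> {s * e powi n | s n. s \<in> {1, -1}}"
    proof (cases "g > 0")
      case True
      then show ?thesis using sub g by blast
    next
      case False
      then have "- g \<in> {s * e powi n | s n. s \<in> {1, -1}}"
        using g0 g by (intro sub pell_real_uminus) auto
      then obtain s n where "- g = s * e powi n" "s = 1 \<or> s = -1" by auto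
      then have "g = (- s) * e powi n" "- s = 1 \<or> - s = -1" by auto
      then show ?thesis by blast
    qed
  next
    fix g assume "g \<in> {s * e powi n | s n. s \<in> {1, -1}}"
    then show "g \<in> pell_real D ` pell_solutions D"
      using ein pell_real_powi pell_real_uminus by fastforce
  qed
  then have fund: "pell_fundamental D = e" by (rule pell_fundamental_eqI)
  have "x1 > 1"
  proof (rule ccontr)
    assume "\<not> x1 > 1"
    then have "x1 = 1" using x1(2) by simp
    then show False using x1 D by simp
  qed
  then show ?thesis using x1 x1e fund by (intro exI[of _ x1] exI[of _ "int y1"]) auto
qed

section \<open>Splitting a solution into coprime factors\<close>

lemma coprime_mult_eq_times_square:
  fixes x y D U :: nat
  assumes cop: "coprime x y" and eq: "x * y = D * U ^ 2" and pos: "x > 0" "y > 0"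
  shows "\<exists>a b u v. x = a * u ^ 2 \<and> y = b * v ^ 2 \<and> D = a * b"
proof -
  have "D dvd x * y" using eq by simp
  \<comment> \<open>Once \<open>D\<close> is distributed over \<open>x\<close> and \<open>y\<close>,
    the remaining cofactors are coprime with product \<open>U^2\<close>, hence squares.\<close>
  then obtain a b where D: "D = a * b" "a dvd x" "b dvd y" using division_decomp by blast
  obtain x' where x: "x = a * x'" using D(2) by (elim dvdE)
  obtain y' where y: "y = b * y'" using D(3) by (elim dvdE)
  have "a * b * (x' * y') = a * b * U ^ 2" using eq by (simp add: D(1) x y mult_ac)
  moreover have "a > 0" "b > 0" using pos x y by (auto intro: gr0I)
  ultimately have "x' * y' = U ^ 2" by simp
  then have "is_square (x' * y')" by (auto simp: is_nth_power_def)
  moreover have "coprime x' y'" using cop by (simp add: x y)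
  moreover have "x' > 0" "y' > 0" using pos x y by (auto intro: gr0I)
  ultimately have "is_square x'" "is_square y'"
    using is_nth_power_mult_coprime_natD by blast+
  then obtain u v where "x' = u ^ 2" "y' = v ^ 2" by (auto simp: is_nth_power_def)
  then show ?thesis using x y D(1) by blast
qed

text \<open>For even \<open>T\<close> the factors \<open>T - 1\<close> and \<open>T + 1\<close> are
  coprime; for odd \<open>T\<close> their halves are, and then either \<open>U\<close> is even or
  \<open>4\<close> divides \<open>D\<close>. The factors differ by \<open>2\<close> or
  \<open>1\<close>. Exchanging them changes the sign of \<open>c\<close> and achieves
  \<open>a \<le> b\<close>, the order in which the box estimate is stated.\<close>

lemma pell_solution_factorisation:
  fixes T U :: int and D :: nat
  assumes T: "T > 1" and U: "U > 0" and eq: "T ^ 2 - int D * U ^ 2 = 1" and D: "D > 0"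
  shows "\<exists>a b u v c :: int. 0 < a \<and> a \<le> b \<and> 0 < u \<and> 0 < v \<and> coprime a b \<and> coprime u v \<and>
    c \<in> {-2, -1, 1, 2} \<and> b * v ^ 2 - a * u ^ 2 = c \<and> (int D = a * b \<or> int D = 4 * (a * b)) \<and>
    a * u ^ 2 \<le> T + 1"
proof -
  have core: ?thesis
    if x: "x > 0" "y > 0" "coprime x y" "x * y = D' * U' ^ 2" "D = D' \<or> D = 4 * D'"
      "int y - int x = c" "c = 1 \<or> c = 2" "int y \<le> T + 1" for x y D' U' :: nat and c :: int
  proof -
    obtain a b u v where abuv: "x = a * u ^ 2" "y = b * v ^ 2" "D' = a * b"
      using coprime_mult_eq_times_square[OF x(3,4,1,2)] by blast
    have pos: "a > 0" "b > 0" "u > 0" "v > 0" using x(1,2) abuv by (auto intro: gr0I)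
    have "coprime (a * u ^ 2) (b * v ^ 2)" using x(3) abuv by simp
    then have cop: "coprime a b" "coprime u v" by auto
    have e: "int b * int v ^ 2 - int a * int u ^ 2 = c" using x(6) abuv by simp
    have D': "int D = int a * int b \<or> int D = 4 * (int a * int b)" using x(5) abuv by auto
    have le: "int a * int u ^ 2 \<le> T + 1" "int b * int v ^ 2 \<le> T + 1"
    proof -
      show "int b * int v ^ 2 \<le> T + 1" using x(8) abuv by simp
      then show "int a * int u ^ 2 \<le> T + 1" using e x(7) by linarith
    qed
    show ?thesis
    proof (cases "a \<le> b")
      case True
      show ?thesis
        by (rule exI[of _ "int a"], rule exI[of _ "int b"], rule exI[of _ "int u"], rule exI[of _ "int v"], rule exI[of _ c])
          (use True pos cop e D' le x(7) in auto)
    next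
      case False
      show ?thesis
        by (rule exI[of _ "int b"], rule exI[of _ "int a"], rule exI[of _ "int v"], rule exI[of _ "int u"], rule exI[of _ "- c"])
          (use False pos cop e D' le x(7) in \<open>auto simp: coprime_commute mult.commute\<close>)
    qed
  qed
  define t where "t = nat T"
  define w where "w = nat U"
  have t: "T = int t" "t > 1" and w: "U = int w" "w > 0" using T U by (auto simp: t_def w_def)
  have eqn: "t ^ 2 = D * w ^ 2 + 1"
  proof -
    have "int (t ^ 2) = int (D * w ^ 2 + 1)" using eq by (simp add: t w)
    then show ?thesis by (simp only: of_nat_eq_iff)
  qed
  have prod: "(t - 1) * (t + 1) = D * w ^ 2"
    using eqn t(2) by (simp add: power2_eq_square algebra_simps diff_mult_distrib)
  show ?thesis
  proof (cases "even t")
    case True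
    have "coprime (t - 1) (t + 1)"
    proof -
      have "gcd (t - 1) (t + 1) dvd (t + 1) - (t - 1)" by (rule dvd_diff_nat[OF gcd_dvd2 gcd_dvd1])
      then have g2: "gcd (t - 1) (t + 1) dvd 2" using t by simp
      have "odd (gcd (t - 1) (t + 1))" using True t by (metis dvd_trans even_Suc gcd_dvd2 Suc_eq_plus1)
      moreover have "gcd (t - 1) (t + 1) = 1 \<or> gcd (t - 1) (t + 1) = 2"
        using g2 two_is_prime_nat unfolding prime_nat_iff by blast
      ultimately have "gcd (t - 1) (t + 1) = 1" by (metis dvd_refl)
      then show ?thesis by (simp add: coprime_iff_gcd_eq_1)
    qed
    then show ?thesis
      using core[of "t - 1" "t + 1" D w 2] prod t by (simp add: of_nat_diff)
  next
    case False
    then obtain x where x: "t = 2 * x + 1" by (elim oddE)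
    have x0: "x > 0" using t x by simp
    have cop: "coprime x (x + 1)" by simp
    have 4: "4 * (x * (x + 1)) = D * w ^ 2" using prod by (simp add: x algebra_simps)
    show ?thesis
    proof (cases "even w")
      case True
      then obtain w' where w': "w = 2 * w'" by (elim evenE)
      have "x * (x + 1) = D * w' ^ 2" using 4 by (simp add: w' power2_eq_square)
      then show ?thesis using core[of x "x + 1" D w' 1] x0 cop t x by simp
    next
      case odd: False
      have "4 dvd D * w ^ 2" using 4 by (metis dvd_triv_left)
      moreover have "coprime (4::nat) (w ^ 2)"
      proof -
        have "coprime 2 w" using odd by (simp add: coprime_left_2_iff_odd)
        then have "coprime (2 ^ 2) (w ^ 2)" by (simp only: coprime_power_left_iff coprime_power_right_iff) simp
        then show ?thesis by simp
      qed
      ultimately have "4 dvd D" by (simp add: coprime_dvd_mult_left_iff)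
      then obtain D' where D': "D = 4 * D'" by (elim dvdE)
      then have "x * (x + 1) = D' * w ^ 2" using 4 by simp
      then show ?thesis using core[of x "x + 1" D' w 1] x0 cop t x D' by simp
    qed
  qed
qed

subsection \<open>Summation over dyadic boxes\<close>

lemma dyadic_nat_index:
  fixes a :: int and R :: real
  assumes "a \<ge> 1" "real_of_int a \<le> R"
  obtains i :: nat where "2 ^ i \<le> real_of_int a" "real_of_int a < 2 * 2 ^ i" "i \<le> nat \<lfloor>log 2 R\<rfloor>"
proof -
  have "1 \<le> nat a" using assms by simp
  then have "\<exists>i. 2 ^ i \<le> nat a \<and> nat a < 2 ^ (i + 1)" by (rule ex_power_ivl1[OF order_refl])
  then obtain i :: nat where i: "2 ^ i \<le> nat a" "nat a < 2 ^ (i + 1)" by blast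
  have "real (2 ^ i) \<le> real (nat a)" "real (nat a) < real (2 ^ (i + 1))"
    using i by (simp_all only: of_nat_le_iff of_nat_less_iff)
  then have b: "2 ^ i \<le> real_of_int a" "real_of_int a < 2 * 2 ^ i" using assms by simp_all
  have "2 ^ i \<le> R" using b assms by linarith
  then have "real i \<le> log 2 R" by (rule le_log_of_power) simp
  then have "int i \<le> \<lfloor>log 2 R\<rfloor>" by (simp add: le_floor_iff)
  then show ?thesis using that b by (metis nat_int nat_mono)
qed

definition small_pell :: "real \<Rightarrow> real \<Rightarrow> nat set" where
  "small_pell \<theta> X = {D. 1 < D \<and> real D \<le> X \<and> \<not> is_square D \<and> pell_fundamental D \<le> real D powr \<theta>}"

text \<open>The box estimate asks for \<open>A U^2 \<le> (A B) powr \<theta>'\<close>, but only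
  \<open>A U^2 \<le> 2 X powr \<theta>\<close> is known, and \<open>A B\<close> may be much smaller
  than \<open>X\<close>. Boxes with \<open>A B < X powr (1 - \<rho>)\<close> are therefore counted
  trivially; in the others the gap between \<open>\<theta>\<close> and \<open>\<theta>' < 3\<close>
  pays for the loss.\<close>

lemma card_small_pell_fundamental_bound:
  fixes \<theta> :: real
  assumes \<theta>: "0 \<le> \<theta>" "\<theta> < 3"
  shows "\<exists>C c X0. c > 0 \<and> (\<forall>X\<ge>X0. real (card (small_pell \<theta> X)) \<le> C * (3 * log 2 X + 2) ^ 3 * X powr (1 - c))"
proof -
  define \<theta>' where "\<theta>' = (3 + \<theta>) / 2"
  \<comment> \<open>\<open>\<theta>' = \<theta> + 2 \<eta>\<close>: one \<open>\<eta>\<close>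
    absorbs the factor \<open>2\<close> as soon as \<open>X powr \<eta> \<ge> 2\<close>, the other
    pays for \<open>\<rho> \<theta>' \<le> 3 \<rho> = \<eta>\<close>.\<close>
  define \<eta> where "\<eta> = (3 - \<theta>) / 4"
  define \<rho> where "\<rho> = \<eta> / 3"
  have \<theta>': "\<theta>' < 3" using \<theta> by (simp add: \<theta>'_def)
  have \<eta>: "\<eta> > 0" using \<theta> by (simp add: \<eta>_def)
  have \<rho>: "\<rho> > 0" "\<rho> < 1" using \<theta> by (simp_all add: \<rho>_def \<eta>_def)
  have exps: "\<theta> + \<eta> \<le> (1 - \<rho>) * \<theta>'"
  proof -
    have "\<rho> * \<theta>' \<le> \<rho> * 3" using \<rho> \<theta>' by (intro mult_left_mono) auto
    then have "\<rho> * \<theta>' \<le> \<eta>" by (simp add: \<rho>_def)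
    moreover have "\<theta>' = \<theta> + 2 * \<eta>" by (simp add: \<theta>'_def \<eta>_def field_simps)
    moreover have "(1 - \<rho>) * \<theta>' = \<theta>' - \<rho> * \<theta>'" by (simp add: algebra_simps)
    ultimately show ?thesis by linarith
  qed
  from near_pell_box_bound[OF \<theta>'] obtain C c where C: "C \<ge> 1" and c: "c > 0" "c < 1"
    and box: "\<forall>A B U k. A \<ge> 1 \<longrightarrow> B \<ge> A \<longrightarrow> U \<ge> 1 \<longrightarrow>
    A * U ^ 2 \<le> (A * B) powr \<theta>' \<longrightarrow> k \<noteq> 0 \<longrightarrow> \<bar>k\<bar> \<le> 2 \<longrightarrow>
    real (card (near_pell_box A B U k)) \<le> C * (A * B) powr (1 - c)"
    by (elim exE conjE) (rule that)
  define c' where "c' = min \<rho> c"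
  have c': "c' > 0" "c' \<le> c" "c' \<le> \<rho>" using \<rho> c by (auto simp: c'_def)
  define C' where "C' = max C 4"
  define X0 where "X0 = max 2 (2 powr (1 / \<eta>))"
  have main: "real (card (small_pell \<theta> X)) \<le> 8 * C' * (3 * log 2 X + 2) ^ 3 * X powr (1 - c')"
    if X: "X \<ge> X0" for X
  proof -
    have X2: "X \<ge> 2" and "2 powr (1 / \<eta>) \<le> X" using X by (auto simp: X0_def)
    then have "(2 powr (1 / \<eta>)) powr \<eta> \<le> X powr \<eta>" using \<eta> by (intro powr_mono2) auto
    then have X\<eta>: "2 \<le> X powr \<eta>" using \<eta> by (simp add: powr_powr)
    \<comment> \<open>A common bound for \<open>a\<close>, \<open>b\<close> and \<open>u\<close>:
      the first two are at most \<open>X\<close>, and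
      \<open>u^2 \<le> 2 X powr \<theta> \<le> 2 X^3\<close>.\<close>
    define R where "R = 2 * X ^ 3"
    define L where "L = nat \<lfloor>log 2 R\<rfloor>"
    have R1: "R \<ge> 1" proof -
      have "1 \<le> X ^ 3" using X2 by (intro one_le_power) auto
      then show ?thesis by (simp add: R_def)
    qed
    have X\<theta>3: "X powr \<theta> \<le> X ^ 3"
    proof -
      have "X powr \<theta> \<le> X powr 3" using X2 \<theta> by (intro powr_mono) auto
      then show ?thesis using X2 by (simp add: powr_numeral)
    qed
    have XR: "X \<le> R"
    proof -
      have "X ^ 1 \<le> X ^ 3" using X2 by (intro power_increasing) auto
      then show ?thesis using X2 by (simp add: R_def)
    qed
    define Idx where "Idx = {(i, j, l, k). i \<le> L \<and> j \<le> L \<and> l \<le> L \<and> k \<in> {-2, -1, 1, 2 :: int} \<and> i \<le> j \<and>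
      2 ^ i * 2 ^ j \<le> X \<and> 2 ^ i * (2 ^ l) ^ 2 \<le> 2 * X powr \<theta>}"
    define W where "W = (\<Union>(i, j, l, k)\<in>Idx. near_pell_box (2 ^ i) (2 ^ j) (2 ^ l) k)"
    have IdxS: "Idx \<subseteq> {..L} \<times> {..L} \<times> {..L} \<times> {-2, -1, 1, 2}" by (auto simp: Idx_def)
    then have finI: "finite Idx" by (rule finite_subset) auto
    have "card Idx \<le> card ({..L} \<times> {..L} \<times> {..L} \<times> {-2, -1, 1, 2 :: int})"
      by (rule card_mono[OF _ IdxS]) auto
    also have "\<dots> = 4 * (L + 1) ^ 3" by (simp add: card_cartesian_product power3_eq_cube algebra_simps)
    finally have cI: "card Idx \<le> 4 * (L + 1) ^ 3" .
    have finW: "finite W"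
      unfolding W_def using finI card_near_pell_box_trivial(1) by auto
    have each: "real (card (near_pell_box (2 ^ i) (2 ^ j) (2 ^ l) k)) \<le> C' * X powr (1 - c')"
      if "(i, j, l, k) \<in> Idx" for i j l :: nat and k :: int
    proof -
      define A B U :: real where "A = 2 ^ i" and "B = 2 ^ j" and "U = 2 ^ l"
      have idx: "i \<le> j" "A * B \<le> X" "A * U ^ 2 \<le> 2 * X powr \<theta>" "k \<in> {-2, -1, 1, 2}"
        using that by (auto simp: Idx_def A_def B_def U_def)
      have A: "A \<ge> 1" and U: "U \<ge> 1" and B: "B \<ge> 1" by (auto simp: A_def U_def B_def)
      have AB: "A \<le> B" using idx(1) by (simp add: A_def B_def power_increasing)
      have Y1: "A * B \<ge> 1" using mult_mono[of 1 A 1 B] A B by simp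
      have "real (card (near_pell_box A B U k)) \<le> C' * X powr (1 - c')"
      proof (cases "A * B \<ge> X powr (1 - \<rho>)")
        case True
        have "A * U ^ 2 \<le> X powr \<eta> * X powr \<theta>" using idx(3) X\<eta> mult_right_mono[of 2 "X powr \<eta>" "X powr \<theta>"] by simp
        also have "\<dots> = X powr (\<theta> + \<eta>)" by (simp add: powr_add mult.commute)
        also have "\<dots> \<le> X powr ((1 - \<rho>) * \<theta>')" using X2 exps by (intro powr_mono) auto
        also have "\<dots> = (X powr (1 - \<rho>)) powr \<theta>'" by (simp add: powr_powr)
        also have "\<dots> \<le> (A * B) powr \<theta>'" using True \<theta> by (intro powr_mono2) (auto simp: \<theta>'_def)
        finally have T: "A * U ^ 2 \<le> (A * B) powr \<theta>'" .
        have "real (card (near_pell_box A B U k)) \<le> C * (A * B) powr (1 - c)"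
          using box[rule_format, OF A AB U T] idx(4) by auto
        also have "\<dots> \<le> C' * X powr (1 - c)"
          using idx(2) Y1 c C by (intro mult_mono powr_mono2) (auto simp: C'_def)
        also have "\<dots> \<le> C' * X powr (1 - c')"
          using X2 c' C by (intro mult_left_mono powr_mono) (auto simp: C'_def)
        finally show ?thesis .
      next
        case False
        have "real (card (near_pell_box A B U k)) \<le> 4 * (A * B)" using card_near_pell_box_trivial(2)[OF A B] .
        also have "\<dots> \<le> C' * X powr (1 - \<rho>)"
          using False Y1 by (intro mult_mono) (auto simp: C'_def)
        also have "\<dots> \<le> C' * X powr (1 - c')"
          using X2 c' by (intro mult_left_mono powr_mono) (auto simp: C'_def)
        finally show ?thesis .
      qed
      then show ?thesis by (simp add: A_def B_def U_def)
    qed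
    have cW: "real (card W) \<le> 4 * (real L + 1) ^ 3 * (C' * X powr (1 - c'))"
    proof -
      have "card W \<le> (\<Sum>z\<in>Idx. card (case z of (i, j, l, k) \<Rightarrow> near_pell_box (2 ^ i) (2 ^ j) (2 ^ l) k))"
        unfolding W_def using finI by (rule card_UN_le)
      then have "real (card W) \<le> real (\<Sum>z\<in>Idx. card (case z of (i, j, l, k) \<Rightarrow> near_pell_box (2 ^ i) (2 ^ j) (2 ^ l) k))"
        by (simp only: of_nat_le_iff)
      also have "\<dots> = (\<Sum>z\<in>Idx. real (card (case z of (i, j, l, k) \<Rightarrow> near_pell_box (2 ^ i) (2 ^ j) (2 ^ l) k)))"
        by (rule of_nat_sum)
      also have "\<dots> \<le> (\<Sum>z\<in>Idx. C' * X powr (1 - c'))" using each by (intro sum_mono) auto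
      also have "\<dots> = real (card Idx) * (C' * X powr (1 - c'))" by simp
      also have "real (card Idx) \<le> real (4 * (L + 1) ^ 3)" using cI by (simp only: of_nat_le_iff)
      then have "real (card Idx) * (C' * X powr (1 - c')) \<le> real (4 * (L + 1) ^ 3) * (C' * X powr (1 - c'))"
        by (intro mult_right_mono) (auto simp: C'_def)
      finally show ?thesis by (simp add: add.commute)
    qed
    have Llog: "real L + 1 \<le> 3 * log 2 X + 2"
    proof -
      have "log 2 R = 1 + 3 * log 2 X" unfolding R_def using X2 by (simp add: log_mult log_nat_power)
      moreover have "real L \<le> log 2 R" unfolding L_def using R1 by simp
      ultimately show ?thesis by linarith
    qed
    \<comment> \<open>\<open>D\<close> is recovered from \<open>(a, b)\<close> as \<open>a b\<close>
      or \<open>4 a b\<close>, so a pair accounts for at most two values of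
      \<open>D\<close>.\<close>
    define p q where "p = (\<lambda>(a, b). nat (a * b))" and "q = (\<lambda>(a, b). nat (4 * (a * b)))"
    have sub: "(small_pell \<theta> X) \<subseteq> p ` W \<union> q ` W"
    proof clarify
      fix D assume "D \<in> small_pell \<theta> X" "D \<notin> q ` W"
      then have D: "1 < D" "real D \<le> X" "\<not> is_square D" "pell_fundamental D \<le> real D powr \<theta>" "D \<notin> q ` W"
        by (auto simp: small_pell_def)
      obtain T V :: int where TV: "T > 1" "V > 0" "T ^ 2 - int D * V ^ 2 = 1" "real_of_int T \<le> pell_fundamental D"
        using pell_fundamental_solution[OF D(3,1)] by blast
      have "D > 0" using D(1) by simp
      from pell_solution_factorisation[OF TV(1-3) this] obtain a b u v k :: int where ab: "0 < a" "a \<le> b" and uv: "0 < u" "0 < v" and cop: "coprime a b" "coprime u v"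
        and k: "k \<in> {-2, -1, 1, 2}" and eq: "b * v ^ 2 - a * u ^ 2 = k" and Dab: "int D = a * b \<or> int D = 4 * (a * b)"
        and au: "a * u ^ 2 \<le> T + 1"
        by (elim exE conjE) (rule that)
      have "real D powr \<theta> \<le> X powr \<theta>" using D \<theta> by (intro powr_mono2) auto
      then have TX: "real_of_int T \<le> X powr \<theta>" using TV D by linarith
      have "real_of_int (a * u ^ 2) \<le> 2 * real_of_int T" using au TV(1) by linarith
      then have au2: "real_of_int a * real_of_int u ^ 2 \<le> 2 * X powr \<theta>" using TX by simp
      have abD: "a * b \<le> int D" using Dab ab by auto
      then have abX: "real_of_int a * real_of_int b \<le> X"
        using D(2) by (metis of_int_le_iff of_int_mult of_int_of_nat_eq order_trans)
      have a1: "real_of_int a \<ge> 1" "real_of_int b \<ge> 1" using ab by auto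
      have aR: "real_of_int a \<le> R" "real_of_int b \<le> R"
      proof -
        have "real_of_int a * 1 \<le> real_of_int a * real_of_int b" using a1 by (intro mult_left_mono) auto
        then show "real_of_int a \<le> R" using abX XR by linarith
        have "1 * real_of_int b \<le> real_of_int a * real_of_int b" using a1 by (intro mult_right_mono) auto
        then show "real_of_int b \<le> R" using abX XR by linarith
      qed
      have uR: "real_of_int u \<le> R"
      proof -
        have u1: "1 \<le> real_of_int u" using uv by simp
        have "real_of_int u * 1 \<le> real_of_int u * real_of_int u" using u1 by (intro mult_left_mono) auto
        moreover have "1 * real_of_int u ^ 2 \<le> real_of_int a * real_of_int u ^ 2" using a1 by (intro mult_right_mono) auto
        ultimately show ?thesis using au2 X\<theta>3 by (simp add: R_def power2_eq_square)
      qed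
      obtain i where i: "2 ^ i \<le> real_of_int a" "real_of_int a < 2 * 2 ^ i" "i \<le> L"
        using dyadic_nat_index[of a R] ab aR unfolding L_def by auto
      obtain j where j: "2 ^ j \<le> real_of_int b" "real_of_int b < 2 * 2 ^ j" "j \<le> L"
        using dyadic_nat_index[of b R] ab aR unfolding L_def by auto
      obtain l where l: "2 ^ l \<le> real_of_int u" "real_of_int u < 2 * 2 ^ l" "l \<le> L"
        using dyadic_nat_index[of u R] uv uR unfolding L_def by auto
      have "i \<le> j"
      proof (rule ccontr)
        assume "\<not> i \<le> j"
        then have "(2::real) ^ Suc j \<le> 2 ^ i" by (intro power_increasing) auto
        moreover have "real_of_int a \<le> real_of_int b" using ab by simp
        ultimately show False using i j by simp
      qed
      moreover have "2 ^ i * 2 ^ j \<le> X"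
      proof -
        have "(2::real) ^ i * 2 ^ j \<le> real_of_int a * real_of_int b" using i j a1 by (intro mult_mono) auto
        then show ?thesis using abX by linarith
      qed
      moreover have "2 ^ i * (2 ^ l) ^ 2 \<le> 2 * X powr \<theta>"
      proof -
        have "(2::real) ^ i * (2 ^ l) ^ 2 \<le> real_of_int a * real_of_int u ^ 2"
          using i l a1 by (intro mult_mono power_mono) auto
        then show ?thesis using au2 by linarith
      qed
      ultimately have I: "(i, j, l, k) \<in> Idx" using i j l k by (simp add: Idx_def)
      have "(a, b) \<in> near_pell_box (2 ^ i) (2 ^ j) (2 ^ l) k"
        unfolding near_pell_box_def using i j l cop uv eq by blast
      then have "(a, b) \<in> W" unfolding W_def using I by blast
      then have "p (a, b) \<in> p ` W" "q (a, b) \<in> q ` W" by blast+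
      moreover have "D = p (a, b) \<or> D = q (a, b)" using Dab by (auto simp: p_def q_def)
      ultimately show "D \<in> p ` W" using D(5) by auto
    qed
    have "card (small_pell \<theta> X)
      \<le> card (p ` W \<union> q ` W)" using finW by (intro card_mono[OF _ sub]) auto
    also have "\<dots> \<le> card (p ` W) + card (q ` W)" by (rule card_Un_le)
    also have "\<dots> \<le> card W + card W" using finW by (intro add_mono card_image_le)
    finally have "real (card (small_pell \<theta> X))
      \<le> 2 * real (card W)" by linarith
    also have "\<dots> \<le> 2 * (4 * (real L + 1) ^ 3 * (C' * X powr (1 - c')))" using cW by linarith
    also have "\<dots> = 8 * C' * (real L + 1) ^ 3 * X powr (1 - c')" by simp
    also have "\<dots> \<le> 8 * C' * (3 * log 2 X + 2) ^ 3 * X powr (1 - c')"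
      using Llog by (intro mult_right_mono mult_left_mono power_mono) (auto simp: C'_def)
    finally show ?thesis .
  qed
  show ?thesis
    by (rule exI[of _ "8 * C'"], rule exI[of _ c'], rule exI[of _ X0]) (use c' main in blast)
qed

theorem corollary6:
  fixes \<theta> :: real
  assumes "0 \<le> \<theta>" and "\<theta> < 3"
  shows "(\<lambda>X::real. real (card {D::nat. 1 < D \<and> real D \<le> X \<and> \<not> is_square D \<and>
            pell_fundamental D \<le> real D powr \<theta>})) \<in> o[at_top](\<lambda>X. X)"
proof -
  obtain C c X0 where c: "c > 0" and bound: "\<And>X. X \<ge> X0 \<Longrightarrow> real (card (small_pell \<theta> X)) \<le> C * (3 * log 2 X + 2) ^ 3 * X powr (1 - c)"
    using card_small_pell_fundamental_bound[OF assms] by blast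
  have "(\<lambda>X::real. real (card (small_pell \<theta> X))) \<in> O(\<lambda>X. C * (3 * log 2 X + 2) ^ 3 * X powr (1 - c))"
  proof (rule bigoI[of _ 1])
    show "\<forall>\<^sub>F X in at_top. norm (real (card (small_pell \<theta> X))) \<le> 1 * norm (C * (3 * log 2 X + 2) ^ 3 * X powr (1 - c))"
      using eventually_ge_at_top[of X0]
    proof eventually_elim
      case (elim X)
      note bound[OF elim]
      also have "C * (3 * log 2 X + 2) ^ 3 * X powr (1 - c) \<le> \<bar>C * (3 * log 2 X + 2) ^ 3 * X powr (1 - c)\<bar>"
        by (rule abs_ge_self)
      finally show ?case by (simp only: real_norm_def abs_of_nat mult_1)
    qed
  qed
  \<comment> \<open>The power saving beats the cube of the logarithm. Nothing is known about
    \<open>C\<close>, hence the absolute value above and the case distinction here.\<close>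
  also have "(\<lambda>X. C * (3 * log 2 X + 2) ^ 3 * X powr (1 - c)) \<in> o(\<lambda>X. X)"
  proof (cases "C = 0")
    case False
    have "(\<lambda>X::real. (3 * log 2 X + 2) ^ 3 * X powr (1 - c)) \<in> o(\<lambda>X. X)" using c by real_asymp
    then show ?thesis using False by (simp add: mult.assoc)
  qed simp
  finally show ?thesis by (simp add: small_pell_def)
qed

end
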